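(* A class of point equivalent fourth order ODEs $x^{(4)}=F(t,x,x',x'',x''')$ admits a totally geodesic paraconformal connection if and only if the Bryant-Wünschmann condition holds and $$4V'(K_2)+3V(K_2')=0.$$ Additionally, under the Bryant-Wünschmann condition, $4V'(K_2)+3V(K_2')=4V'(K_2)-3V(K_1)$.
   Context: On $J^3(\mathbb{R},\mathbb{R})$ with coordinates $t,x_0,x_1,x_2,x_3$, $\partial_i=\partial/\partial x_i$, let $X_F=\partial_t+x_1\partial_0+x_2\partial_1+x_3\partial_2+F\partial_3$; $M_F=J^3(\mathbb{R},\mathbb{R})/X_F$ is the (local) solution space with projection $\pi$. Point transformations are transformations of the variables $(t,x)$. A prime on a function denotes its derivative along $X_F$; on a vector field it denotes the bracket with $X_F$. Let $g$ be a nowhere vanishing local solution of $X_F(g)=\frac g4\partial_3F$, $V=g\partial_3$, $V^{(j)}=\mathrm{ad}_{X_F}^jV$. The functions $K_0,K_1,K_2$ are defined by $V^{(4)}=-K_0V+K_1V'-K_2V''$. Bryant-Wünschmann condition: the two Wünschmann invariants of the equation vanish, i.e. there are (locally) nowhere vanishing functions $f,\tilde g$ on $J^3(\mathbb{R},\mathbb{R})$ with $\mathrm{ad}_{fX_F}^{4}\tilde g\partial_3=0\mod X_F$; equivalently $K_0+\frac3{10}K_1'-\frac9{100}K_2^2=0$ and $K_1+K_2'=0$. Under this condition the lines $\mathbb{R}\pi_*\partial_3$ along the fibre of $\pi$ over $y\in M_F$ lie on a rational normal curve of degree 3 in $P(T_yM_F)$, defining the canonical paraconformal structure on $M_F$: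 a field of cones, locally consisting of multiples of $V(s)=V_0+sV_1+s^2V_2+s^3V_3$ with $V_0,\ldots,V_3$ a frame on $M_F$. A connection $\nabla$ on $M_F$ (possibly with torsion) is paraconformal if $\nabla_YV(s)\in\mathrm{span}\{V(s),\frac{d}{ds}V(s)\}$ for all $s$ and all vector fields $Y$. The class admits a totally geodesic paraconformal connection if the canonical paraconformal structure exists (Bryant-Wünschmann condition) and there is a paraconformal connection on $M_F$ for which the projections to $M_F$ of the integral manifolds of $\mathcal{D}_3=\mathrm{span}\{\partial_3,\partial_2,\partial_1\}$ are totally geodesic submanifolds. *)

theory Defs
  imports "HOL-Analysis.Analysis"
begin

text \<open>
  Manifolds occur only locally: they are open subsets of Euclidean spaces, and vector fields are
  vector-valued functions, of which only the values on the open set in question matter.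
\<close>

primrec Ck_on :: "nat \<Rightarrow> 'a set \<Rightarrow> ('a::euclidean_space \<Rightarrow> 'b::real_normed_vector) \<Rightarrow> bool" where
  "Ck_on 0 S f \<longleftrightarrow> continuous_on S f"
| "Ck_on (Suc k) S f \<longleftrightarrow>
     (\<forall>x\<in>S. f differentiable (at x)) \<and> (\<forall>v. Ck_on k S (\<lambda>x. frechet_derivative f (at x) v))"

definition smooth_on :: "'a set \<Rightarrow> ('a::euclidean_space \<Rightarrow> 'b::real_normed_vector) \<Rightarrow> bool" where
  "smooth_on S f \<longleftrightarrow> (\<forall>k. Ck_on k S f)"

definition dir_deriv ::
    "('a::euclidean_space \<Rightarrow> 'a) \<Rightarrow> ('a \<Rightarrow> 'b::real_normed_vector) \<Rightarrow> 'a \<Rightarrow> 'b" where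
  "dir_deriv X f p = frechet_derivative f (at p) (X p)"

definition lie_bracket :: "('a::euclidean_space \<Rightarrow> 'a) \<Rightarrow> ('a \<Rightarrow> 'a) \<Rightarrow> 'a \<Rightarrow> 'a" where
  "lie_bracket X Y p = dir_deriv X Y p - dir_deriv Y X p"

definition ad :: "('a::euclidean_space \<Rightarrow> 'a) \<Rightarrow> nat \<Rightarrow> ('a \<Rightarrow> 'a) \<Rightarrow> 'a \<Rightarrow> 'a" where
  "ad X j Y = (lie_bracket X ^^ j) Y"


subsection \<open>Fourth order equations and their solution spaces\<close>

text \<open>
  A point \<open>p\<close> of the jet space has the coordinates \<open>x\<^sub>i = p $ i\<close> for \<open>i = 0, 1, 2, 3\<close> and
  \<open>t = p $ 4\<close>; these are the five different elements of the index type.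
\<close>

type_synonym jet = "real^5"

definition coord_field :: "5 \<Rightarrow> jet \<Rightarrow> jet" where
  "coord_field i = (\<lambda>_. axis i 1)"

definition total_deriv :: "(jet \<Rightarrow> real) \<Rightarrow> jet \<Rightarrow> jet" where
  "total_deriv F p =
     coord_field 4 p + (p $ 1) *\<^sub>R coord_field 0 p + (p $ 2) *\<^sub>R coord_field 1 p
       + (p $ 3) *\<^sub>R coord_field 2 p + F p *\<^sub>R coord_field 3 p"

text \<open>
  The quotient of \<open>U\<close> by the integral curves of \<open>X\<^sub>F\<close>, in a chart: it is the open set \<open>\<pi> ` U\<close>.
  By the kernel condition \<open>\<pi>\<close> is a submersion, so that a fibre is a curve tangent to \<open>X\<^sub>F\<close>; being
  connected, it is a single integral curve.
\<close>

definition solution_space :: "(jet \<Rightarrow> real) \<Rightarrow> jet set \<Rightarrow> (jet \<Rightarrow> real^4) \<Rightarrow> bool" where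
  "solution_space F U \<pi> \<longleftrightarrow>
     open U \<and> smooth_on U \<pi> \<and>
     (\<forall>p\<in>U. {v. frechet_derivative \<pi> (at p) v = 0} = span {total_deriv F p}) \<and>
     (\<forall>y. connected {p\<in>U. \<pi> p = y})"

definition bryant_wuenschmann :: "(jet \<Rightarrow> real) \<Rightarrow> jet set \<Rightarrow> bool" where
  "bryant_wuenschmann F U \<longleftrightarrow>
     (\<forall>p\<in>U. \<exists>W f h. open W \<and> p \<in> W \<and> W \<subseteq> U \<and>
        smooth_on W f \<and> smooth_on W h \<and> (\<forall>q\<in>W. f q \<noteq> 0 \<and> h q \<noteq> 0) \<and>
        (\<forall>q\<in>W. ad (\<lambda>q. f q *\<^sub>R total_deriv F q) 4 (\<lambda>q. h q *\<^sub>R coord_field 3 q) q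
                 \<in> span {total_deriv F q}))"


subsection \<open>The canonical paraconformal structure\<close>

definition rational_normal :: "(nat \<Rightarrow> real^4 \<Rightarrow> real^4) \<Rightarrow> real \<Rightarrow> real^4 \<Rightarrow> real^4" where
  "rational_normal V s y = (\<Sum>i<4. s ^ i *\<^sub>R V i y)"

text \<open>
  A fibre of \<open>\<pi>\<close> gives infinitely many lines in each tangent space, and a rational normal curve
  of degree 3 is determined by six of its points. Hence the field of cones spanned by
  \<open>rational_normal V s\<close> does not depend on the choice of the frame \<open>V\<close>.
\<close>

definition canonical_frame ::
    "(jet \<Rightarrow> real) \<Rightarrow> jet set \<Rightarrow> (jet \<Rightarrow> real^4) \<Rightarrow> (nat \<Rightarrow> real^4 \<Rightarrow> real^4) \<Rightarrow> bool" where
  "canonical_frame F U \<pi> V \<longleftrightarrow>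
     solution_space F U \<pi> \<and>
     (\<forall>i<4. smooth_on (\<pi> ` U) (V i)) \<and>
     (\<forall>y\<in>\<pi> ` U. span ((\<lambda>i. V i y) ` {..<4}) = UNIV) \<and>
     (\<forall>p\<in>U. \<exists>s. frechet_derivative \<pi> (at p) (coord_field 3 p) \<in> span {rational_normal V s (\<pi> p)})"


subsection \<open>Connections\<close>

text \<open>
  A connection on an open set \<open>N\<close> is given by its Christoffel symbols, which form a smooth field
  of bilinear maps; they need not be symmetric.
\<close>

type_synonym 'a christoffel = "'a \<Rightarrow> 'a \<Rightarrow> 'a \<Rightarrow> 'a"

definition connection_on :: "'a::euclidean_space set \<Rightarrow> 'a christoffel \<Rightarrow> bool" where
  "connection_on N \<Gamma> \<longleftrightarrow> (\<forall>y\<in>N. bilinear (\<Gamma> y)) \<and> (\<forall>u v. smooth_on N (\<lambda>y. \<Gamma> y u v))"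

definition cov_deriv ::
    "'a::euclidean_space christoffel \<Rightarrow> ('a \<Rightarrow> 'a) \<Rightarrow> ('a \<Rightarrow> 'a) \<Rightarrow> 'a \<Rightarrow> 'a" where
  "cov_deriv \<Gamma> Y Z y = dir_deriv Y Z y + \<Gamma> y (Y y) (Z y)"

text \<open>The covariant derivative of a vector field \<open>Z\<close> along a map \<open>\<phi>\<close>.\<close>

definition cov_deriv_along ::
    "'a::euclidean_space christoffel \<Rightarrow> ('b::euclidean_space \<Rightarrow> 'a) \<Rightarrow> ('b \<Rightarrow> 'b) \<Rightarrow> ('b \<Rightarrow> 'a)
       \<Rightarrow> 'b \<Rightarrow> 'a" where
  "cov_deriv_along \<Gamma> \<phi> Y Z u = dir_deriv Y Z u + \<Gamma> (\<phi> u) (dir_deriv Y \<phi> u) (Z u)"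

text \<open>
  For an immersion \<open>\<phi>\<close> of the open set \<open>D\<close>: the derivative of a field tangent to the submanifold
  in a direction tangent to the submanifold is again tangent to it. For the connections and the
  submanifolds considered below, the second fundamental form is a product of two 1-forms, one of
  which has no zeros; so even in the presence of torsion it is zero as soon as it is zero on the
  diagonal, that is, as soon as geodesics tangent to the submanifold remain in it.
\<close>

definition totally_geodesic ::
    "'a::euclidean_space christoffel \<Rightarrow> 'b::euclidean_space set \<Rightarrow> ('b \<Rightarrow> 'a) \<Rightarrow> bool" where
  "totally_geodesic \<Gamma> D \<phi> \<longleftrightarrow>
     (\<forall>Y Z. smooth_on D Y \<longrightarrow> smooth_on D Z \<longrightarrow>
        (\<forall>u\<in>D. cov_deriv_along \<Gamma> \<phi> Y (dir_deriv Z \<phi>) u \<in> range (frechet_derivative \<phi> (at u))))"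

definition paraconformal_connection ::
    "(nat \<Rightarrow> real^4 \<Rightarrow> real^4) \<Rightarrow> (real^4) set \<Rightarrow> (real^4) christoffel \<Rightarrow> bool" where
  "paraconformal_connection V N \<Gamma> \<longleftrightarrow>
     connection_on N \<Gamma> \<and>
     (\<forall>Y. smooth_on N Y \<longrightarrow> (\<forall>s. \<forall>y\<in>N.
        cov_deriv \<Gamma> Y (rational_normal V s) y
          \<in> span {rational_normal V s y,
                  vector_derivative (\<lambda>s. rational_normal V s y) (at s)}))"

text \<open>
  The integral manifolds of the span of \<open>\<partial>\<^sub>3\<close>, \<open>\<partial>\<^sub>2\<close>, \<open>\<partial>\<^sub>1\<close> are the slices on which \<open>t\<close>
  and \<open>x\<^sub>0\<close> have constant values \<open>c\<close> and \<open>a\<close>, with \<open>x\<^sub>1\<close>, \<open>x\<^sub>2\<close>, \<open>x\<^sub>3\<close> as parameters.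
\<close>

definition slice :: "real \<Rightarrow> real \<Rightarrow> real^3 \<Rightarrow> jet" where
  "slice c a u = axis 4 c + axis 0 a + axis 1 (u $ 1) + axis 2 (u $ 2) + axis 3 (u $ 3)"

text \<open>
  A class of point equivalent equations is represented by any of its members: point
  transformations preserve the lines spanned by \<open>X\<^sub>F\<close>, the lines \<open>\<real> \<pi>\<^sub>* \<partial>\<^sub>3\<close>, and the slices above.
  As the solution space is a local object, the connection is required in a neighbourhood of each
  point. The domain \<open>W\<close> may be shrunk, so the parameter value \<open>s = \<infinity>\<close> need not be considered.
\<close>

definition admits_totally_geodesic_paraconformal_connection ::
    "(jet \<Rightarrow> real) \<Rightarrow> jet set \<Rightarrow> (jet \<Rightarrow> real^4) \<Rightarrow> bool" where
  "admits_totally_geodesic_paraconformal_connection F U \<pi> \<longleftrightarrow>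
     bryant_wuenschmann F U \<and>
     (\<forall>p\<in>U. \<exists>W V \<Gamma>. p \<in> W \<and> W \<subseteq> U \<and> canonical_frame F W \<pi> V \<and>
        paraconformal_connection V (\<pi> ` W) \<Gamma> \<and>
        (\<forall>c a. totally_geodesic \<Gamma> {u. slice c a u \<in> W} (\<lambda>u. \<pi> (slice c a u))))"

end

theory Submission
  imports Defs
begin

text \<open>
  Write \<open>v i\<close> for the projection of \<open>V\<^sup>(\<^sup>i\<^sup>)\<close> to the solution space and let a prime be the derivative along \<open>X\<close>.
  Then \<open>v i' = v (i + 1)\<close>, and the \<open>v i\<close> with \<open>i < 4\<close> form a moving frame along each solution. A connection
  is paraconformal iff \<open>\<nabla> (v 0) = \<alpha> v 0 + \<beta> v 1\<close> for 1-forms \<open>\<alpha>\<close>, \<open>\<beta>\<close> with \<open>\<alpha> X = 0\<close>, \<open>\<beta> X = 1\<close>. Differentiating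
  along \<open>X\<close> gives \<open>\<nabla> (v i)\<close> for all \<open>i\<close>; the slices are totally geodesic iff \<open>\<beta>\<close> vanishes on \<open>V 0\<close>, \<open>V 1\<close>, \<open>V 2\<close>,
  and comparison with \<open>v 4 = - K0 v 0 + K1 v 1 - K2 v 2\<close> yields \<open>\<alpha>' = - 3/2 \<beta>''\<close> and
  \<open>5 \<beta>''' + 2 K2 \<beta>' + K2' \<beta> = d K2\<close>. The values of this equation on \<open>V 0\<close> and \<open>V 1\<close> give
  \<open>\<beta> (V 3) = - V 0 (K2) / 5\<close> and \<open>4 V 1 (K2) + 3 V 0 (K2') = 0\<close>. Conversely, with this \<open>\<beta>\<close> and
  \<open>\<alpha> = - 3/2 \<beta>'\<close> the remaining components hold because of the Jacobi identities for the fields \<open>V i\<close> and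
  the Bryant-Wuenschmann condition, and the Christoffel symbols so defined are constant along the solutions,
  so that they descend to the solution space.
\<close>

section \<open>Smooth maps\<close>

text \<open>The constants come from the Leibniz rule. The fourth derivative of \<alpha> v 0 +
  \<beta> v 1 along \<open>X\<close> has to agree with \<nabla> of
  \<open>- K0 v 0 + K1 v 1 - K2 v 2\<close>. In the coefficient of \<open>v 3\<close> the terms with
  \<open>K2\<close> cancel and 4 \<alpha>' + 6 \<beta>'' = 0 remains; the coefficient of
  \<open>v 2\<close> contains 6 \<alpha>'' + 4 \<beta>''', that is - 5 \<beta>'''. Among the first
  four \<open>V i\<close>, only \<open>V 3\<close> can have a nonzero value of \<beta>, so one
  unknown function has to satisfy the equation on four fields. The converse is the harder half. The
  coefficients of \<open>v 0\<close> and \<open>v 1\<close> follow from the equation for \<beta> and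
  its derivatives by the Bryant-Wuenschmann condition, but the values of the equation on
  \<open>V 2\<close> and \<open>V 3\<close> need an elimination among the brackets of the
  \<open>V i\<close>, with derivatives up to the fifth order. It is carried out for formal power
  series, where differentiation has no smoothness conditions. A second obstacle is that the cone
  condition concerns every parameter, while one solution meets only some of them.\<close>

lemma frechet_derivative_eqI: "(f has_derivative f') (at x) \<Longrightarrow> frechet_derivative f (at x) = f'"
  using frechet_derivative_at by metis

lemma Ck_on_SucI:
  assumes "\<And>x. x \<in> S \<Longrightarrow> f differentiable (at x)"
    and "\<And>v. Ck_on k S (\<lambda>x. frechet_derivative f (at x) v)"
  shows "Ck_on (Suc k) S f"
  using assms by simp

text \<open>\<open>frechet_derivative\<close> is taken in the full space, so agreement on
  \<open>S\<close> carries over to derivatives because \<open>S\<close> is a neighbourhood of its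
  points. This lets each later rule replace a derivative by its formula on \<open>S\<close>.\<close>

lemma Ck_on_cong:
  fixes f g :: "'a::euclidean_space \<Rightarrow> 'b::real_normed_vector"
  assumes "open S" and "\<And>x. x \<in> S \<Longrightarrow> f x = g x"
  shows "Ck_on k S f \<longleftrightarrow> Ck_on k S g"
  using assms(2)
proof (induction k arbitrary: f g)
  case 0
  then show ?case by (simp cong: continuous_on_cong)
next
  case (Suc k)
  have imp: "Ck_on (Suc k) S g" if fg: "\<And>x. x \<in> S \<Longrightarrow> f x = g x" and f: "Ck_on (Suc k) S f"
    for f g :: "'a \<Rightarrow> 'b"
  proof (rule Ck_on_SucI)
    fix x assume x: "x \<in> S"
    then have "(f has_derivative frechet_derivative f (at x)) (at x)"
      using f by (intro frechet_derivative_works[THEN iffD1]) auto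
    then have "(g has_derivative frechet_derivative f (at x)) (at x)"
      by (rule has_derivative_transform_within_open[OF _ \<open>open S\<close> x]) (simp add: fg)
    then show "g differentiable (at x)" by (auto simp: differentiable_def)
  next
    fix v
    have "frechet_derivative f (at x) v = frechet_derivative g (at x) v" if "x \<in> S" for x
      using frechet_derivative_transform_within_open[of f x S g] f fg that \<open>open S\<close> by auto
    then show "Ck_on k S (\<lambda>x. frechet_derivative g (at x) v)"
      using Suc.IH[of "\<lambda>x. frechet_derivative f (at x) v" "\<lambda>x. frechet_derivative g (at x) v"] f by auto
  qed
  show ?case
  proof (rule iffI)
    show "Ck_on (Suc k) S g" if "Ck_on (Suc k) S f" by (rule imp[of f g]) (use that Suc.prems in auto)
    show "Ck_on (Suc k) S f" if "Ck_on (Suc k) S g" by (rule imp[of g f]) (use that Suc.prems in auto)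
  qed
qed

lemma Ck_on_eqI:
  "Ck_on k S f \<Longrightarrow> open S \<Longrightarrow> (\<And>x. x \<in> S \<Longrightarrow> g x = f x) \<Longrightarrow> Ck_on k S g"
  using Ck_on_cong by blast

lemma Ck_on_Suc_has_derivative:
  "Ck_on (Suc k) S f \<Longrightarrow> x \<in> S \<Longrightarrow> (f has_derivative frechet_derivative f (at x)) (at x)"
  by (intro frechet_derivative_works[THEN iffD1]) auto

lemma Ck_on_Suc_imp: "Ck_on (Suc k) S f \<Longrightarrow> Ck_on k S f"
proof (induction k arbitrary: f)
  case 0
  then show ?case
    by (auto intro!: continuous_at_imp_continuous_on differentiable_imp_continuous_within)
next
  case (Suc k)
  then show ?case by (metis Ck_on.simps(2))
qed

lemma Ck_on_subset: "Ck_on k S f \<Longrightarrow> T \<subseteq> S \<Longrightarrow> Ck_on k T f"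
  by (induction k arbitrary: f) (auto intro: continuous_on_subset)

lemma Ck_on_const [simp]: "Ck_on k S (\<lambda>_. c)"
  by (induction k arbitrary: c) auto

lemma Ck_on_add:
  assumes "open S" and "Ck_on k S f" and "Ck_on k S g"
  shows "Ck_on k S (\<lambda>x. f x + g x)"
  using assms(2,3)
proof (induction k arbitrary: f g)
  case 0
  then show ?case by (simp add: continuous_on_add)
next
  case (Suc k)
  have der: "((\<lambda>x. f x + g x) has_derivative
      (\<lambda>v. frechet_derivative f (at x) v + frechet_derivative g (at x) v)) (at x)" if "x \<in> S" for x
    using Suc.prems that by (intro has_derivative_add Ck_on_Suc_has_derivative)
  show ?case
  proof (rule Ck_on_SucI)
    show "(\<lambda>x. f x + g x) differentiable (at x)" if "x \<in> S" for x
      using der[OF that] by (auto simp: differentiable_def)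
    fix v
    have "Ck_on k S (\<lambda>x. frechet_derivative f (at x) v + frechet_derivative g (at x) v)"
      using Suc by auto
    then show "Ck_on k S (\<lambda>x. frechet_derivative (\<lambda>x. f x + g x) (at x) v)"
      by (rule Ck_on_eqI[OF _ assms(1)]) (simp add: frechet_derivative_eqI[OF der])
  qed
qed

lemma (in bounded_bilinear) Ck_on:
  fixes f :: "'d::euclidean_space \<Rightarrow> 'a" and g :: "'d \<Rightarrow> 'b"
  assumes "open S" and "Ck_on k S f" and "Ck_on k S g"
  shows "Ck_on k S (\<lambda>x. prod (f x) (g x))"
  using assms(2,3)
proof (induction k arbitrary: f g)
  case 0
  then show ?case by (simp add: continuous_on)
next
  case (Suc k)
  have der: "((\<lambda>x. prod (f x) (g x)) has_derivative
      (\<lambda>v. prod (f x) (frechet_derivative g (at x) v) + prod (frechet_derivative f (at x) v) (g x))) (at x)"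
    if "x \<in> S" for x
    using Suc.prems that by (intro FDERIV Ck_on_Suc_has_derivative)
  show ?case
  proof (rule Ck_on_SucI)
    show "(\<lambda>x. prod (f x) (g x)) differentiable (at x)" if "x \<in> S" for x
      using der[OF that] by (auto simp: differentiable_def)
    fix v
    have "Ck_on k S (\<lambda>x. prod (f x) (frechet_derivative g (at x) v) + prod (frechet_derivative f (at x) v) (g x))"
      using Suc Ck_on_Suc_imp[OF Suc.prems(1)] Ck_on_Suc_imp[OF Suc.prems(2)]
      by (auto intro!: Ck_on_add[OF assms(1)])
    then show "Ck_on k S (\<lambda>x. frechet_derivative (\<lambda>x. prod (f x) (g x)) (at x) v)"
      by (rule Ck_on_eqI[OF _ assms(1)]) (simp add: frechet_derivative_eqI[OF der])
  qed
qed

lemma Ck_on_sum: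
  assumes "open S" and "\<And>i. i \<in> I \<Longrightarrow> Ck_on k S (f i)"
  shows "Ck_on k S (\<lambda>x. \<Sum>i\<in>I. f i x)"
  using assms(2) by (induction I rule: infinite_finite_induct) (auto intro!: Ck_on_add[OF assms(1)])

text \<open>\<open>Ck_on\<close> only knows derivatives in a fixed direction. Expanding a moving
  direction in the standard basis reduces \<open>frechet_derivative f (at x) (Y x)\<close> to that
  case.\<close>

lemma linear_sum_Basis:
  fixes f :: "'a::euclidean_space \<Rightarrow> 'b::real_normed_vector"
  assumes "linear f"
  shows "f v = (\<Sum>b\<in>Basis. (v \<bullet> b) *\<^sub>R f b)"
  by (metis (no_types, lifting) assms euclidean_representation linear_cmul linear_sum sum.cong)

text \<open>The induction varies \<open>f\<close> but keeps \<open>g\<close>: in the chain rule the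
  outer factors are partial derivatives of \<open>f\<close>, again composed with \<open>g\<close>,
  while the inner factors are derivatives of \<open>g\<close>, which the hypothesis on
  \<open>g\<close> covers.\<close>

lemma Ck_on_compose:
  fixes g :: "'a::euclidean_space \<Rightarrow> 'b::euclidean_space" and f :: "'b \<Rightarrow> 'c::real_normed_vector"
  assumes "open S" and "g ` S \<subseteq> T" and "Ck_on k S g" and "Ck_on k T f"
  shows "Ck_on k S (\<lambda>x. f (g x))"
  using assms(3,4)
proof (induction k arbitrary: f)
  case 0
  then show ?case using assms(2) by (auto intro: continuous_on_compose2)
next
  case (Suc k)
  have der: "((\<lambda>x. f (g x)) has_derivative
      (\<lambda>v. frechet_derivative f (at (g x)) (frechet_derivative g (at x) v))) (at x)" if "x \<in> S" for x
    using Suc.prems that assms(2)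
    by (intro has_derivative_compose[of g _ x UNIV f] Ck_on_Suc_has_derivative) auto
  show ?case
  proof (rule Ck_on_SucI)
    show "(\<lambda>x. f (g x)) differentiable (at x)" if "x \<in> S" for x
      using der[OF that] by (auto simp: differentiable_def)
    fix v
    have "Ck_on k S (\<lambda>x. frechet_derivative g (at x) v \<bullet> b)" for b
      using bounded_bilinear.Ck_on[OF bounded_bilinear_inner assms(1), of k "\<lambda>x. frechet_derivative g (at x) v" "\<lambda>_. b"] Suc.prems
      by simp
    moreover have "Ck_on k S (\<lambda>x. frechet_derivative f (at (g x)) b)" for b
      using Suc.IH[OF Ck_on_Suc_imp[OF Suc.prems(1)], of "\<lambda>y. frechet_derivative f (at y) b"] Suc.prems(2) by simp
    ultimately have "Ck_on k S (\<lambda>x. \<Sum>b\<in>Basis. (frechet_derivative g (at x) v \<bullet> b) *\<^sub>R frechet_derivative f (at (g x)) b)"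
      by (intro Ck_on_sum[OF assms(1)] bounded_bilinear.Ck_on[OF bounded_bilinear_scaleR assms(1)]) auto
    moreover have "frechet_derivative (\<lambda>x. f (g x)) (at x) v =
        (\<Sum>b\<in>Basis. (frechet_derivative g (at x) v \<bullet> b) *\<^sub>R frechet_derivative f (at (g x)) b)" if "x \<in> S" for x
      using Suc.prems that assms(2)
      by (subst frechet_derivative_eqI[OF der[OF that]], intro linear_sum_Basis linear_frechet_derivative) auto
    ultimately show "Ck_on k S (\<lambda>x. frechet_derivative (\<lambda>x. f (g x)) (at x) v)"
      by (rule Ck_on_eqI[OF _ assms(1)])
  qed
qed

lemma Ck_on_inverse:
  fixes f :: "'a::euclidean_space \<Rightarrow> real"
  assumes "open S" and "Ck_on k S f" and "\<And>x. x \<in> S \<Longrightarrow> f x \<noteq> 0"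
  shows "Ck_on k S (\<lambda>x. inverse (f x))"
  using assms(2)
proof (induction k)
  case 0
  then show ?case using assms(3) by (auto intro: continuous_on_inverse)
next
  case (Suc k)
  have der: "((\<lambda>x. inverse (f x)) has_derivative
      (\<lambda>v. - (inverse (f x) * frechet_derivative f (at x) v * inverse (f x)))) (at x)" if "x \<in> S" for x
    using Suc.prems that assms(3) by (intro Deriv.has_derivative_inverse Ck_on_Suc_has_derivative) auto
  note mul = bounded_bilinear.Ck_on[OF bounded_bilinear_mult \<open>open S\<close>]
  show ?case
  proof (rule Ck_on_SucI)
    show "(\<lambda>x. inverse (f x)) differentiable (at x)" if "x \<in> S" for x
      using der[OF that] by (auto simp: differentiable_def)
    fix v
    have "Ck_on k S (\<lambda>x. (- 1) * (inverse (f x) * frechet_derivative f (at x) v * inverse (f x)))"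
      using Suc.prems Suc.IH[OF Ck_on_Suc_imp[OF Suc.prems]] by (intro mul) auto
    then show "Ck_on k S (\<lambda>x. frechet_derivative (\<lambda>x. inverse (f x)) (at x) v)"
      by (rule Ck_on_eqI[OF _ assms(1)]) (simp add: frechet_derivative_eqI[OF der])
  qed
qed

lemma smooth_on_imp_differentiable: "smooth_on S f \<Longrightarrow> x \<in> S \<Longrightarrow> f differentiable (at x)"
  unfolding smooth_on_def by (metis Ck_on.simps(2))

lemma smooth_on_frechet: "smooth_on S f \<Longrightarrow> smooth_on S (\<lambda>x. frechet_derivative f (at x) v)"
  unfolding smooth_on_def by (metis Ck_on.simps(2))

lemma smooth_on_cong: "open S \<Longrightarrow> (\<And>x. x \<in> S \<Longrightarrow> f x = g x) \<Longrightarrow> smooth_on S f \<longleftrightarrow> smooth_on S g"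
  unfolding smooth_on_def using Ck_on_cong by blast

lemma smooth_on_eqI:
  "smooth_on S f \<Longrightarrow> open S \<Longrightarrow> (\<And>x. x \<in> S \<Longrightarrow> g x = f x) \<Longrightarrow> smooth_on S g"
  using smooth_on_cong by blast

lemma smooth_on_subset: "smooth_on S f \<Longrightarrow> T \<subseteq> S \<Longrightarrow> smooth_on T f"
  unfolding smooth_on_def using Ck_on_subset by blast

lemma smooth_on_const [simp]: "smooth_on S (\<lambda>_. c)"
  by (simp add: smooth_on_def)

lemma smooth_on_add: "open S \<Longrightarrow> smooth_on S f \<Longrightarrow> smooth_on S g \<Longrightarrow> smooth_on S (\<lambda>x. f x + g x)"
  unfolding smooth_on_def using Ck_on_add by blast

lemma smooth_on_mult:
  fixes f g :: "'a::euclidean_space \<Rightarrow> real"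
  shows "open S \<Longrightarrow> smooth_on S f \<Longrightarrow> smooth_on S g \<Longrightarrow> smooth_on S (\<lambda>x. f x * g x)"
  by (simp add: smooth_on_def bounded_bilinear.Ck_on[OF bounded_bilinear_mult])

lemma smooth_on_scaleR: "open S \<Longrightarrow> smooth_on S f \<Longrightarrow> smooth_on S g \<Longrightarrow> smooth_on S (\<lambda>x. f x *\<^sub>R g x)"
  by (simp add: smooth_on_def bounded_bilinear.Ck_on[OF bounded_bilinear_scaleR])

lemma smooth_on_inner: "open S \<Longrightarrow> smooth_on S f \<Longrightarrow> smooth_on S g \<Longrightarrow> smooth_on S (\<lambda>x. f x \<bullet> g x)"
  by (simp add: smooth_on_def bounded_bilinear.Ck_on[OF bounded_bilinear_inner])

lemma smooth_on_sum: "open S \<Longrightarrow> (\<And>i. i \<in> I \<Longrightarrow> smooth_on S (f i)) \<Longrightarrow> smooth_on S (\<lambda>x. \<Sum>i\<in>I. f i x)"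
  by (simp add: smooth_on_def Ck_on_sum)

lemma smooth_on_compose:
  fixes g :: "'a::euclidean_space \<Rightarrow> 'b::euclidean_space"
  shows "open S \<Longrightarrow> g ` S \<subseteq> T \<Longrightarrow> smooth_on S g \<Longrightarrow> smooth_on T f \<Longrightarrow> smooth_on S (\<lambda>x. f (g x))"
  by (simp add: smooth_on_def Ck_on_compose)

lemma smooth_on_inverse:
  fixes f :: "'a::euclidean_space \<Rightarrow> real"
  shows "open S \<Longrightarrow> smooth_on S f \<Longrightarrow> (\<And>x. x \<in> S \<Longrightarrow> f x \<noteq> 0) \<Longrightarrow> smooth_on S (\<lambda>x. inverse (f x))"
  by (simp add: smooth_on_def Ck_on_inverse)

lemma smooth_on_divide:
  fixes f g :: "'a::euclidean_space \<Rightarrow> real"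
  shows "open S \<Longrightarrow> smooth_on S f \<Longrightarrow> smooth_on S g \<Longrightarrow> (\<And>x. x \<in> S \<Longrightarrow> g x \<noteq> 0) \<Longrightarrow> smooth_on S (\<lambda>x. f x / g x)"
  unfolding divide_inverse by (intro smooth_on_mult smooth_on_inverse)

lemma smooth_on_minus: "open S \<Longrightarrow> smooth_on S f \<Longrightarrow> smooth_on S (\<lambda>x. - f x)"
  using smooth_on_scaleR[of S "\<lambda>_. - 1" f] by simp

lemma smooth_on_diff: "open S \<Longrightarrow> smooth_on S f \<Longrightarrow> smooth_on S g \<Longrightarrow> smooth_on S (\<lambda>x. f x - g x)"
  using smooth_on_add[of S f "\<lambda>x. - g x"] smooth_on_minus[of S g] by simp

lemma smooth_on_prod:
  fixes f :: "'i \<Rightarrow> 'a::euclidean_space \<Rightarrow> real"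
  shows "open S \<Longrightarrow> (\<And>i. i \<in> I \<Longrightarrow> smooth_on S (f i)) \<Longrightarrow> smooth_on S (\<lambda>x. \<Prod>i\<in>I. f i x)"
  by (induction I rule: infinite_finite_induct) (auto intro!: smooth_on_mult)

lemma smooth_on_linear:
  fixes f :: "'a::euclidean_space \<Rightarrow> 'b::real_normed_vector"
  assumes "linear f"
  shows "smooth_on S f"
proof -
  have der: "frechet_derivative f (at x) = f" "f differentiable (at x)" for x
    using linear_imp_has_derivative[OF assms, of "at x"] frechet_derivative_eqI
    by (auto simp: differentiable_def)
  have "Ck_on k S f" for k
    using linear_continuous_on[OF linear_conv_bounded_linear[THEN iffD1, OF assms], of S]
    by (cases k) (auto simp: der)
  then show ?thesis by (simp add: smooth_on_def)
qed

lemma smooth_on_linear_compose: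
  fixes f :: "'a::euclidean_space \<Rightarrow> 'b::real_normed_vector"
  assumes "linear f" and "open S" and "smooth_on S g"
  shows "smooth_on S (\<lambda>x. f (g x))"
  using smooth_on_compose[OF assms(2) subset_UNIV assms(3) smooth_on_linear[OF assms(1)]] .

lemma smooth_on_ident: "smooth_on S (\<lambda>x. x)"
  by (rule smooth_on_linear) (simp add: linear_id[unfolded id_def])

lemma smooth_on_vec_nth: "open S \<Longrightarrow> smooth_on S f \<Longrightarrow> smooth_on S (\<lambda>x. f x $ i)"
  for f :: "'a::euclidean_space \<Rightarrow> real^'n"
  by (rule smooth_on_linear_compose[where f="\<lambda>v. v $ i"])
    (auto intro: bounded_linear.linear bounded_linear_vec_nth)

lemma smooth_on_det:
  fixes M :: "'a::euclidean_space \<Rightarrow> real^'n^'n"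
  assumes "open S" and "\<And>i j. smooth_on S (\<lambda>x. M x $ i $ j)"
  shows "smooth_on S (\<lambda>x. det (M x))"
  unfolding det_def using assms by (intro smooth_on_sum smooth_on_mult smooth_on_prod) auto

lemma smooth_on_has_derivative:
  "smooth_on S f \<Longrightarrow> x \<in> S \<Longrightarrow> (f has_derivative frechet_derivative f (at x)) (at x)"
  by (simp add: smooth_on_imp_differentiable flip: frechet_derivative_works)

lemma smooth_on_frechet_field:
  assumes "open S" and "smooth_on S f" and "smooth_on S Y"
  shows "smooth_on S (\<lambda>x. frechet_derivative f (at x) (Y x))"
proof -
  have "smooth_on S (\<lambda>x. \<Sum>b\<in>Basis. (Y x \<bullet> b) *\<^sub>R frechet_derivative f (at x) b)"
    using assms by (intro smooth_on_sum smooth_on_scaleR smooth_on_inner smooth_on_frechet) auto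
  moreover have "frechet_derivative f (at x) (Y x) = (\<Sum>b\<in>Basis. (Y x \<bullet> b) *\<^sub>R frechet_derivative f (at x) b)"
    if "x \<in> S" for x
    using assms(2) that by (intro linear_sum_Basis linear_frechet_derivative smooth_on_imp_differentiable)
  ultimately show ?thesis by (rule smooth_on_eqI[OF _ assms(1)])
qed

section \<open>Derivatives along vector fields\<close>

lemma dir_deriv_eqI: "(f has_derivative f') (at p) \<Longrightarrow> dir_deriv X f p = f' (X p)"
  by (simp add: dir_deriv_def frechet_derivative_eqI)

lemma differentiable_imp_has_derivative:
  "f differentiable (at x) \<Longrightarrow> (f has_derivative frechet_derivative f (at x)) (at x)"
  by (rule frechet_derivative_works[THEN iffD1])

lemma dir_deriv_cong:
  assumes "open S" and "p \<in> S" and "\<And>q. q \<in> S \<Longrightarrow> f q = g q"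
  shows "dir_deriv X f p = dir_deriv X g p"
proof (cases "f differentiable (at p)")
  case True
  then show ?thesis
    using frechet_derivative_transform_within_open[OF True assms] by (simp add: dir_deriv_def)
next
  case False
  \<comment> \<open>\<open>frechet_derivative\<close> is a choice; even where there is no
    derivative, both sides choose from the same set of candidates.\<close>
  have "(f has_derivative f') (at p) \<longleftrightarrow> (g has_derivative f') (at p)" for f'
    using assms has_derivative_transform_within_open[OF _ assms(1,2), of f f' UNIV g]
      has_derivative_transform_within_open[OF _ assms(1,2), of g f' UNIV f] by auto
  then show ?thesis by (simp add: dir_deriv_def frechet_derivative_def)
qed

lemma dir_deriv_const [simp]: "dir_deriv X (\<lambda>_. c) p = 0"
  by (simp add: dir_deriv_def)

lemma dir_deriv_add:
  "f differentiable (at p) \<Longrightarrow> g differentiable (at p) \<Longrightarrow>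
    dir_deriv X (\<lambda>q. f q + g q) p = dir_deriv X f p + dir_deriv X g p"
  unfolding dir_deriv_def
  by (subst frechet_derivative_eqI[OF has_derivative_add[OF differentiable_imp_has_derivative differentiable_imp_has_derivative]]) auto

lemma dir_deriv_diff:
  "f differentiable (at p) \<Longrightarrow> g differentiable (at p) \<Longrightarrow>
    dir_deriv X (\<lambda>q. f q - g q) p = dir_deriv X f p - dir_deriv X g p"
  unfolding dir_deriv_def
  by (subst frechet_derivative_eqI[OF has_derivative_diff[OF differentiable_imp_has_derivative differentiable_imp_has_derivative]]) auto

lemma dir_deriv_minus:
  "f differentiable (at p) \<Longrightarrow> dir_deriv X (\<lambda>q. - f q) p = - dir_deriv X f p"
  unfolding dir_deriv_def
  by (subst frechet_derivative_eqI[OF has_derivative_minus[OF differentiable_imp_has_derivative]]) auto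

lemma dir_deriv_mult:
  fixes f g :: "'a::euclidean_space \<Rightarrow> real"
  shows "f differentiable (at p) \<Longrightarrow> g differentiable (at p) \<Longrightarrow>
    dir_deriv X (\<lambda>q. f q * g q) p = dir_deriv X f p * g p + f p * dir_deriv X g p"
  unfolding dir_deriv_def
  by (subst frechet_derivative_eqI[OF has_derivative_mult[OF differentiable_imp_has_derivative differentiable_imp_has_derivative]]) auto

lemma dir_deriv_scaleR:
  "f differentiable (at p) \<Longrightarrow> g differentiable (at p) \<Longrightarrow>
    dir_deriv X (\<lambda>q. f q *\<^sub>R g q) p = dir_deriv X f p *\<^sub>R g p + f p *\<^sub>R dir_deriv X g p"
  unfolding dir_deriv_def
  by (subst frechet_derivative_eqI[OF has_derivative_scaleR[OF differentiable_imp_has_derivative differentiable_imp_has_derivative]]) auto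

lemma dir_deriv_sum:
  assumes "\<And>i. i \<in> I \<Longrightarrow> f i differentiable (at p)"
  shows "dir_deriv X (\<lambda>q. \<Sum>i\<in>I. f i q) p = (\<Sum>i\<in>I. dir_deriv X (f i) p)"
proof -
  have "((\<lambda>q. \<Sum>i\<in>I. f i q) has_derivative (\<lambda>v. \<Sum>i\<in>I. frechet_derivative (f i) (at p) v)) (at p)"
    using assms by (intro has_derivative_sum differentiable_imp_has_derivative)
  from dir_deriv_eqI[OF this, of X] show ?thesis by (simp add: dir_deriv_def[of X "f _"])
qed

lemma dir_deriv_linear:
  fixes L :: "'b::euclidean_space \<Rightarrow> 'c::real_normed_vector"
  assumes "linear L" and "f differentiable (at p)"
  shows "dir_deriv X (\<lambda>q. L (f q)) p = L (dir_deriv X f p)"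
proof -
  have "bounded_linear L" using assms(1) by (simp add: linear_conv_bounded_linear)
  then have "((\<lambda>q. L (f q)) has_derivative (\<lambda>v. L (frechet_derivative f (at p) v))) (at p)"
    by (rule bounded_linear.has_derivative[OF _ differentiable_imp_has_derivative[OF assms(2)]])
  from dir_deriv_eqI[OF this, of X] show ?thesis by (simp add: dir_deriv_def)
qed

lemma dir_deriv_vec_nth:
  "f differentiable (at p) \<Longrightarrow> dir_deriv X (\<lambda>q. f q $ i) p = dir_deriv X f p $ i" for f :: "_ \<Rightarrow> real^'n"
  by (rule dir_deriv_linear[where L="\<lambda>v. v $ i"]) (auto intro: bounded_linear.linear bounded_linear_vec_nth)

lemma dir_deriv_compose:
  assumes "g differentiable (at p)" and "f differentiable (at (g p))"
  shows "dir_deriv X (\<lambda>q. f (g q)) p = frechet_derivative f (at (g p)) (dir_deriv X g p)"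
proof -
  have "((\<lambda>q. f (g q)) has_derivative (\<lambda>v. frechet_derivative f (at (g p)) (frechet_derivative g (at p) v))) (at p)"
    using assms by (intro has_derivative_compose[of g _ p UNIV f] differentiable_imp_has_derivative)
  from dir_deriv_eqI[OF this, of X] show ?thesis by (simp add: dir_deriv_def)
qed

lemma smooth_on_dir_deriv:
  "open S \<Longrightarrow> smooth_on S X \<Longrightarrow> smooth_on S f \<Longrightarrow> smooth_on S (dir_deriv X f)"
  unfolding dir_deriv_def[abs_def] by (rule smooth_on_frechet_field)

lemma smooth_on_lie_bracket:
  "open S \<Longrightarrow> smooth_on S X \<Longrightarrow> smooth_on S Y \<Longrightarrow> smooth_on S (lie_bracket X Y)"
  unfolding lie_bracket_def[abs_def] by (intro smooth_on_diff smooth_on_dir_deriv)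

section \<open>Symmetry of second derivatives and the commutator of two vector fields\<close>

lemma has_real_derivative_along_line:
  fixes f :: "'a::euclidean_space \<Rightarrow> real"
  assumes "f differentiable (at (x + s *\<^sub>R v))"
  shows "((\<lambda>s. f (x + s *\<^sub>R v)) has_real_derivative frechet_derivative f (at (x + s *\<^sub>R v)) v) (at s)"
proof -
  have lin: "linear (frechet_derivative f (at (x + s *\<^sub>R v)))"
    by (rule linear_frechet_derivative[OF assms])
  have "((\<lambda>s. x + s *\<^sub>R v) has_derivative (\<lambda>h. h *\<^sub>R v)) (at s)"
    by (auto intro!: derivative_eq_intros)
  then have "((\<lambda>s. f (x + s *\<^sub>R v)) has_derivative (\<lambda>h. frechet_derivative f (at (x + s *\<^sub>R v)) (h *\<^sub>R v))) (at s)"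
    by (rule has_derivative_compose[where g=f]) (rule differentiable_imp_has_derivative[OF assms])
  moreover have "(\<lambda>h. frechet_derivative f (at (x + s *\<^sub>R v)) (h *\<^sub>R v)) = (*) (frechet_derivative f (at (x + s *\<^sub>R v)) v)"
    using linear_cmul[OF lin] by (auto simp: mult.commute)
  ultimately show ?thesis by (simp add: has_field_derivative_def)
qed

text \<open>Two applications of the mean value theorem, first in direction \<open>a\<close>, then in
  direction \<open>b\<close>. The second difference is symmetric in \<open>a\<close> and
  \<open>b\<close>, which is the source of the symmetry of second derivatives.\<close>

lemma second_difference_mean_value:
  fixes f :: "'a::euclidean_space \<Rightarrow> real"
  assumes f: "smooth_on S f" and B: "ball p r \<subseteq> S" and h: "0 < h" "h * (norm a + norm b) < r"
  obtains x where "dist x p \<le> h * (norm a + norm b)"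
    and "f (p + h *\<^sub>R a + h *\<^sub>R b) - f (p + h *\<^sub>R a) - f (p + h *\<^sub>R b) + f p =
      h * (h * frechet_derivative (\<lambda>x. frechet_derivative f (at x) a) (at x) b)"
proof -
  have near: "dist (p + s *\<^sub>R a + t *\<^sub>R b) p \<le> h * (norm a + norm b)"
    if "0 \<le> s" "s \<le> h" "0 \<le> t" "t \<le> h" for s t
  proof -
    have "norm (s *\<^sub>R a + t *\<^sub>R b) \<le> s * norm a + t * norm b"
      using that norm_triangle_ineq[of "s *\<^sub>R a" "t *\<^sub>R b"] by simp
    also have "\<dots> \<le> h * norm a + h * norm b"
      using that by (intro add_mono mult_right_mono) auto
    finally show ?thesis by (simp add: dist_norm algebra_simps)
  qed
  then have inS: "p + s *\<^sub>R a + t *\<^sub>R b \<in> S" if "0 \<le> s" "s \<le> h" "0 \<le> t" "t \<le> h" for s t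
    using that B h by (force simp: dist_commute)
  have D: "g differentiable (at (p + s *\<^sub>R a + t *\<^sub>R b))"
    if "smooth_on S g" "0 \<le> s" "s \<le> h" "0 \<le> t" "t \<le> h" for g :: "'a \<Rightarrow> real" and s t
    using inS that smooth_on_imp_differentiable by blast
  define u where "u s = f (p + h *\<^sub>R b + s *\<^sub>R a) - f (p + s *\<^sub>R a)" for s
  define g where "g x = frechet_derivative f (at x) a" for x
  have g: "smooth_on S g" unfolding g_def by (rule smooth_on_frechet[OF f])
  have "(u has_real_derivative (g (p + h *\<^sub>R b + s *\<^sub>R a) - g (p + s *\<^sub>R a))) (at s)"
    if "0 \<le> s" "s \<le> h" for s
    unfolding u_def g_def
    using D[OF f that, of h] D[OF f that, of 0] that h
    by (intro DERIV_diff has_real_derivative_along_line) (simp_all add: add_ac)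
  from MVT2[OF \<open>0 < h\<close> this] obtain \<xi> where \<xi>: "0 < \<xi>" "\<xi> < h"
    and u: "u h - u 0 = (h - 0) * (g (p + h *\<^sub>R b + \<xi> *\<^sub>R a) - g (p + \<xi> *\<^sub>R a))"
    by blast
  have "((\<lambda>t. g (p + \<xi> *\<^sub>R a + t *\<^sub>R b)) has_real_derivative
      frechet_derivative g (at (p + \<xi> *\<^sub>R a + t *\<^sub>R b)) b) (at t)" if "0 \<le> t" "t \<le> h" for t
    using D[OF g _ _ that, of \<xi>] \<xi> by (intro has_real_derivative_along_line) simp
  from MVT2[OF \<open>0 < h\<close> this] obtain \<eta> where \<eta>: "0 < \<eta>" "\<eta> < h"
    and g': "g (p + \<xi> *\<^sub>R a + h *\<^sub>R b) - g (p + \<xi> *\<^sub>R a + 0 *\<^sub>R b) =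
      (h - 0) * frechet_derivative g (at (p + \<xi> *\<^sub>R a + \<eta> *\<^sub>R b)) b"
    by blast
  show thesis
  proof (rule that)
    show "dist (p + \<xi> *\<^sub>R a + \<eta> *\<^sub>R b) p \<le> h * (norm a + norm b)"
      using \<xi> \<eta> by (intro near) auto
    have "u h - u 0 = h * (h * frechet_derivative g (at (p + \<xi> *\<^sub>R a + \<eta> *\<^sub>R b)) b)"
      using u g' by (simp add: add_ac)
    then show "f (p + h *\<^sub>R a + h *\<^sub>R b) - f (p + h *\<^sub>R a) - f (p + h *\<^sub>R b) + f p =
      h * (h * frechet_derivative (\<lambda>x. frechet_derivative f (at x) a) (at (p + \<xi> *\<^sub>R a + \<eta> *\<^sub>R b)) b)"
      by (simp add: u_def g_def[abs_def] add_ac)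
  qed
qed

lemma frechet_derivative_commute_real:
  fixes f :: "'a::euclidean_space \<Rightarrow> real"
  assumes "open S" and "smooth_on S f" and "p \<in> S"
  shows "frechet_derivative (\<lambda>x. frechet_derivative f (at x) a) (at p) b =
    frechet_derivative (\<lambda>x. frechet_derivative f (at x) b) (at p) a"
proof (rule ccontr)
  define A where "A x = frechet_derivative (\<lambda>x. frechet_derivative f (at x) a) (at x) b" for x
  define B where "B x = frechet_derivative (\<lambda>x. frechet_derivative f (at x) b) (at x) a" for x
  assume "\<not> ?thesis"
  then have \<epsilon>: "\<bar>A p - B p\<bar> / 2 > 0" by (simp add: A_def B_def)
  have "smooth_on S A" "smooth_on S B"
    unfolding A_def B_def using assms by (auto intro: smooth_on_frechet)
  then have "isCont A p" "isCont B p"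
    using assms(3) by (auto intro: differentiable_imp_continuous_within smooth_on_imp_differentiable)
  then obtain d e where "d > 0" "e > 0"
    and d: "\<And>x. dist x p < d \<Longrightarrow> \<bar>A x - A p\<bar> < \<bar>A p - B p\<bar> / 2"
    and e: "\<And>x. dist x p < e \<Longrightarrow> \<bar>B x - B p\<bar> < \<bar>A p - B p\<bar> / 2"
    using \<epsilon> unfolding continuous_at_eps_delta by (metis dist_norm real_norm_def)
  obtain r where "r > 0" and r: "ball p r \<subseteq> S"
    using assms by (meson openE)
  define m where "m = min r (min d e)"
  have "m > 0" using \<open>r > 0\<close> \<open>d > 0\<close> \<open>e > 0\<close> by (simp add: m_def)
  define h where "h = m / (2 * (norm a + norm b + 1))"
  have pos: "norm a + norm b + 1 > 0" by (smt (verit) norm_ge_zero)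
  then have "h > 0" using \<open>m > 0\<close> by (simp add: h_def)
  have "h * (norm a + norm b) < h * (2 * (norm a + norm b + 1))"
    using \<open>h > 0\<close> pos by (intro mult_strict_left_mono) (simp_all del: norm_ge_zero)
  also have "\<dots> = m" using pos by (simp add: h_def)
  finally have hm: "h * (norm a + norm b) < m" .
  then have hr: "h * (norm a + norm b) < r" "h * (norm b + norm a) < r"
    by (auto simp: m_def add.commute)
  obtain x where x: "dist x p \<le> h * (norm a + norm b)"
    and X: "f (p + h *\<^sub>R a + h *\<^sub>R b) - f (p + h *\<^sub>R a) - f (p + h *\<^sub>R b) + f p = h * (h * A x)"
    using second_difference_mean_value[OF assms(2) r \<open>h > 0\<close> hr(1)] unfolding A_def by blast
  obtain y where y: "dist y p \<le> h * (norm b + norm a)"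
    and Y: "f (p + h *\<^sub>R b + h *\<^sub>R a) - f (p + h *\<^sub>R b) - f (p + h *\<^sub>R a) + f p = h * (h * B y)"
    using second_difference_mean_value[OF assms(2) r \<open>h > 0\<close> hr(2)] unfolding B_def by blast
  \<comment> \<open>Exchanging \<open>a\<close> and \<open>b\<close> leaves the second difference
    unchanged, so \<open>A\<close> at one nearby point equals \<open>B\<close> at another; by
    continuity the gap at \<open>p\<close> cannot persist.\<close>
  have swap: "p + h *\<^sub>R b + h *\<^sub>R a = p + h *\<^sub>R a + h *\<^sub>R b" by simp
  have "h * (h * A x) = h * (h * B y)" using X Y unfolding swap by linarith
  then have "A x = B y" using \<open>h > 0\<close> by simp
  then have "\<bar>A p - B p\<bar> \<le> \<bar>A x - A p\<bar> + \<bar>B y - B p\<bar>" by linarith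
  moreover have "\<bar>A x - A p\<bar> < \<bar>A p - B p\<bar> / 2" "\<bar>B y - B p\<bar> < \<bar>A p - B p\<bar> / 2"
    using x y hm by (intro d e; simp add: m_def add.commute)+
  moreover have False if "t \<le> u + w" "u < t / 2" "w < t / 2" for t u w :: real
    using that by linarith
  ultimately show False by blast
qed

lemma frechet_derivative_inner:
  assumes "f differentiable (at x)"
  shows "frechet_derivative (\<lambda>x. f x \<bullet> c) (at x) v = frechet_derivative f (at x) v \<bullet> c"
proof -
  have "((\<lambda>x. f x \<bullet> c) has_derivative (\<lambda>v. frechet_derivative f (at x) v \<bullet> c)) (at x)"
    by (intro has_derivative_inner_left differentiable_imp_has_derivative assms)
  from frechet_derivative_eqI[OF this] show ?thesis by simp
qed

lemma frechet_derivative_commute: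
  fixes f :: "'a::euclidean_space \<Rightarrow> 'b::euclidean_space"
  assumes "open S" and "smooth_on S f" and "p \<in> S"
  shows "frechet_derivative (\<lambda>x. frechet_derivative f (at x) a) (at p) b =
    frechet_derivative (\<lambda>x. frechet_derivative f (at x) b) (at p) a"
proof (rule euclidean_eqI)
  fix c :: 'b
  have sm: "smooth_on S (\<lambda>x. f x \<bullet> c)"
    using assms by (intro smooth_on_inner) auto
  have "frechet_derivative (\<lambda>x. frechet_derivative f (at x) u) (at p) v \<bullet> c =
      frechet_derivative (\<lambda>x. frechet_derivative (\<lambda>x. f x \<bullet> c) (at x) u) (at p) v" for u v
  proof -
    have "frechet_derivative (\<lambda>x. frechet_derivative f (at x) u) (at p) v \<bullet> c =
        frechet_derivative (\<lambda>x. frechet_derivative f (at x) u \<bullet> c) (at p) v"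
      using smooth_on_imp_differentiable[OF smooth_on_frechet[OF assms(2)] assms(3)]
      by (simp add: frechet_derivative_inner)
    also have "\<dots> = dir_deriv (\<lambda>_. v) (\<lambda>x. frechet_derivative f (at x) u \<bullet> c) p"
      by (simp add: dir_deriv_def)
    also have "\<dots> = dir_deriv (\<lambda>_. v) (\<lambda>x. frechet_derivative (\<lambda>x. f x \<bullet> c) (at x) u) p"
      using smooth_on_imp_differentiable[OF assms(2)]
      by (intro dir_deriv_cong[OF assms(1,3)]) (simp add: frechet_derivative_inner)
    finally show ?thesis by (simp add: dir_deriv_def)
  qed
  then show "frechet_derivative (\<lambda>x. frechet_derivative f (at x) a) (at p) b \<bullet> c =
    frechet_derivative (\<lambda>x. frechet_derivative f (at x) b) (at p) a \<bullet> c"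
    using frechet_derivative_commute_real[OF assms(1) sm assms(3)] by metis
qed

text \<open>Separates the derivative of \<open>Y\<close> from the second derivative of
  \<open>f\<close>. Only the first part survives in a commutator, since the second is symmetric in
  the two directions.\<close>

lemma dir_deriv_dir_deriv:
  fixes f :: "'a::euclidean_space \<Rightarrow> 'b::euclidean_space"
  assumes "open S" and f: "smooth_on S f" and Y: "smooth_on S Y" and p: "p \<in> S"
  shows "dir_deriv X (dir_deriv Y f) p =
    frechet_derivative f (at p) (dir_deriv X Y p) + frechet_derivative (\<lambda>x. frechet_derivative f (at x) (Y p)) (at p) (X p)"
proof -
  have "dir_deriv X (dir_deriv Y f) p =
      dir_deriv X (\<lambda>x. \<Sum>b\<in>Basis. (Y x \<bullet> b) *\<^sub>R frechet_derivative f (at x) b) p"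
    using f unfolding dir_deriv_def[of Y f]
    by (intro dir_deriv_cong[OF assms(1) p] linear_sum_Basis linear_frechet_derivative smooth_on_imp_differentiable)
  also have "\<dots> = (\<Sum>b\<in>Basis. dir_deriv X (\<lambda>x. Y x \<bullet> b) p *\<^sub>R frechet_derivative f (at p) b +
      (Y p \<bullet> b) *\<^sub>R dir_deriv X (\<lambda>x. frechet_derivative f (at x) b) p)"
    using p \<open>open S\<close> f Y
    by (subst dir_deriv_sum, intro smooth_on_imp_differentiable[of S] smooth_on_scaleR smooth_on_inner smooth_on_frechet)
      (auto intro!: sum.cong dir_deriv_scaleR smooth_on_imp_differentiable[of S] smooth_on_inner smooth_on_frechet)
  also have "\<dots> = (\<Sum>b\<in>Basis. (dir_deriv X Y p \<bullet> b) *\<^sub>R frechet_derivative f (at p) b) +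
      (\<Sum>b\<in>Basis. (Y p \<bullet> b) *\<^sub>R frechet_derivative (\<lambda>x. frechet_derivative f (at x) b) (at p) (X p))"
    using p Y by (simp add: sum.distrib dir_deriv_def frechet_derivative_inner smooth_on_imp_differentiable)
  also have "(\<Sum>b\<in>Basis. (dir_deriv X Y p \<bullet> b) *\<^sub>R frechet_derivative f (at p) b) =
      frechet_derivative f (at p) (dir_deriv X Y p)"
    using p f by (intro linear_sum_Basis[symmetric] linear_frechet_derivative smooth_on_imp_differentiable)
  \<comment> \<open>A direction in the outer slot acts linearly, so symmetry moves the basis vector
    there, the sum collapses to \<open>Y p\<close>, and symmetry moves it back.\<close>
  also have "(\<Sum>b\<in>Basis. (Y p \<bullet> b) *\<^sub>R frechet_derivative (\<lambda>x. frechet_derivative f (at x) b) (at p) (X p)) =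
      (\<Sum>b\<in>Basis. (Y p \<bullet> b) *\<^sub>R frechet_derivative (\<lambda>x. frechet_derivative f (at x) (X p)) (at p) b)"
    using frechet_derivative_commute[OF assms(1) f p] by metis
  also have "\<dots> = frechet_derivative (\<lambda>x. frechet_derivative f (at x) (X p)) (at p) (Y p)"
    using p f by (intro linear_sum_Basis[symmetric] linear_frechet_derivative smooth_on_imp_differentiable smooth_on_frechet)
  also have "\<dots> = frechet_derivative (\<lambda>x. frechet_derivative f (at x) (Y p)) (at p) (X p)"
    using frechet_derivative_commute[OF assms(1) f p] by metis
  finally show ?thesis .
qed

lemma dir_deriv_lie_bracket:
  fixes f :: "'a::euclidean_space \<Rightarrow> 'b::euclidean_space"
  assumes "open S" and "smooth_on S f" and "smooth_on S X" and "smooth_on S Y" and "p \<in> S"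
  shows "dir_deriv (lie_bracket X Y) f p = dir_deriv X (dir_deriv Y f) p - dir_deriv Y (dir_deriv X f) p"
proof -
  have "dir_deriv (lie_bracket X Y) f p =
      frechet_derivative f (at p) (dir_deriv X Y p) - frechet_derivative f (at p) (dir_deriv Y X p)"
    unfolding dir_deriv_def[of "lie_bracket X Y"] lie_bracket_def
    using assms by (intro linear_diff linear_frechet_derivative smooth_on_imp_differentiable)
  then show ?thesis
    using dir_deriv_dir_deriv[OF assms(1,2,4,5), of X] dir_deriv_dir_deriv[OF assms(1,2,3,5), of Y]
      frechet_derivative_commute[OF assms(1,2,5), of "X p" "Y p"] by simp
qed

section \<open>Taylor series along a vector field\<close>

text \<open>
  The Taylor map at a point is a homomorphism of differential rings, so differential identities
  between smooth functions can be derived from identities in the ring of formal power series.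
\<close>

definition taylor :: "('a::euclidean_space \<Rightarrow> 'a) \<Rightarrow> 'a \<Rightarrow> ('a \<Rightarrow> real) \<Rightarrow> real fps" where
  "taylor X p f = Abs_fps (\<lambda>n. (dir_deriv X ^^ n) f p / fact n)"

lemma taylor_nth_0 [simp]: "fps_nth (taylor X p f) 0 = f p"
  by (simp add: taylor_def)

lemma taylor_dir_deriv: "taylor X p (dir_deriv X f) = fps_deriv (taylor X p f)"
  by (rule fps_ext) (simp add: taylor_def funpow_swap1[symmetric] field_simps del: of_nat_Suc)

text \<open>A coinduction principle: \<open>R\<close> is preserved by differentiation and implies
  equality at \<open>p\<close>, so all iterated derivatives agree at \<open>p\<close>.\<close>

lemma taylor_eqI:
  assumes "\<And>f g. R f g \<Longrightarrow> f p = g p" and "\<And>f g. R f g \<Longrightarrow> R (dir_deriv X f) (dir_deriv X g)" and "R f g"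
  shows "taylor X p f = taylor X p g"
proof -
  have "(dir_deriv X ^^ n) f p = (dir_deriv X ^^ n) g p" for n
    using assms(3) by (induction n arbitrary: f g) (auto simp: funpow_swap1 assms(1,2))
  then show ?thesis by (simp add: taylor_def)
qed

lemma taylor_cong:
  assumes "open S" and "p \<in> S" and "\<And>q. q \<in> S \<Longrightarrow> f q = g q"
  shows "taylor X p f = taylor X p g"
proof (rule taylor_eqI[where R="\<lambda>f g. \<forall>q\<in>S. f q = g q"])
  show "\<forall>q\<in>S. dir_deriv X f q = dir_deriv X g q" if "\<forall>q\<in>S. f q = g q" for f g
    using that by (auto intro: dir_deriv_cong[OF assms(1)])
qed (use assms in auto)

lemma taylor_0 [simp]: "taylor X p (\<lambda>_. 0) = 0"
proof -
  have "(dir_deriv X ^^ n) (\<lambda>_. 0) = (\<lambda>_. 0 :: real)" for n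
    by (induction n) (simp_all add: dir_deriv_const[abs_def])
  then show ?thesis by (simp add: taylor_def fps_eq_iff)
qed

lemma taylor_const: "taylor X p (\<lambda>_. c) = fps_const c"
proof (rule fps_ext)
  show "fps_nth (taylor X p (\<lambda>_. c)) n = fps_nth (fps_const c) n" for n
  proof (cases n)
    case (Suc m)
    have "(dir_deriv X ^^ m) (dir_deriv X (\<lambda>_. c)) = (\<lambda>_. 0 :: real)" for m
      by (induction m) (simp_all add: dir_deriv_const[abs_def])
    then show ?thesis using Suc by (simp add: taylor_def funpow_swap1)
  qed (simp add: taylor_def)
qed

lemma smooth_on_dir_deriv_funpow:
  "open S \<Longrightarrow> smooth_on S X \<Longrightarrow> smooth_on S f \<Longrightarrow> smooth_on S ((dir_deriv X ^^ n) f)"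
  by (induction n) (auto intro: smooth_on_dir_deriv)

lemma taylor_add:
  assumes "open S" and "p \<in> S" and "smooth_on S X" and "smooth_on S f" and "smooth_on S g"
  shows "taylor X p (\<lambda>q. f q + g q) = taylor X p f + taylor X p g"
proof (rule fps_ext)
  fix n
  show "fps_nth (taylor X p (\<lambda>q. f q + g q)) n = fps_nth (taylor X p f + taylor X p g) n"
    using assms(4,5)
  proof (induction n arbitrary: f g)
    case (Suc n)
    have "fps_nth (fps_deriv (taylor X p (\<lambda>q. f q + g q))) n =
        fps_nth (taylor X p (\<lambda>q. dir_deriv X f q + dir_deriv X g q)) n"
      unfolding taylor_dir_deriv[symmetric] using Suc.prems
      by (intro arg_cong[of _ _ "\<lambda>f. fps_nth f n"] taylor_cong[OF assms(1,2)] dir_deriv_add smooth_on_imp_differentiable[of S])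
    also have "\<dots> = fps_nth (fps_deriv (taylor X p f + taylor X p g)) n"
      using Suc.prems assms by (subst Suc.IH) (auto intro: smooth_on_dir_deriv simp: taylor_dir_deriv)
    finally show ?case by (simp add: distrib_left[symmetric] del: of_nat_Suc)
  qed simp
qed

text \<open>Leibniz without binomial sums: coefficient \<open>Suc n\<close> of a series is, up to a
  factor, coefficient \<open>n\<close> of its derivative, and the derivative of the product is a sum
  of two products to which the induction hypothesis applies.\<close>

lemma taylor_mult:
  assumes "open S" and "p \<in> S" and "smooth_on S X" and "smooth_on S f" and "smooth_on S g"
  shows "taylor X p (\<lambda>q. f q * g q) = taylor X p f * taylor X p g"
proof (rule fps_ext)
  fix n
  show "fps_nth (taylor X p (\<lambda>q. f q * g q)) n = fps_nth (taylor X p f * taylor X p g) n"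
    using assms(4,5)
  proof (induction n arbitrary: f g)
    case (Suc n)
    note sm = assms(1,3) Suc.prems smooth_on_dir_deriv[OF assms(1,3)] smooth_on_mult[OF assms(1)]
    have "fps_nth (fps_deriv (taylor X p (\<lambda>q. f q * g q))) n =
        fps_nth (taylor X p (\<lambda>q. dir_deriv X f q * g q + f q * dir_deriv X g q)) n"
      unfolding taylor_dir_deriv[symmetric] using Suc.prems
      by (intro arg_cong[of _ _ "\<lambda>f. fps_nth f n"] taylor_cong[OF assms(1,2)] dir_deriv_mult smooth_on_imp_differentiable[of S])
    also have "\<dots> = fps_nth (taylor X p (\<lambda>q. dir_deriv X f q * g q)) n + fps_nth (taylor X p (\<lambda>q. f q * dir_deriv X g q)) n"
      by (subst taylor_add[OF assms(1,2,3)]) (auto intro: sm)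
    also have "\<dots> = fps_nth (fps_deriv (taylor X p f * taylor X p g)) n"
      by (subst (1 2) Suc.IH) (auto intro: sm simp: taylor_dir_deriv)
    finally show ?case by (simp del: of_nat_Suc fps_deriv_mult)
  qed simp
qed

lemma taylor_minus:
  assumes "open S" and "p \<in> S" and "smooth_on S X" and "smooth_on S f"
  shows "taylor X p (\<lambda>q. - f q) = - taylor X p f"
proof -
  have "taylor X p (\<lambda>q. (- 1) * f q) = fps_const (- 1) * taylor X p f"
    unfolding taylor_const[of X p "- 1", symmetric] using assms by (intro taylor_mult) auto
  then show ?thesis by (simp add: fps_const_neg[symmetric] del: fps_const_neg)
qed

lemma taylor_diff:
  assumes "open S" and "p \<in> S" and "smooth_on S X" and "smooth_on S f" and "smooth_on S g"
  shows "taylor X p (\<lambda>q. f q - g q) = taylor X p f - taylor X p g"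
  using taylor_add[OF assms(1-4), of "\<lambda>q. - g q"] taylor_minus[OF assms(1-3,5)] smooth_on_minus[OF assms(1,5)]
  by simp

section \<open>Frames and coordinates\<close>

lemma sum_lessThan_4: "(\<Sum>i<4. f i) = f 0 + f 1 + f 2 + f 3"
  for f :: "nat \<Rightarrow> 'a::comm_monoid_add"
  by (simp add: eval_nat_numeral lessThan_Suc ac_simps)

lemma sum_lessThan_3: "(\<Sum>i<3. f i) = f 0 + f 1 + f 2"
  for f :: "nat \<Rightarrow> 'a::comm_monoid_add"
  by (simp add: eval_nat_numeral lessThan_Suc ac_simps)

lemma all_less_4: "(\<forall>i<4. P i) \<longleftrightarrow> P 0 \<and> P 1 \<and> P 2 \<and> P (3::nat)"
  by (simp add: eval_nat_numeral All_less_Suc conj_ac)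

lemma less_4_cases: "k < 4 \<Longrightarrow> k = 0 \<or> k = 1 \<or> k = 2 \<or> k = (3 :: nat)"
  by linarith

definition frame_on :: "'a set \<Rightarrow> (nat \<Rightarrow> 'a::euclidean_space \<Rightarrow> real^4) \<Rightarrow> bool" where
  "frame_on S v \<longleftrightarrow> (\<forall>i<4. smooth_on S (v i)) \<and> (\<forall>p\<in>S. span ((\<lambda>i. v i p) ` {..<4}) = UNIV)"

text \<open>In the index type \<open>4\<close> the numerals \<open>4\<close> and \<open>0\<close> denote the same element.\<close>

definition frame_index :: "4 \<Rightarrow> nat" where
  "frame_index s = (if s = 1 then 1 else if s = 2 then 2 else if s = 3 then 3 else 0)"

definition frame_matrix :: "(nat \<Rightarrow> 'a \<Rightarrow> real^4) \<Rightarrow> 'a \<Rightarrow> real^4^4" where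
  "frame_matrix v p = (\<chi> r s. v (frame_index s) p $ r)"

text \<open>Cramer's rule as the definition makes smooth dependence on the point immediate: a
  coordinate is a quotient of two determinants.\<close>

definition frame_coord :: "(nat \<Rightarrow> 'a \<Rightarrow> real^4) \<Rightarrow> 'a \<Rightarrow> nat \<Rightarrow> real^4 \<Rightarrow> real" where
  "frame_coord v p k w =
    det (\<chi> i j. if j = of_nat k then w $ i else frame_matrix v p $ i $ j) / det (frame_matrix v p)"

lemma frame_index_simps [simp]:
  "frame_index 0 = 0" "frame_index 1 = 1" "frame_index 2 = 2" "frame_index 3 = 3" "frame_index 4 = 0"
  by (auto simp: frame_index_def)

lemma frame_index_of_nat: "k < 4 \<Longrightarrow> frame_index (of_nat k) = k"
proof -
  have "\<forall>k<4. frame_index (of_nat k) = k" unfolding all_less_4 by simp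
  then show "k < 4 \<Longrightarrow> frame_index (of_nat k) = k" by blast
qed

lemma frame_matrix_mult:
  "frame_matrix v p *v x = x $ 0 *\<^sub>R v 0 p + x $ 1 *\<^sub>R v 1 p + x $ 2 *\<^sub>R v 2 p + x $ 3 *\<^sub>R v 3 p"
proof -
  \<comment> \<open>\<open>sum_4\<close> runs over the indices 1 to 4, while the frame is numbered
    from 0.\<close>
  have x4: "x $ 4 = x $ 0" by (rule arg_cong[where f="vec_nth x"]) simp
  show ?thesis
    by (simp add: vec_eq_iff matrix_vector_mult_def frame_matrix_def sum_4 algebra_simps x4)
qed

lemma det_frame_matrix:
  assumes "frame_on S v" and "p \<in> S"
  shows "det (frame_matrix v p) \<noteq> 0"
proof -
  have "v i p \<in> columns (frame_matrix v p)" if "i < 4" for i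
  proof -
    define s :: 4 where "s = of_nat i"
    have "frame_index s = i" using that by (simp add: s_def frame_index_of_nat)
    then have "column s (frame_matrix v p) = v i p"
      by (simp add: column_def frame_matrix_def vec_eq_iff)
    then show ?thesis unfolding columns_def by (metis (mono_tags, lifting) UNIV_I mem_Collect_eq)
  qed
  then have "span (columns (frame_matrix v p)) = UNIV"
    using assms span_mono[of "(\<lambda>i. v i p) ` {..<4}" "columns (frame_matrix v p)"]
    unfolding frame_on_def by blast
  then have "invertible (frame_matrix v p)"
    by (simp add: invertible_right_inverse matrix_right_invertible_span_columns span_vec_eq)
  then show ?thesis using invertible_det_nz by blast
qed

lemma frame_coord_unique:
  assumes "frame_on S v" and "p \<in> S" and "w = (\<Sum>i<4. c i *\<^sub>R v i p)" and "k < 4"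
  shows "frame_coord v p k w = c k"
proof -
  define x :: "real^4" where "x = (\<chi> s. c (frame_index s))"
  have "frame_matrix v p *v x = w"
    using assms(3) by (simp add: frame_matrix_mult x_def sum_lessThan_4)
  then have x: "x = (\<chi> k. det (\<chi> i j. if j = k then w $ i else frame_matrix v p $ i $ j) / det (frame_matrix v p))"
    by (rule cramer[OF det_frame_matrix[OF assms(1,2)], THEN iffD1])
  have "x $ (of_nat k) = frame_coord v p k w"
    by (subst x) (simp add: frame_coord_def)
  moreover have "frame_index (of_nat k) = k"
    using assms(4) by (rule frame_index_of_nat)
  ultimately show ?thesis by (simp add: x_def)
qed

lemma frame_coord_expand:
  assumes "frame_on S v" and "p \<in> S"
  shows "(\<Sum>i<4. frame_coord v p i w *\<^sub>R v i p) = w"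
proof -
  obtain x where x: "frame_matrix v p *v x = w"
    using cramer[OF det_frame_matrix[OF assms], of _ w] by simp
  from this[symmetric] have w: "w = (\<Sum>i<4. (x $ of_nat i) *\<^sub>R v i p)"
    by (simp add: frame_matrix_mult sum_lessThan_4)
  have "(\<Sum>i<4. frame_coord v p i w *\<^sub>R v i p) = (\<Sum>i<4. (x $ of_nat i) *\<^sub>R v i p)"
    by (intro sum.cong refl) (simp add: frame_coord_unique[OF assms w])
  then show ?thesis unfolding w[symmetric] .
qed

lemma linear_frame_coord:
  assumes "frame_on S v" and "p \<in> S" and "k < 4"
  shows "linear (frame_coord v p k)"
proof (rule linearI)
  show "frame_coord v p k (a + b) = frame_coord v p k a + frame_coord v p k b" for a b
  proof (rule frame_coord_unique[OF assms(1,2) _ assms(3), where c="\<lambda>k. frame_coord v p k a + frame_coord v p k b"])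
    show "a + b = (\<Sum>i<4. (frame_coord v p i a + frame_coord v p i b) *\<^sub>R v i p)"
      unfolding scaleR_add_left sum.distrib frame_coord_expand[OF assms(1,2)] ..
  qed
  show "frame_coord v p k (r *\<^sub>R a) = r *\<^sub>R frame_coord v p k a" for r a
  proof (rule frame_coord_unique[OF assms(1,2) _ assms(3), where c="\<lambda>k. r *\<^sub>R frame_coord v p k a"])
    show "r *\<^sub>R a = (\<Sum>i<4. (r *\<^sub>R frame_coord v p i a) *\<^sub>R v i p)"
      unfolding real_scaleR_def scaleR_scaleR[symmetric] scaleR_sum_right[symmetric]
        frame_coord_expand[OF assms(1,2)] ..
  qed
qed

lemma smooth_on_frame_coord:
  assumes "open S" and "frame_on S v" and "smooth_on S f"
  shows "smooth_on S (\<lambda>p. frame_coord v p k (f p))"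
proof -
  have M: "smooth_on S (\<lambda>p. frame_matrix v p $ i $ j)" for i j
    using assms(1,2) by (auto simp: frame_matrix_def frame_on_def frame_index_def intro!: smooth_on_vec_nth)
  have "smooth_on S (\<lambda>p. if j = of_nat k then f p $ i else frame_matrix v p $ i $ j)" for i j
    using M smooth_on_vec_nth[OF assms(1,3)] by (cases "j = of_nat k") auto
  then show ?thesis
    unfolding frame_coord_def using assms(1) det_frame_matrix[OF assms(2)] M
    by (intro smooth_on_divide smooth_on_det) auto
qed

lemma frame_coord_dir_deriv:
  fixes v :: "nat \<Rightarrow> 'a::euclidean_space \<Rightarrow> real^4"
  assumes "open S" and v: "frame_on S v" and f: "smooth_on S f" and p: "p \<in> S"
  shows "dir_deriv X f p = (\<Sum>i<4. dir_deriv X (\<lambda>q. frame_coord v q i (f q)) p *\<^sub>R v i p +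
    frame_coord v p i (f p) *\<^sub>R dir_deriv X (v i) p)"
proof -
  have "dir_deriv X f p = dir_deriv X (\<lambda>q. \<Sum>i<4. frame_coord v q i (f q) *\<^sub>R v i q) p"
    using frame_coord_expand[OF v] by (intro dir_deriv_cong[OF assms(1) p]) simp
  also have "\<dots> = (\<Sum>i<4. dir_deriv X (\<lambda>q. frame_coord v q i (f q) *\<^sub>R v i q) p)"
    using assms smooth_on_frame_coord[OF assms(1-3)]
    by (intro dir_deriv_sum smooth_on_imp_differentiable[of S] smooth_on_scaleR) (auto simp: frame_on_def)
  also have "\<dots> = (\<Sum>i<4. dir_deriv X (\<lambda>q. frame_coord v q i (f q)) p *\<^sub>R v i p +
    frame_coord v p i (f p) *\<^sub>R dir_deriv X (v i) p)"
    using assms smooth_on_frame_coord[OF assms(1-3)]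
    by (intro sum.cong dir_deriv_scaleR refl smooth_on_imp_differentiable[of S]) (auto simp: frame_on_def)
  finally show ?thesis .
qed

section \<open>Differential identities\<close>

text \<open>
  The \<open>wi j\<close> are the coordinates of \<open>(f d/dt)\<^sup>j (k v 0)\<close> in the moving frame. If they vanish for \<open>j = 4\<close>,
  everything can be expressed through \<open>\<rho> = f' / (2 f)\<close>.
\<close>

lemma wuenschmann_identities:
  fixes f k K0 K1 K2 :: "real fps" and w0 w1 w2 w3 :: "nat \<Rightarrow> real fps"
  assumes f: "fps_nth f 0 \<noteq> 0" and k: "k \<noteq> 0"
    and w_0: "w0 0 = k" "w1 0 = 0" "w2 0 = 0" "w3 0 = 0"
    and w_Suc: "\<And>j. w0 (Suc j) = f * (fps_deriv (w0 j) - K0 * w3 j)"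
      "\<And>j. w1 (Suc j) = f * (fps_deriv (w1 j) + w0 j + K1 * w3 j)"
      "\<And>j. w2 (Suc j) = f * (fps_deriv (w2 j) + w1 j - K2 * w3 j)"
      "\<And>j. w3 (Suc j) = f * (fps_deriv (w3 j) + w2 j)"
    and w_4: "w0 4 = 0" "w1 4 = 0" "w2 4 = 0" "w3 4 = 0"
  shows "K1 = - fps_deriv K2" and "100 * K0 = 9 * K2 * K2 - 30 * fps_deriv K1"
proof -
  define \<rho> where "\<rho> = fps_const (1 / 2) * fps_deriv f * inverse f"
  have "2 * \<rho> * f = (2 * fps_const (1 / 2)) * fps_deriv f * (inverse f * f)"
    by (simp add: \<rho>_def algebra_simps)
  also have "2 * fps_const (1 / 2 :: real) = 1"
    by (simp add: fps_numeral_fps_const fps_const_mult flip: fps_const_1_eq_1)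
  finally have f': "fps_deriv f = 2 * \<rho> * f"
    using inverse_mult_eq_1[OF f] by simp
  have nz: "f \<noteq> 0" "k \<noteq> 0" using f k by auto
  note w1 = w_Suc[of 0, unfolded w_0, simplified]
  note w2 = w_Suc[of "Suc 0", unfolded w1, simplified]
  note w3 = w_Suc[of "Suc (Suc 0)", unfolded w2, simplified]
  note w4 = w_Suc[of "Suc (Suc (Suc 0))", unfolded w3, simplified]
  note z = w_4[unfolded numeral_eq_Suc BitM.simps pred_numeral_simps numeral_One One_nat_def]
  have cancel: "x = 0" if "f * f * f * f * (k * x) = w" "w = 0" for x w using that nz by simp
  \<comment> \<open>The system \<open>w_4\<close> is triangular: the coordinate along
    \<open>v 3\<close> fixes the logarithmic derivative of \<open>k\<close>, and those along
    \<open>v 2\<close>, \<open>v 1\<close>, \<open>v 0\<close> then give \<open>K2\<close>,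
    \<open>K1\<close>, \<open>K0\<close> in terms of \<rho> and its derivatives.\<close>
  have "f * f * f * f * (4 * (fps_deriv k + 3 * \<rho> * k)) = w3 (Suc (Suc (Suc (Suc 0))))"
    unfolding w4 by (simp add: f' algebra_simps)
  then have "fps_deriv k + 3 * \<rho> * k = 0"
    using z(4) nz by (metis mult_eq_0_iff zero_neq_numeral)
  then have k': "fps_deriv k = - (3 * \<rho> * k)" by (simp add: eq_neg_iff_add_eq_0)
  define r1 r2 r3 where "r1 = fps_deriv \<rho>" and "r2 = fps_deriv r1" and "r3 = fps_deriv r2"
  note r = r1_def[symmetric] r2_def[symmetric] r3_def[symmetric]
  have "- 10 * \<rho> * \<rho> - 10 * r1 - K2 = 0"
    by (rule cancel[OF _ z(3)], unfold w4) (simp add: f' k' r algebra_simps)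
  then have K2: "K2 = - 10 * \<rho> * \<rho> - 10 * r1" by (simp add: algebra_simps)
  have "K1 - (20 * \<rho> * r1 + 10 * r2) = 0"
    by (rule cancel[OF _ z(2)], unfold w4) (simp add: f' k' r algebra_simps)
  then have K1: "K1 = 20 * \<rho> * r1 + 10 * r2" by simp
  have "9 * \<rho> * \<rho> * \<rho> * \<rho> + 18 * \<rho> * \<rho> * r1 - 6 * \<rho> * r2 + 3 * r1 * r1 - 3 * r3 - K0 = 0"
    by (rule cancel[OF _ z(1)], unfold w4) (simp add: f' k' r algebra_simps)
  then have K0: "K0 = 9 * \<rho> * \<rho> * \<rho> * \<rho> + 18 * \<rho> * \<rho> * r1 - 6 * \<rho> * r2 + 3 * r1 * r1 - 3 * r3"
    by simp
  show "K1 = - fps_deriv K2"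
    by (simp add: K1 K2 r algebra_simps)
  show "100 * K0 = 9 * K2 * K2 - 30 * fps_deriv K1"
    by (simp add: K0 K1 K2 r algebra_simps)
qed

text \<open>
  Here \<open>c i j k\<close> stands for the coordinates of the projection of the bracket of \<open>V i\<close> and \<open>V j\<close>, whose recursion
  is the Jacobi identity, and \<open>z i j\<close> for the derivative of \<open>X\<^sup>j K2\<close> along \<open>V i\<close>.
\<close>

lemma structure_identities:
  fixes K0 K1 K2 :: "real fps" and c :: "nat \<Rightarrow> nat \<Rightarrow> nat \<Rightarrow> real fps" and z :: "nat \<Rightarrow> nat \<Rightarrow> real fps"
  assumes c': "\<And>i j. fps_deriv (c i j 0) - K0 * c i j 3 = c (Suc i) j 0 + c i (Suc j) 0"
      "\<And>i j. fps_deriv (c i j 1) + c i j 0 + K1 * c i j 3 = c (Suc i) j 1 + c i (Suc j) 1"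
      "\<And>i j. fps_deriv (c i j 2) + c i j 1 - K2 * c i j 3 = c (Suc i) j 2 + c i (Suc j) 2"
      "\<And>i j. fps_deriv (c i j 3) + c i j 2 = c (Suc i) j 3 + c i (Suc j) 3"
    and anti: "\<And>i j k. c j i k = - c i j k"
    and c01: "c 0 1 2 = 0" "c 0 1 3 = 0" and c12: "c 1 2 3 = 0"
    and z': "\<And>i j. fps_deriv (z i j) = z (Suc i) j + z i (Suc j)"
    and c4: "\<And>i. c i 4 0 = - K0 * c i 0 0 + K1 * c i 1 0 - K2 * c i 2 0 - y0 i"
      "\<And>i. c i 4 1 = - K0 * c i 0 1 + K1 * c i 1 1 - K2 * c i 2 1 - z i 1"
      "\<And>i. c i 4 2 = - K0 * c i 0 2 + K1 * c i 1 2 - K2 * c i 2 2 - z i 0"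
      "\<And>i. c i 4 3 = - K0 * c i 0 3 + K1 * c i 1 3 - K2 * c i 2 3"
    and y0: "\<And>i. 100 * y0 i = 30 * z i 2 + 18 * K2 * z i 0"
    and K1: "K1 = - fps_deriv K2" and K0: "100 * K0 = 9 * K2 * K2 - 30 * fps_deriv K1"
    and main: "4 * z 1 0 + 3 * z 0 1 = 0"
  shows "10 * z 2 0 + 5 * z 1 1 + 3 * K2 * z 0 0 = 0"
    and "20 * z 3 0 + 5 * z 2 1 + 6 * fps_deriv K2 * z 0 0 - 36 * K2 * fps_deriv (z 0 0) = 0"
proof -
  have anti0: "c i i k = 0" for i k
  proof -
    have "2 * c i i k = 0" using anti[of i i k] by (metis add.right_inverse mult_2)
    then show ?thesis by simp
  qed
  \<comment> \<open>These are the only coordinates of \<open>c 0 1\<close> and \<open>c 1 2\<close>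
    that may be nonzero. The recursion and the form of the brackets with \<open>V 4\<close> express
    all other brackets needed below by them.\<close>
  define a b p q r where "a = c 0 1 0" and "b = c 0 1 1" and "p = c 1 2 0" and "q = c 1 2 1" and "r = c 1 2 2"
  note abb = a_def[symmetric] b_def[symmetric] p_def[symmetric] q_def[symmetric] r_def[symmetric]
  have e: "Suc 0 = 1" "Suc 1 = 2" "Suc 2 = 3" "Suc 3 = 4" by simp_all
  note One_nat_def [simp del] fps_deriv_eq_0_iff [simp del]
  have c02: "c 0 2 0 = fps_deriv a" "c 0 2 1 = fps_deriv b + a" "c 0 2 2 = b" "c 0 2 3 = 0"
    using c'[of 0 1] unfolding e c01 anti0 abb by (simp_all add: add_ac)
  have c03: "c 0 3 0 = fps_deriv (fps_deriv a) - p" "c 0 3 1 = fps_deriv (fps_deriv b) + 2 * fps_deriv a - q"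
    "c 0 3 2 = 2 * fps_deriv b + a - r" "c 0 3 3 = b"
    using c'[of 0 2] unfolding e c02 c12 abb by (simp_all add: algebra_simps)
  have c13: "c 1 3 0 = fps_deriv p" "c 1 3 1 = fps_deriv q + p" "c 1 3 2 = fps_deriv r + q" "c 1 3 3 = r"
    using c'[of 1 2] unfolding e c12 anti0 abb by (simp_all add: add_ac)
  have c04: "c 0 4 0 = K1 * a - K2 * fps_deriv a - y0 0" "c 0 4 1 = K1 * b - K2 * (fps_deriv b + a) - z 0 1"
    "c 0 4 2 = - K2 * b - z 0 0" "c 0 4 3 = 0"
    using c4[of 0] unfolding c02 anti0 c01 abb by simp_all
  \<comment> \<open>The bracket of \<open>V 0\<close> and \<open>V 4\<close> is known in two ways,
    by the recursion and by the relation for \<open>V 4\<close>. Its four coordinates express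
    \<open>a\<close>, \<open>z 0 0\<close>, \<open>z 0 1\<close> and \<open>y0 0\<close> by the
    other functions.\<close>
  have a: "a = 2 * r - 3 * fps_deriv b"
    using c'(4)[of 0 3] unfolding e c03 c13 c04 by (simp add: algebra_simps)
  have z00: "z 0 0 = 2 * q - 2 * fps_deriv a"
    using c'(3)[of 0 3] unfolding e c03 c13 c04 a by (simp add: algebra_simps)
  have z01: "z 0 1 = 2 * p - 2 * fps_deriv (fps_deriv a) + (fps_deriv q - (fps_deriv (fps_deriv (fps_deriv b)) + fps_deriv (fps_deriv a) - fps_deriv q)) - K2 * (fps_deriv b + a)"
    using c'(2)[of 0 3] unfolding e c03 c13 c04 by (simp add: algebra_simps)
  have y00: "y0 0 = fps_deriv p - (fps_deriv (fps_deriv (fps_deriv a)) - fps_deriv p - K0 * b) + K1 * a - K2 * fps_deriv a"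
    using c'(1)[of 0 3] unfolding e c03 c13 c04 by (simp add: algebra_simps)
  have c10: "c 1 0 0 = - a" "c 1 0 1 = - b" "c 1 0 2 = 0" "c 1 0 3 = 0"
    using anti[of 0 1 0] anti[of 0 1 1] anti[of 0 1 2] anti[of 0 1 3] c01 by (simp_all add: a_def b_def)
  have c20: "c 2 0 0 = - fps_deriv a" "c 2 0 1 = - fps_deriv b - a" "c 2 0 2 = - b" "c 2 0 3 = 0"
    unfolding anti[of 2 0] c02 by simp_all
  have c21: "c 2 1 0 = - p" "c 2 1 1 = - q" "c 2 1 2 = - r" "c 2 1 3 = 0"
    unfolding anti[of 2 1] c12 p_def q_def r_def by simp_all
  have c14: "c 1 4 0 = K0 * a - K2 * p - y0 1" "c 1 4 1 = K0 * b - K2 * q - z 1 1"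
    "c 1 4 2 = - K2 * r - z 1 0" "c 1 4 3 = 0"
    using c4[of 1] unfolding anti0 c10 c12 abb by (simp_all add: algebra_simps)
  have c23: "c 2 3 0 = fps_deriv (fps_deriv p) - K0 * r - K0 * a + K2 * p + y0 1"
    "c 2 3 1 = fps_deriv (fps_deriv q) + 2 * fps_deriv p + K1 * r - K0 * b + K2 * q + z 1 1"
    "c 2 3 2 = fps_deriv (fps_deriv r) + 2 * fps_deriv q + p + z 1 0"
    "c 2 3 3 = 2 * fps_deriv r + q"
    using c'[of 1 3] unfolding e c13 c14 by (simp_all add: algebra_simps)
  have c24: "c 2 4 0 = K0 * fps_deriv a - K1 * p - y0 2" "c 2 4 1 = K0 * (fps_deriv b + a) - K1 * q - z 2 1"
    "c 2 4 2 = K0 * b - K1 * r - z 2 0" "c 2 4 3 = 0"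
    using c4[of 2] unfolding anti0 c20 c21 by (simp_all add: algebra_simps)
  \<comment> \<open>The same comparison for \<open>V 2\<close> and \<open>V 4\<close>, where the
    bracket of \<open>V 3\<close> with itself vanishes.\<close>
  note eqs = c'(1)[of 2 3] c'(2)[of 2 3] c'(3)[of 2 3] c'(4)[of 2 3]
  note eqs' = eqs[unfolded e c23 c24 anti0]
  define r1 r2 r3 r4 where "r1 = fps_deriv r" and "r2 = fps_deriv r1" and "r3 = fps_deriv r2" and "r4 = fps_deriv r3"
  define q1 q2 q3 where "q1 = fps_deriv q" and "q2 = fps_deriv q1" and "q3 = fps_deriv q2"
  define b1 b2 b3 b4 b5 where "b1 = fps_deriv b" and "b2 = fps_deriv b1" and "b3 = fps_deriv b2" and "b4 = fps_deriv b3"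
    and "b5 = fps_deriv b4"
  define k1 k2 k3 where "k1 = fps_deriv K2" and "k2 = fps_deriv k1" and "k3 = fps_deriv k2"
  note D = r1_def[symmetric] r2_def[symmetric] r3_def[symmetric] r4_def[symmetric]
    q1_def[symmetric] q2_def[symmetric] q3_def[symmetric] b1_def[symmetric] b2_def[symmetric] b3_def[symmetric]
    b4_def[symmetric] b5_def[symmetric] k1_def[symmetric] k2_def[symmetric] k3_def[symmetric]
  have zd: "fps_deriv (z 0 0) = z 1 0 + z 0 1" "fps_deriv (z 1 0) = z 2 0 + z 1 1" "fps_deriv (z 0 1) = z 1 1 + z 0 2"
    "fps_deriv (z 2 0) = z 3 0 + z 2 1" "fps_deriv (z 1 1) = z 2 1 + z 1 2" "fps_deriv (z 0 2) = z 1 2 + z 0 3"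
    using z'[of 0 0] z'[of 1 0] z'[of 0 1] z'[of 2 0] z'[of 1 1] z'[of 0 2] unfolding e by simp_all
  have K1': "K1 = - k1" using K1 unfolding D .
  have K0': "100 * K0 = 9 * K2 * K2 + 30 * k2" "100 * fps_deriv K0 = 18 * K2 * k1 + 30 * k3"
  proof -
    show *: "100 * K0 = 9 * K2 * K2 + 30 * k2" using K0 unfolding K1' by (simp add: D)
    have "fps_deriv (100 * K0) = 18 * K2 * k1 + 30 * k3" unfolding * by (simp add: D algebra_simps)
    then show "100 * fps_deriv K0 = 18 * K2 * k1 + 30 * k3" by simp
  qed
  have Z: "z 0 0 = 2 * q - 4 * r1 + 6 * b2" using z00 by (simp add: a D)
  have p: "p = - 3 * q1 - 3 * r2 - z 1 0"
    using eqs'(4) by (simp add: D) algebra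
  have p1: "fps_deriv p = - 3 * q2 - 3 * r3 - z 2 0 - z 1 1"
    and p2: "fps_deriv (fps_deriv p) = - 3 * q3 - 3 * r4 - z 3 0 - 2 * z 2 1 - z 1 2"
    unfolding p by (simp_all add: D zd)
  have Z1: "z 1 0 + z 0 1 = 2 * q1 - 4 * r2 + 6 * b3"
    unfolding zd(1)[symmetric] unfolding Z by (simp add: D)
  have "fps_deriv (z 1 0 + z 0 1) = 2 * q2 - 4 * r3 + 6 * b4"
    unfolding Z1 by (simp add: D)
  then have Z2: "z 2 0 + 2 * z 1 1 + z 0 2 = 2 * q2 - 4 * r3 + 6 * b4" by (simp add: zd algebra_simps)
  have "fps_deriv (z 2 0 + 2 * z 1 1 + z 0 2) = 2 * q3 - 4 * r4 + 6 * b5"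
    unfolding Z2 by (simp add: D)
  then have Z3: "z 3 0 + 3 * z 2 1 + 3 * z 1 2 + z 0 3 = 2 * q3 - 4 * r4 + 6 * b5" by (simp add: zd algebra_simps)
  have M1: "4 * z 2 0 + 7 * z 1 1 + 3 * z 0 2 = 0"
    using arg_cong[OF main, of fps_deriv] by (simp add: zd algebra_simps)
  have M2: "4 * z 3 0 + 11 * z 2 1 + 10 * z 1 2 + 3 * z 0 3 = 0"
    using arg_cong[OF M1, of fps_deriv] by (simp add: zd algebra_simps)
  have "20 * (r2 - b3) + K2 * (2 * r - 2 * b1) + 4 * z 1 0 + 3 * z 0 1 = 0"
    using z01 Z1 p unfolding a by (simp add: D) algebra
  \<comment> \<open>With \<open>u = r - b'\<close> this is \<open>10 u'' + K2 u = 0\<close>; the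
    hypothesis \<open>main\<close> is exactly what removes the inhomogeneous term.\<close>
  then have I: "20 * (r2 - b3) + K2 * (2 * r - 2 * b1) = 0"
    using main by algebra
  have I1: "20 * (r3 - b4) + k1 * (2 * r - 2 * b1) + K2 * (2 * r1 - 2 * b2) = 0"
    using arg_cong[OF I, of fps_deriv] by (simp add: D algebra_simps)
  have I2: "20 * (r4 - b5) + k2 * (2 * r - 2 * b1) + 2 * k1 * (2 * r1 - 2 * b2) + K2 * (2 * r2 - 2 * b3) = 0"
    using arg_cong[OF I1, of fps_deriv] by (simp add: D algebra_simps)
  have "z 2 0 + z 1 1 + 6 * q2 + 8 * r3 + 2 * k1 * r + 2 * K2 * r1 + 2 * K0 * b = 0"
    using eqs'(3) p1 zd(2) unfolding K1' by (simp add: D p) algebra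
  \<comment> \<open>Thus \<open>b\<close> solves the same linear equation of order four as
    \<open>v 0\<close>, with \<open>K1 = - K2'\<close> inserted.\<close>
  then have III: "b4 + k1 * b1 + K2 * b2 + K0 * b = 0"
    using I1 Z2 M1 by algebra
  have III1: "b5 + k2 * b1 + 2 * k1 * b2 + K2 * b3 + fps_deriv K0 * b + K0 * b1 = 0"
    using arg_cong[OF III, of fps_deriv] by (simp add: D algebra_simps)
  have "y0 0 = 2 * fps_deriv p - (2 * r3 - 3 * b4) + K0 * b - k1 * (2 * r - 3 * b1) - K2 * (2 * r1 - 3 * b2)"
    using y00 unfolding a K1' by (simp add: D algebra_simps)
  then have "z 2 0 + z 1 1 + y0 0 = 0"
    using p1 III Z2 M1 I1 by algebra
  \<comment> \<open>The derivative \<open>M1\<close> of \<open>main\<close> eliminates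
    \<open>z 0 2\<close>, which enters through \<open>y0 0\<close>.\<close>
  then have E2: "10 * z 2 0 + 5 * z 1 1 + 3 * K2 * z 0 0 = 0"
    using y0[of 0] M1 by algebra
  then show "10 * z 2 0 + 5 * z 1 1 + 3 * K2 * z 0 0 = 0" .
  have E2': "10 * z 3 0 + 15 * z 2 1 + 5 * z 1 2 + 3 * k1 * z 0 0 + 3 * K2 * (z 1 0 + z 0 1) = 0"
    using arg_cong[OF E2, of fps_deriv] by (simp add: zd D algebra_simps)
  \<comment> \<open>The coordinate along \<open>v 1\<close> brings in \<open>z 3 0\<close> through
    the second derivative of \<open>p\<close>; the derivatives of \<open>I\<close>,
    \<open>III\<close>, \<open>E2\<close> and \<open>main\<close> eliminate \<open>b\<close>,
    \<open>p\<close>, \<open>q\<close>, \<open>r\<close>.\<close>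
  have V: "q3 + 2 * fps_deriv (fps_deriv p) - (k2 * r + k1 * r1) - (fps_deriv K0 * b + K0 * b1) + (k1 * q + K2 * q1) + z 2 1 + z 1 2
    + (fps_deriv (fps_deriv p) - K0 * r - K0 * (2 * r - 3 * b1) + K2 * p + y0 1) - k1 * (2 * r1 + q)
    = K0 * (2 * r - 2 * b1) + k1 * q - z 2 1"
    using eqs'(2) unfolding a K1' by (simp add: D zd algebra_simps)
  show "20 * z 3 0 + 5 * z 2 1 + 6 * fps_deriv K2 * z 0 0 - 36 * K2 * fps_deriv (z 0 0) = 0"
    unfolding D zd using V p2 p Z Z1 Z3 main M2 E2' I I1 I2 III1 y0[of 1] K0'(1) by algebra
qed


text \<open>Here \<open>n i j k\<close> stands for the coordinates of the covariant derivative of \<open>v j\<close> along \<open>V i\<close>.\<close>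

lemma totally_geodesic_identity:
  fixes K0 K1 K2 :: "real fps" and n :: "nat \<Rightarrow> nat \<Rightarrow> nat \<Rightarrow> real fps" and z :: "nat \<Rightarrow> nat \<Rightarrow> real fps"
  assumes n': "\<And>i j. fps_deriv (n i j 0) - K0 * n i j 3 = n (Suc i) j 0 + n i (Suc j) 0"
      "\<And>i j. fps_deriv (n i j 1) + n i j 0 + K1 * n i j 3 = n (Suc i) j 1 + n i (Suc j) 1"
      "\<And>i j. fps_deriv (n i j 2) + n i j 1 - K2 * n i j 3 = n (Suc i) j 2 + n i (Suc j) 2"
      "\<And>i j. fps_deriv (n i j 3) + n i j 2 = n (Suc i) j 3 + n i (Suc j) 3"
    and n0: "\<And>i. n i 0 2 = 0" "\<And>i. n i 0 3 = 0"
    and n2: "\<And>i. i < 3 \<Longrightarrow> n i 2 3 = 0"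
    and n4: "\<And>i. n i 4 2 = - K0 * n i 0 2 + K1 * n i 1 2 - K2 * n i 2 2 - z i 0"
      "\<And>i. n i 4 3 = - K0 * n i 0 3 + K1 * n i 1 3 - K2 * n i 2 3"
      "n 4 0 1 = - K0 * n 0 0 1 + K1 * n 1 0 1 - K2 * n 2 0 1"
    and z': "fps_deriv (z 0 0) = z 1 0 + z 0 1"
  shows "4 * z 1 0 + 3 * z 0 1 = 0"
proof -
  have e: "Suc 0 = 1" "Suc 1 = 2" "Suc 2 = 3" "Suc 3 = 4" by simp_all
  note One_nat_def [simp del] fps_deriv_eq_0_iff [simp del]
  define a b where "a i = n i 0 0" and "b i = n i 0 1" for i
  \<comment> \<open>The values on \<open>V i\<close> of the Lie derivatives along \<open>X\<close>
    of \<alpha> and \<beta>: the value on the bracket \<open>V (i + 1)\<close> is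
    subtracted.\<close>
  define a1 b1 where "a1 i = fps_deriv (a i) - a (Suc i)" and "b1 i = fps_deriv (b i) - b (Suc i)" for i
  define a2 b2 where "a2 i = fps_deriv (a1 i) - a1 (Suc i)" and "b2 i = fps_deriv (b1 i) - b1 (Suc i)" for i
  define b3 where "b3 i = fps_deriv (b2 i) - b2 (Suc i)" for i
  have m1: "n i 1 0 = a1 i" "n i 1 1 = a i + b1 i" "n i 1 2 = b i" "n i 1 3 = 0" for i
    using n'[of i 0] unfolding e n0 a_def[symmetric] b_def[symmetric]
    by (simp_all add: a1_def b1_def algebra_simps)
  have m2: "n i 2 0 = a2 i" "n i 2 1 = 2 * a1 i + b2 i" "n i 2 2 = a i + 2 * b1 i" "n i 2 3 = b i" for i
    using n'[of i 1] unfolding e m1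
    by (simp_all add: a1_def b1_def a2_def b2_def algebra_simps)
  have m3: "n i 3 1 = 3 * a2 i + b3 i + K1 * b i" "n i 3 2 = 3 * a1 i + 3 * b2 i - K2 * b i" "n i 3 3 = a i + 3 * b1 i" for i
    using n'(2-4)[of i 2] unfolding e m2
    by (simp_all add: a1_def b1_def a2_def b2_def b3_def algebra_simps)
  \<comment> \<open>\<nabla> (v 4) is computed twice, by differentiating \<nabla> (v 3) and from the
    relation for \<open>v 4\<close>: here the coefficient of \<open>v 3\<close>, in
    \<open>pre\<close> that of \<open>v 2\<close>.\<close>
  have "2 * (2 * a1 i + 3 * b2 i) = 0" for i
    using n'(4)[of i 3] n4(2)[of i] unfolding e m3 m2 m1 n0
    by (simp add: a1_def b1_def b2_def algebra_simps)
  then have a1: "2 * a1 i + 3 * b2 i = 0" for i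
    by (metis mult_eq_0_iff zero_neq_numeral)
  have a2: "2 * a2 i + 3 * b3 i = 0" for i
  proof -
    have "2 * a2 i + 3 * b3 i = fps_deriv (2 * a1 i + 3 * b2 i) - (2 * a1 (Suc i) + 3 * b2 (Suc i))"
      by (simp add: a2_def b3_def algebra_simps)
    then show ?thesis by (simp only: a1) simp
  qed
  have pre: "6 * a2 i + 4 * b3 i - 2 * K2 * b1 i - fps_deriv K2 * b i + z i 0 = 0" for i
    using n'(3)[of i 3] n4(1)[of i] unfolding e m3 m2 m1 n0
    by (simp add: a1_def b1_def b2_def a2_def b3_def algebra_simps)
  have main: "5 * b3 i + 2 * K2 * b1 i + fps_deriv K2 * b i - z i 0 = 0" for i
    using pre[of i] a2[of i] by algebra
  \<comment> \<open>By \<open>m2\<close> the coefficient of \<open>v 3\<close> in \<nabla> (v 2) is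
    \<beta> itself, so total geodesy kills \<beta> on \<open>V 0\<close>, \<open>V 1\<close>,
    \<open>V 2\<close>, and hence on \<open>V 4\<close>.\<close>
  have b: "b 0 = 0" "b 1 = 0" "b 2 = 0"
    using n2[of 0] n2[of 1] n2[of 2] unfolding m2 by simp_all
  have b4: "b 4 = 0"
    using n4(3) b unfolding b_def by simp
  have "z 0 0 = - 5 * b 3"
    using main[of 0] by (simp add: b3_def b2_def b1_def b e)
  moreover have "z 1 0 = 15 * fps_deriv (b 3)"
    using main[of 1] by (simp add: b3_def b2_def b1_def b b4 e)
  \<comment> \<open>The two values give \<open>z 1 0 = - 3 (z 0 0)'\<close>, and \<open>z'\<close>
    splits the derivative into \<open>z 1 0 + z 0 1\<close>.\<close>
  ultimately show ?thesis using z' by simp algebra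
qed

text \<open>
  Twice the coordinates of the covariant derivative of \<open>v j\<close> along \<open>V i\<close>, where \<open>B m i\<close> is the value on \<open>V i\<close> of
  the \<open>m\<close>-th derivative of \<open>\<beta>\<close> along \<open>X\<close>, and \<open>\<alpha> = - 3/2 \<beta>'\<close>.
\<close>

definition connection_coeff ::
    "(nat \<Rightarrow> nat \<Rightarrow> 'a::comm_ring_1) \<Rightarrow> 'a \<Rightarrow> 'a \<Rightarrow> 'a \<Rightarrow> nat \<Rightarrow> nat \<Rightarrow> nat \<Rightarrow> 'a" where
  "connection_coeff B K0 K1 K2 i j k =
     (if j = 0 then [- 3 * B 1 i, 2 * B 0 i, 0, 0]
      else if j = 1 then [- 3 * B 2 i, - B 1 i, 2 * B 0 i, 0]
      else if j = 2 then [- 3 * B 3 i, - 4 * B 2 i, B 1 i, 2 * B 0 i]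
      else [- 3 * B 4 i - 2 * K0 * B 0 i, - 7 * B 3 i + 2 * K1 * B 0 i, - 3 * B 2 i - 2 * K2 * B 0 i, 3 * B 1 i]) ! k"

lemma connection_coeff_simps:
  "connection_coeff B k0 k1 k2 i 0 0 = - 3 * B 1 i" "connection_coeff B k0 k1 k2 i 0 1 = 2 * B 0 i"
  "connection_coeff B k0 k1 k2 i 0 2 = 0" "connection_coeff B k0 k1 k2 i 0 3 = 0"
  "connection_coeff B k0 k1 k2 i 1 0 = - 3 * B 2 i" "connection_coeff B k0 k1 k2 i 1 1 = - B 1 i"
  "connection_coeff B k0 k1 k2 i 1 2 = 2 * B 0 i" "connection_coeff B k0 k1 k2 i 1 3 = 0"
  "connection_coeff B k0 k1 k2 i 2 0 = - 3 * B 3 i" "connection_coeff B k0 k1 k2 i 2 1 = - 4 * B 2 i"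
  "connection_coeff B k0 k1 k2 i 2 2 = B 1 i" "connection_coeff B k0 k1 k2 i 2 3 = 2 * B 0 i"
  "3 \<le> j \<Longrightarrow> connection_coeff B k0 k1 k2 i j 0 = - 3 * B 4 i - 2 * k0 * B 0 i"
  "3 \<le> j \<Longrightarrow> connection_coeff B k0 k1 k2 i j 1 = - 7 * B 3 i + 2 * k1 * B 0 i"
  "3 \<le> j \<Longrightarrow> connection_coeff B k0 k1 k2 i j 2 = - 3 * B 2 i - 2 * k2 * B 0 i"
  "3 \<le> j \<Longrightarrow> connection_coeff B k0 k1 k2 i j 3 = 3 * B 1 i"
  by (simp_all add: connection_coeff_def numeral_2_eq_2 numeral_3_eq_3)

lemma connection_coeff_induct [consumes 1]:
  fixes j k :: nat
  assumes "k < 4"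
    and "P 0 0" "P 0 1" "P 0 2" "P 0 3" "P 1 0" "P 1 1" "P 1 2" "P 1 3" "P 2 0" "P 2 1" "P 2 2" "P 2 3"
    and "\<And>j. 3 \<le> j \<Longrightarrow> P j 0 \<and> P j 1 \<and> P j 2 \<and> P j 3"
  shows "P j k"
proof -
  have "j = 0 \<or> j = 1 \<or> j = 2 \<or> 3 \<le> j" by linarith
  then show ?thesis using assms(2-) less_4_cases[OF assms(1)] by (elim disjE) simp_all
qed

text \<open>For \<open>j < 3\<close> the rows of \<open>connection_coeff\<close> are built so that
  the recursion is the Leibniz rule. The content is the case \<open>j = 3\<close>, where \<nabla> (v
  4) is prescribed: its coefficient of \<open>v 3\<close> agrees by the choice of \<alpha>, and
  those of \<open>v 2\<close>, \<open>v 1\<close>, \<open>v 0\<close> amount to the equation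
  \<open>E\<close> for \<beta> and, through the Bryant-Wuenschmann identities, its derivatives
  \<open>F\<close> and \<open>H\<close>.\<close>

lemma connection_coeff_recursion:
  fixes K0 K1 K2 :: "real fps" and B z :: "nat \<Rightarrow> nat \<Rightarrow> real fps"
  assumes B': "\<And>m i. i < 4 \<Longrightarrow> fps_deriv (B m i) = B (Suc m) i + B m (Suc i)"
    and B4: "\<And>m. B m 4 = - K0 * B m 0 + K1 * B m 1 - K2 * B m 2"
    and B0: "B 0 0 = 0" "B 0 1 = 0" "B 0 2 = 0" "5 * B 0 3 = - z 0 0"
    and z': "\<And>i j. fps_deriv (z i j) = z (Suc i) j + z i (Suc j)"
    and z4: "\<And>j. z 4 j = - K0 * z 0 j + K1 * z 1 j - K2 * z 2 j"
    and y0: "\<And>i. 100 * y0 i = 30 * z i 2 + 18 * K2 * z i 0"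
    and K1: "K1 = - fps_deriv K2" and K0: "100 * K0 = 9 * K2 * K2 - 30 * fps_deriv K1"
    and main: "4 * z 1 0 + 3 * z 0 1 = 0"
    and E2: "10 * z 2 0 + 5 * z 1 1 + 3 * K2 * z 0 0 = 0"
    and E3: "20 * z 3 0 + 5 * z 2 1 + 6 * fps_deriv K2 * z 0 0 - 36 * K2 * fps_deriv (z 0 0) = 0"
  defines "c \<equiv> connection_coeff B K0 K1 K2"
  assumes i: "i < 4"
  shows "j < 3 \<Longrightarrow> fps_deriv (c i j 0) - K0 * c i j 3 = c (Suc i) j 0 + c i (Suc j) 0"
    and "j < 3 \<Longrightarrow> fps_deriv (c i j 1) + c i j 0 + K1 * c i j 3 = c (Suc i) j 1 + c i (Suc j) 1"
    and "j < 3 \<Longrightarrow> fps_deriv (c i j 2) + c i j 1 - K2 * c i j 3 = c (Suc i) j 2 + c i (Suc j) 2"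
    and "j < 3 \<Longrightarrow> fps_deriv (c i j 3) + c i j 2 = c (Suc i) j 3 + c i (Suc j) 3"
    and "fps_deriv (c i 3 0) - K0 * c i 3 3 = c (Suc i) 3 0 + (- K0 * c i 0 0 + K1 * c i 1 0 - K2 * c i 2 0 - 2 * y0 i)"
    and "fps_deriv (c i 3 1) + c i 3 0 + K1 * c i 3 3 = c (Suc i) 3 1 + (- K0 * c i 0 1 + K1 * c i 1 1 - K2 * c i 2 1 - 2 * z i 1)"
    and "fps_deriv (c i 3 2) + c i 3 1 - K2 * c i 3 3 = c (Suc i) 3 2 + (- K0 * c i 0 2 + K1 * c i 1 2 - K2 * c i 2 2 - 2 * z i 0)"
    and "fps_deriv (c i 3 3) + c i 3 2 = c (Suc i) 3 3 + (- K0 * c i 0 3 + K1 * c i 1 3 - K2 * c i 2 3)"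
proof -
  have e: "Suc 0 = 1" "Suc 1 = 2" "Suc 2 = 3" "Suc 3 = 4" "Suc 4 = 5" by simp_all
  note One_nat_def [simp del] fps_deriv_eq_0_iff [simp del]
  note cs = connection_coeff_simps[where B=B and ?k0.0=K0 and ?k1.0=K1 and ?k2.0=K2, folded c_def]
  define k1 k2 k3 where "k1 = fps_deriv K2" and "k2 = fps_deriv k1" and "k3 = fps_deriv k2"
  note D = k1_def[symmetric] k2_def[symmetric] k3_def[symmetric]
  have K1': "K1 = - k1" using K1 unfolding D .
  have K0': "100 * K0 = 9 * K2 * K2 + 30 * k2" using K0 unfolding K1' by (simp add: D)
  have "fps_deriv (100 * K0) = 18 * K2 * k1 + 30 * k3" unfolding K0' by (simp add: D algebra_simps)
  then have K0'': "100 * fps_deriv K0 = 18 * K2 * k1 + 30 * k3" by simp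
  have small: "i = 0 \<or> i = 1 \<or> i = 2 \<or> i = 3" if "i < 4" for i :: nat using that by linarith
  \<comment> \<open>The equation for \<beta> evaluated on \<open>V i\<close>. Index 4 is included
    because differentiating the equation at \<open>V 3\<close> involves its value at
    \<open>V 4\<close>.\<close>
  have E: "5 * B 3 i + 2 * K2 * B 1 i + k1 * B 0 i - z i 0 = 0" if "i \<le> 4" for i
  proof -
    define l l1 l2 l3 where "l = B 0 3" and "l1 = fps_deriv l" and "l2 = fps_deriv l1" and "l3 = fps_deriv l2"
    note L = l_def[symmetric] l1_def[symmetric] l2_def[symmetric] l3_def[symmetric]
    have b: "B (Suc m) i = fps_deriv (B m i) - B m (Suc i)" if "i < 4" for m i
      using B'[OF that, of m] by simp
    have b0: "B 0 4 = 0" using B4[of 0] B0 by simp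
    have b1: "B 1 0 = 0" "B 1 1 = 0" "B 1 2 = - l" "B 1 3 = l1"
      using b[of 0 0] b[of 1 0] b[of 2 0] b[of 3 0] unfolding e B0 b0 L by simp_all
    have b1': "B 1 4 = K2 * l" using B4[of 1] b1 by simp
    have b2: "B 2 0 = 0" "B 2 1 = l" "B 2 2 = - 2 * l1" "B 2 3 = l2 - K2 * l"
      using b[of 0 1] b[of 1 1] b[of 2 1] b[of 3 1] unfolding e b1 b1' by (simp_all add: L)
    have b2': "B 2 4 = - k1 * l + 2 * K2 * l1" using B4[of 2] b2 unfolding K1' by simp
    have b3: "B 3 0 = - l" "B 3 1 = 3 * l1" "B 3 2 = - 3 * l2 + K2 * l" "B 3 3 = l3 - 3 * K2 * l1"
      using b[of 0 2] b[of 1 2] b[of 2 2] b[of 3 2] unfolding e b2 b2' by (simp_all add: L D algebra_simps)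
    have zl: "z 0 0 = - 5 * l" using B0(4) unfolding L by (simp add: minus_equation_iff)
    have zd: "fps_deriv (z 0 0) = z 1 0 + z 0 1" "fps_deriv (z 1 0) = z 2 0 + z 1 1"
      "fps_deriv (z 2 0) = z 3 0 + z 2 1" "fps_deriv (z 1 1) = z 2 1 + z 1 2"
      using z'[of 0 0] z'[of 1 0] z'[of 2 0] z'[of 1 1] unfolding e by simp_all
    have z1: "z 1 0 = 15 * l1" using zd(1) main unfolding zl by (simp add: L) algebra
    have z2: "z 2 0 + z 1 1 = 15 * l2" using zd(2) unfolding z1 by (simp add: L)
    have z2': "z 2 0 = - 15 * l2 + 3 * K2 * l" using z2 E2 unfolding zl by algebra
    have z3: "z 3 0 + z 2 1 = - 15 * l3 + 3 * k1 * l + 3 * K2 * l1"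
      using zd(3) unfolding z2' by (simp add: L D algebra_simps)
    have "fps_deriv (z 0 0) = - 5 * l1" unfolding zl by (simp add: L)
    then have z3': "z 3 0 = 5 * l3 - 13 * K2 * l1 + k1 * l"
      using z3 E3 unfolding zl D by algebra
    \<comment> \<open>The four values are, in turn, the choice of \<beta> (V 3),
      \<open>main\<close>, \<open>E2\<close> and \<open>E3\<close>.\<close>
    have E': "5 * B 3 i + 2 * K2 * B 1 i + k1 * B 0 i - z i 0 = 0" if "i < 4" for i
      using small[OF that]
      by (elim disjE) (simp_all add: b1 b3 B0 zl z1 z2' z3' L algebra_simps)
    show ?thesis
    proof (cases "i = 4")
      case True
      have "5 * B 3 4 + 2 * K2 * B 1 4 + k1 * B 0 4 - z 4 0 =
          - K0 * (5 * B 3 0 + 2 * K2 * B 1 0 + k1 * B 0 0 - z 0 0)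
          + K1 * (5 * B 3 1 + 2 * K2 * B 1 1 + k1 * B 0 1 - z 1 0)
          - K2 * (5 * B 3 2 + 2 * K2 * B 1 2 + k1 * B 0 2 - z 2 0)"
        unfolding B4 z4 by (simp add: algebra_simps)
      then show ?thesis unfolding True using E'[of 0] E'[of 1] E'[of 2] by simp
    qed (use E' that in simp)
  qed
  have F': "5 * B 4 i + 3 * k1 * B 1 i + 2 * K2 * B 2 i + k2 * B 0 i - z i 1 = 0" if "i < 4" for i
  proof -
    have "fps_deriv (5 * B 3 i + 2 * K2 * B 1 i + k1 * B 0 i - z i 0) = 0"
      using E[of i] that by simp
    then show ?thesis
      using E[of "Suc i"] B'[OF that, of 3] B'[OF that, of 1] B'[OF that, of 0] that
      by (simp add: z' D e) algebra
  qed
  have F: "5 * B 4 i + 3 * k1 * B 1 i + 2 * K2 * B 2 i + k2 * B 0 i - z i 1 = 0" if "i \<le> 4" for i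
  proof (cases "i = 4")
    case True
    have "5 * B 4 4 + 3 * k1 * B 1 4 + 2 * K2 * B 2 4 + k2 * B 0 4 - z 4 1 =
        - K0 * (5 * B 4 0 + 3 * k1 * B 1 0 + 2 * K2 * B 2 0 + k2 * B 0 0 - z 0 1)
        + K1 * (5 * B 4 1 + 3 * k1 * B 1 1 + 2 * K2 * B 2 1 + k2 * B 0 1 - z 1 1)
        - K2 * (5 * B 4 2 + 3 * k1 * B 1 2 + 2 * K2 * B 2 2 + k2 * B 0 2 - z 2 1)"
      unfolding B4 z4 by (simp add: algebra_simps)
    then show ?thesis unfolding True using F'[of 0] F'[of 1] F'[of 2] by simp
  qed (use F' that in simp)
  have H: "5 * B 5 i + 5 * k1 * B 2 i + 2 * K2 * B 3 i + 4 * k2 * B 1 i + k3 * B 0 i - z i 2 = 0"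
  proof -
    have "fps_deriv (5 * B 4 i + 3 * k1 * B 1 i + 2 * K2 * B 2 i + k2 * B 0 i - z i 1) = 0"
      using F[of i] i by simp
    then show ?thesis
      using F[of "Suc i"] B'[OF i, of 4] B'[OF i, of 2] B'[OF i, of 1] B'[OF i, of 0] i
      by (simp add: z' D e) algebra
  qed
  have Ei: "5 * B 3 i + 2 * K2 * B 1 i + k1 * B 0 i - z i 0 = 0"
    and Fi: "5 * B 4 i + 3 * k1 * B 1 i + 2 * K2 * B 2 i + k2 * B 0 i - z i 1 = 0"
    using E F i by auto
  have Bd: "fps_deriv (B 0 i) = B 1 i + B 0 (Suc i)" "fps_deriv (B 1 i) = B 2 i + B 1 (Suc i)"
    "fps_deriv (B 2 i) = B 3 i + B 2 (Suc i)" "fps_deriv (B 3 i) = B 4 i + B 3 (Suc i)"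
    "fps_deriv (B 4 i) = B 5 i + B 4 (Suc i)"
    using B'[OF i, of 0] B'[OF i, of 1] B'[OF i, of 2] B'[OF i, of 3] B'[OF i, of 4] unfolding e by simp_all
  have three: "j = 0 \<or> j = 1 \<or> j = 2" if "j < 3" for j :: nat using that by linarith
  show "j < 3 \<Longrightarrow> fps_deriv (c i j 0) - K0 * c i j 3 = c (Suc i) j 0 + c i (Suc j) 0"
    by (drule three, elim disjE) (simp_all add: cs e Bd algebra_simps)
  show "j < 3 \<Longrightarrow> fps_deriv (c i j 1) + c i j 0 + K1 * c i j 3 = c (Suc i) j 1 + c i (Suc j) 1"
    by (drule three, elim disjE) (simp_all add: cs e Bd algebra_simps)
  show "j < 3 \<Longrightarrow> fps_deriv (c i j 2) + c i j 1 - K2 * c i j 3 = c (Suc i) j 2 + c i (Suc j) 2"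
    by (drule three, elim disjE) (simp_all add: cs e Bd algebra_simps)
  show "j < 3 \<Longrightarrow> fps_deriv (c i j 3) + c i j 2 = c (Suc i) j 3 + c i (Suc j) 3"
    by (drule three, elim disjE) (simp_all add: cs e Bd algebra_simps)
  show "fps_deriv (c i 3 3) + c i 3 2 = c (Suc i) 3 3 + (- K0 * c i 0 3 + K1 * c i 1 3 - K2 * c i 2 3)"
    by (simp add: cs Bd algebra_simps)
  show "fps_deriv (c i 3 2) + c i 3 1 - K2 * c i 3 3 = c (Suc i) 3 2 + (- K0 * c i 0 2 + K1 * c i 1 2 - K2 * c i 2 2 - 2 * z i 0)"
    by (simp add: cs Bd D K1') (use Ei in algebra)
  show "fps_deriv (c i 3 1) + c i 3 0 + K1 * c i 3 3 = c (Suc i) 3 1 + (- K0 * c i 0 1 + K1 * c i 1 1 - K2 * c i 2 1 - 2 * z i 1)"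
    by (simp add: cs Bd D K1') (use Fi in algebra)
  \<comment> \<open>The factor 100 clears the denominators in the expressions for \<open>K0\<close>
    and \<open>y0\<close>.\<close>
  have "100 * (fps_deriv (c i 3 0) - K0 * c i 3 3) = 100 * (c (Suc i) 3 0 + (- K0 * c i 0 0 + K1 * c i 1 0 - K2 * c i 2 0 - 2 * y0 i))"
    by (simp add: cs Bd D K1') (use H Ei y0[of i] K0' K0'' in algebra)
  then show "fps_deriv (c i 3 0) - K0 * c i 3 3 = c (Suc i) 3 0 + (- K0 * c i 0 0 + K1 * c i 1 0 - K2 * c i 2 0 - 2 * y0 i)"
    by (metis mult_cancel_left zero_neq_numeral)
qed

section \<open>The moving frame of a fourth order equation\<close>

lemma distinct_5: "distinct [0, 1, 2, 3, 4 :: 5]"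
  by simp

lemma UNIV_5: "(UNIV :: 5 set) = {0, 1, 2, 3, 4}"
proof (rule sym, rule card_subset_eq)
  show "card {0, 1, 2, 3, 4 :: 5} = card (UNIV :: 5 set)"
    using distinct_card[OF distinct_5] by simp
qed simp_all

lemma jet_eqI:
  fixes p q :: jet
  assumes "p $ 0 = q $ 0" "p $ 1 = q $ 1" "p $ 2 = q $ 2" "p $ 3 = q $ 3" "p $ 4 = q $ 4"
  shows "p = q"
proof -
  have "p $ i = q $ i" if "i \<in> {0, 1, 2, 3, 4}" for i using that assms by auto
  then show ?thesis unfolding vec_eq_iff by (metis UNIV_5 UNIV_I)
qed

lemma total_deriv_nth [simp]:
  "total_deriv F p $ 0 = p $ 1" "total_deriv F p $ 1 = p $ 2" "total_deriv F p $ 2 = p $ 3"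
  "total_deriv F p $ 3 = F p" "total_deriv F p $ 4 = 1"
  by (simp_all add: total_deriv_def coord_field_def axis_def)

lemma smooth_on_total_deriv:
  assumes "open S" and "smooth_on S F"
  shows "smooth_on S (total_deriv F)"
  unfolding total_deriv_def[abs_def] coord_field_def using assms
  by (intro smooth_on_add smooth_on_scaleR smooth_on_const smooth_on_vec_nth smooth_on_ident)

lemma lie_bracket_nth:
  fixes X Y :: "real^'n \<Rightarrow> real^'n"
  assumes "smooth_on S X" and "smooth_on S Y" and "p \<in> S"
  shows "lie_bracket X Y p $ i = dir_deriv X (\<lambda>q. Y q $ i) p - dir_deriv Y (\<lambda>q. X q $ i) p"
  using assms by (simp add: lie_bracket_def dir_deriv_vec_nth smooth_on_imp_differentiable)

lemma dir_deriv_coordinate: "dir_deriv Y (\<lambda>q. q $ i) p = Y p $ i" for Y :: "real^'n \<Rightarrow> real^'n"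
  using dir_deriv_vec_nth[of "\<lambda>q. q" p Y i] by (simp add: dir_deriv_def)

lemma dir_deriv_0: "open S \<Longrightarrow> p \<in> S \<Longrightarrow> (\<And>q. q \<in> S \<Longrightarrow> f q = c) \<Longrightarrow> dir_deriv X f p = 0"
  using dir_deriv_cong[of S p f "\<lambda>_. c"] by simp

locale fourth_order_ode =
  fixes F g K0 K1 K2 :: "jet \<Rightarrow> real" and U :: "jet set" and \<pi> :: "jet \<Rightarrow> real^4"
  assumes open_U: "open U" and smooth_F: "smooth_on U F" and smooth_pi: "smooth_on U \<pi>"
    and kernel: "\<And>p. p \<in> U \<Longrightarrow> {v. frechet_derivative \<pi> (at p) v = 0} = span {total_deriv F p}"
    and smooth_g: "smooth_on U g" and g_nz: "\<And>p. p \<in> U \<Longrightarrow> g p \<noteq> 0"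
    and ad4: "\<And>p. p \<in> U \<Longrightarrow> ad (total_deriv F) 4 (\<lambda>p. g p *\<^sub>R coord_field 3 p) p =
      - K0 p *\<^sub>R ad (total_deriv F) 0 (\<lambda>p. g p *\<^sub>R coord_field 3 p) p
      + K1 p *\<^sub>R ad (total_deriv F) 1 (\<lambda>p. g p *\<^sub>R coord_field 3 p) p
      - K2 p *\<^sub>R ad (total_deriv F) 2 (\<lambda>p. g p *\<^sub>R coord_field 3 p) p"
begin

definition X :: "jet \<Rightarrow> jet" where "X = total_deriv F"

definition V :: "nat \<Rightarrow> jet \<Rightarrow> jet" where "V j = ad X j (\<lambda>p. g p *\<^sub>R coord_field 3 p)"

definition v :: "nat \<Rightarrow> jet \<Rightarrow> real^4" where "v j = dir_deriv (V j) \<pi>"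

text \<open>\<open>X\<close>, \<open>V\<close> and \<open>v\<close> do not depend on
  \<open>U\<close>, so facts obtained on a smaller open set speak about the same fields. Connections
  and the functions of the Bryant-Wuenschmann condition are given only on such sets.\<close>

lemma restrict: "open W \<Longrightarrow> W \<subseteq> U \<Longrightarrow> fourth_order_ode F g K0 K1 K2 W \<pi>"
  using kernel g_nz ad4
  by (intro fourth_order_ode.intro smooth_on_subset[OF smooth_F] smooth_on_subset[OF smooth_pi]
    smooth_on_subset[OF smooth_g]) blast+

lemma V_0: "V 0 p = g p *\<^sub>R coord_field 3 p" and V_Suc: "V (Suc j) = lie_bracket X (V j)"
  by (simp_all add: V_def ad_def)

lemma V_4: "p \<in> U \<Longrightarrow> V 4 p = - K0 p *\<^sub>R V 0 p + K1 p *\<^sub>R V 1 p - K2 p *\<^sub>R V 2 p"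
  using ad4 by (simp add: V_def X_def)

lemma smooth_X: "smooth_on U X"
  unfolding X_def using open_U smooth_F by (rule smooth_on_total_deriv)

lemma X_nth [simp]: "X p $ 0 = p $ 1" "X p $ 1 = p $ 2" "X p $ 2 = p $ 3" "X p $ 3 = F p" "X p $ 4 = 1"
  by (simp_all add: X_def)

lemma smooth_V: "smooth_on U (V j)"
proof (induction j)
  case 0
  show ?case unfolding V_0[abs_def] coord_field_def
    using open_U smooth_g by (intro smooth_on_scaleR smooth_on_const)
qed (simp add: V_Suc smooth_on_lie_bracket open_U smooth_X)

lemma smooth_v: "smooth_on U (v j)"
  unfolding v_def by (intro smooth_on_dir_deriv open_U smooth_V smooth_pi)

lemma differentiable: "smooth_on U f \<Longrightarrow> p \<in> U \<Longrightarrow> f differentiable (at p)"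
  by (rule smooth_on_imp_differentiable)

lemma dir_deriv_X_pi:
  assumes "p \<in> U"
  shows "dir_deriv X \<pi> p = 0"
proof -
  have "total_deriv F p \<in> {v. frechet_derivative \<pi> (at p) v = 0}"
    unfolding kernel[OF assms] by (rule span_base) simp
  then show ?thesis by (simp add: dir_deriv_def X_def)
qed

lemma smooth_dir_deriv_V: "smooth_on U f \<Longrightarrow> smooth_on U (dir_deriv (V i) f)"
  and smooth_dir_deriv_X: "smooth_on U f \<Longrightarrow> smooth_on U (dir_deriv X f)"
  by (auto intro: smooth_on_dir_deriv open_U smooth_V smooth_X)

lemma dir_deriv_X_V:
  fixes f :: "jet \<Rightarrow> 'b::euclidean_space"
  assumes "smooth_on U f" and "p \<in> U"
  shows "dir_deriv X (dir_deriv (V i) f) p = dir_deriv (V (Suc i)) f p + dir_deriv (V i) (dir_deriv X f) p"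
  using dir_deriv_lie_bracket[OF open_U assms(1) smooth_X smooth_V assms(2), of i] by (simp add: V_Suc)

text \<open>Since \<pi> is constant along \<open>X\<close>, half of the bracket projects to zero:
  after projection, bracketing with \<open>X\<close> is differentiation of vector-valued
  functions.\<close>

lemma dir_deriv_X_v: "p \<in> U \<Longrightarrow> dir_deriv X (v i) p = v (Suc i) p"
  using dir_deriv_X_V[OF smooth_pi, of p i] dir_deriv_0[OF open_U, of p "dir_deriv X \<pi>" 0] dir_deriv_X_pi
  by (simp add: v_def)

lemma dir_deriv_V_4:
  assumes "f differentiable (at p)" and "p \<in> U"
  shows "dir_deriv (V 4) f p = - K0 p *\<^sub>R dir_deriv (V 0) f p + K1 p *\<^sub>R dir_deriv (V 1) f p - K2 p *\<^sub>R dir_deriv (V 2) f p"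
proof -
  have "linear (frechet_derivative f (at p))" by (rule linear_frechet_derivative[OF assms(1)])
  then show ?thesis
    by (simp add: dir_deriv_def V_4[OF assms(2)] linear_add linear_diff linear_cmul linear_neg)
qed

lemma v_4: "p \<in> U \<Longrightarrow> v 4 p = - K0 p *\<^sub>R v 0 p + K1 p *\<^sub>R v 1 p - K2 p *\<^sub>R v 2 p"
  unfolding v_def by (intro dir_deriv_V_4 differentiable smooth_pi)

lemma V_nth_Suc:
  assumes "p \<in> U"
  shows "V (Suc j) p $ 0 = dir_deriv X (\<lambda>q. V j q $ 0) p - V j p $ 1"
    and "V (Suc j) p $ 1 = dir_deriv X (\<lambda>q. V j q $ 1) p - V j p $ 2"
    and "V (Suc j) p $ 2 = dir_deriv X (\<lambda>q. V j q $ 2) p - V j p $ 3"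
    and "V (Suc j) p $ 4 = dir_deriv X (\<lambda>q. V j q $ 4) p"
  using lie_bracket_nth[OF smooth_X smooth_V assms] by (simp_all add: V_Suc dir_deriv_coordinate)

lemma V_nth_4: "p \<in> U \<Longrightarrow> V j p $ 4 = 0"
proof (induction j arbitrary: p)
  case 0
  show ?case by (simp add: V_0 coord_field_def axis_def)
next
  case (Suc j)
  then show ?case using dir_deriv_0[OF open_U, of p "\<lambda>q. V j q $ 4" 0] by (simp add: V_nth_Suc)
qed

text \<open>A bracket with \<open>X\<close> shifts the leading coordinate from \<open>x_i\<close> to
  \<open>x_(i-1)\<close> and changes its sign. Together with \<open>V_nth_4\<close> this triangular
  shape gives the independence of the first four \<open>V i\<close> and the tangency of
  \<open>V 0\<close>, \<open>V 1\<close>, \<open>V 2\<close> to the slices.\<close>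

lemma V_nth:
  assumes "p \<in> U"
  shows "V 0 p $ 0 = 0" "V 0 p $ 1 = 0" "V 0 p $ 2 = 0" "V 0 p $ 3 = g p"
    "V 1 p $ 0 = 0" "V 1 p $ 1 = 0" "V 1 p $ 2 = - g p"
    "V 2 p $ 0 = 0" "V 2 p $ 1 = g p" "V 3 p $ 0 = - g p"
proof -
  have e: "1 = Suc 0" "2 = Suc (Suc 0)" "3 = Suc (Suc (Suc 0))" by simp_all
  have *: "V 0 q $ 0 = 0" "V 0 q $ 1 = 0" "V 0 q $ 2 = 0" "V 0 q $ 3 = g q" for q
    by (simp_all add: V_0 coord_field_def axis_def)
  have 1: "V 1 q $ 0 = 0" "V 1 q $ 1 = 0" "V 1 q $ 2 = - g q" if "q \<in> U" for q
    unfolding e(1)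
    by (simp_all add: V_nth_Suc[OF that] * dir_deriv_const)
  have 2: "V 2 q $ 0 = 0" "V 2 q $ 1 = g q" if "q \<in> U" for q
    unfolding e(2) V_nth_Suc[OF that] e(1)[symmetric]
    using dir_deriv_0[where X=X and f="\<lambda>q. V 1 q $ 0", OF open_U that 1(1)]
      dir_deriv_0[where X=X and f="\<lambda>q. V 1 q $ 1", OF open_U that 1(2)] 1[OF that] by simp_all
  have 3: "V 3 p $ 0 = - g p"
    unfolding e(3) V_nth_Suc[OF assms] e(2)[symmetric]
    using dir_deriv_0[where X=X and f="\<lambda>q. V 2 q $ 0", OF open_U assms 2(1)] 2[OF assms] by simp
  show "V 0 p $ 0 = 0" "V 0 p $ 1 = 0" "V 0 p $ 2 = 0" "V 0 p $ 3 = g p"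
    "V 1 p $ 0 = 0" "V 1 p $ 1 = 0" "V 1 p $ 2 = - g p"
    "V 2 p $ 0 = 0" "V 2 p $ 1 = g p" "V 3 p $ 0 = - g p"
    using * 1 2 3 assms by auto
qed

lemma linear_pi: "p \<in> U \<Longrightarrow> linear (frechet_derivative \<pi> (at p))"
  by (intro linear_frechet_derivative differentiable smooth_pi)

lemma V_combination_eq_0:
  assumes "p \<in> U" and "(\<Sum>i<4. c i *\<^sub>R V i p) = a *\<^sub>R X p"
  shows "\<forall>i<4. c i = 0" and "a = 0"
proof -
  have "(\<Sum>i<4. c i *\<^sub>R V i p) $ k = (a *\<^sub>R X p) $ k" for k using assms(2) by simp
  then have eq: "c 0 * V 0 p $ k + c 1 * V 1 p $ k + c 2 * V 2 p $ k + c 3 * V 3 p $ k = a * X p $ k" for k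
    by (simp add: sum_lessThan_4)
  show a: "a = 0" using eq[of 4] by (simp add: V_nth_4[OF assms(1)])
  have "c 3 = 0" using eq[of 0] g_nz[OF assms(1)] by (simp add: V_nth[OF assms(1), simplified] a)
  moreover from this have "c 2 = 0" using eq[of 1] g_nz[OF assms(1)] by (simp add: V_nth[OF assms(1), simplified] a)
  moreover from calculation have "c 1 = 0" using eq[of 2] g_nz[OF assms(1)] by (simp add: V_nth[OF assms(1), simplified] a)
  moreover from calculation have "c 0 = 0" using eq[of 3] g_nz[OF assms(1)] by (simp add: V_nth[OF assms(1), simplified] a)
  ultimately show "\<forall>i<4. c i = 0" unfolding all_less_4 by simp
qed

lemma pi_V_sum: "p \<in> U \<Longrightarrow> frechet_derivative \<pi> (at p) (\<Sum>i<4. c i *\<^sub>R V i p) = (\<Sum>i<4. c i *\<^sub>R v i p)"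
  using linear_pi[of p] by (simp add: linear_sum linear_cmul v_def dir_deriv_def)

text \<open>A relation among the \<open>v i\<close> lifts to a combination of the \<open>V i\<close>
  in the kernel of the derivative of \<pi>, that is, to a multiple of \<open>X\<close>; by the
  triangular shape all its coefficients vanish.\<close>

lemma frame_v: "frame_on U v"
  unfolding frame_on_def
proof (intro conjI ballI allI impI)
  fix p assume p: "p \<in> U"
  let ?T = "(*v) (frame_matrix v p)"
  have T: "?T x = (\<Sum>i<4. (x $ of_nat i) *\<^sub>R v i p)" for x
    by (simp add: frame_matrix_mult sum_lessThan_4)
  have lin: "linear ?T" by (rule matrix_vector_mul_linear)
  have "inj ?T"
  proof (subst linear_injective_0[OF lin], intro allI impI)
    fix x assume "?T x = 0"
    then have "frechet_derivative \<pi> (at p) (\<Sum>i<4. (x $ of_nat i) *\<^sub>R V i p) = 0"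
      unfolding T using pi_V_sum[OF p] by simp
    then have "(\<Sum>i<4. (x $ of_nat i) *\<^sub>R V i p) \<in> span {X p}"
      using kernel[OF p] unfolding X_def by blast
    then obtain a where "(\<Sum>i<4. (x $ of_nat i) *\<^sub>R V i p) = a *\<^sub>R X p"
      by (auto simp: span_singleton)
    from V_combination_eq_0(1)[OF p this] have "x $ 0 = 0 \<and> x $ 1 = 0 \<and> x $ 2 = 0 \<and> x $ 3 = 0"
      unfolding all_less_4 by simp
    moreover have "x $ 4 = x $ 0" by (rule arg_cong[where f="vec_nth x"]) simp
    ultimately show "x = 0" by (simp add: vec_eq_iff forall_4)
  qed
  then have "surj ?T" by (rule linear_inj_imp_surj[OF lin])
  show "span ((\<lambda>i. v i p) ` {..<4}) = UNIV"
  proof (intro equalityI subset_UNIV subsetI)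
    fix w
    obtain x where w: "w = ?T x" using \<open>surj ?T\<close> by blast
    show "w \<in> span ((\<lambda>i. v i p) ` {..<4})"
      unfolding w T by (intro span_sum span_mul span_base) auto
  qed
qed (rule smooth_v)

text \<open>No \<open>V i\<close> has a \<open>t\<close>-component while that of \<open>X\<close> is
  1, so the \<open>t\<close>-component splits off the multiple of \<open>X\<close>, and \<pi> sees
  the rest.\<close>

lemma tangent_decomposition:
  assumes "p \<in> U"
  shows "w = (w $ 4) *\<^sub>R X p + (\<Sum>i<4. frame_coord v p i (frechet_derivative \<pi> (at p) w) *\<^sub>R V i p)"
proof -
  let ?s = "\<Sum>i<4. frame_coord v p i (frechet_derivative \<pi> (at p) w) *\<^sub>R V i p"
  have "frechet_derivative \<pi> (at p) (w - ?s) = 0"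
    using linear_diff[OF linear_pi[OF assms]] pi_V_sum[OF assms] frame_coord_expand[OF frame_v assms] by simp
  then have "w - ?s \<in> span {X p}" using kernel[OF assms] unfolding X_def by blast
  then obtain a where a: "w - ?s = a *\<^sub>R X p" by (auto simp: span_singleton)
  then have "(w - ?s) $ 4 = a" by simp
  then have "a = w $ 4" by (simp add: sum_lessThan_4 V_nth_4[OF assms])
  then show ?thesis using a by (simp add: algebra_simps)
qed


section \<open>Coordinates along the solutions\<close>

lemma smooth_coord: "smooth_on U u \<Longrightarrow> smooth_on U (\<lambda>q. frame_coord v q k (u q))"
  by (rule smooth_on_frame_coord[OF open_U frame_v])

lemma frame_coord_v:
  assumes "p \<in> U" and "i < 4" and "k < 4"
  shows "frame_coord v p k (v i p) = (if i = k then 1 else 0)"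
proof (rule frame_coord_unique[OF frame_v assms(1) _ assms(3), where c="\<lambda>k. if i = k then 1 else 0"])
  have "(\<Sum>j<4. (if i = j then 1 else 0 :: real) *\<^sub>R v j p) = (\<Sum>j<4. if j = i then v j p else 0)"
    by (intro sum.cong) auto
  then show "v i p = (\<Sum>j<4. (if i = j then 1 else 0 :: real) *\<^sub>R v j p)"
    using assms(2) by (simp add: sum.delta')
qed

text \<open>\<open>K0\<close>, \<open>K1\<close>, \<open>K2\<close> are given only by a pointwise
  relation. Reading them off as frame coordinates of \<open>v 4\<close> is what makes them
  smooth.\<close>

lemma K_coord:
  assumes "p \<in> U"
  shows "K0 p = - frame_coord v p 0 (v 4 p)" "K1 p = frame_coord v p 1 (v 4 p)" "K2 p = - frame_coord v p 2 (v 4 p)"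
proof -
  have *: "v 4 p = (\<Sum>i<4. (if i = 0 then - K0 p else if i = 1 then K1 p else if i = 2 then - K2 p else 0) *\<^sub>R v i p)"
    using v_4[OF assms] by (simp add: sum_lessThan_4)
  show "K0 p = - frame_coord v p 0 (v 4 p)" "K1 p = frame_coord v p 1 (v 4 p)" "K2 p = - frame_coord v p 2 (v 4 p)"
    by (simp_all add: frame_coord_unique[OF frame_v assms *])
qed

lemma smooth_K: "smooth_on U K0" "smooth_on U K1" "smooth_on U K2"
  using K_coord smooth_on_eqI[OF smooth_on_minus[OF open_U smooth_coord[OF smooth_v]] open_U]
    smooth_on_eqI[OF smooth_coord[OF smooth_v] open_U] by metis+

text \<open>The companion matrix of the linear equation for \<open>v 0\<close>: it sends the
  coordinates of a combination of the \<open>v k\<close> to those of the same combination of the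
  \<open>v (k + 1)\<close>.\<close>

definition shift :: "jet \<Rightarrow> (nat \<Rightarrow> real) \<Rightarrow> nat \<Rightarrow> real" where
  "shift p c k = (if k = 0 then - K0 p * c 3 else if k = 1 then c 0 + K1 p * c 3
     else if k = 2 then c 1 - K2 p * c 3 else c 2)"

lemma coord_dir_deriv_X:
  assumes u: "smooth_on U u" and p: "p \<in> U" and k: "k < 4"
  shows "frame_coord v p k (dir_deriv X u p) =
    dir_deriv X (\<lambda>q. frame_coord v q k (u q)) p + shift p (\<lambda>i. frame_coord v p i (u p)) k"
proof (rule frame_coord_unique[OF frame_v p _ k])
  have e: "Suc 0 = 1" "Suc 1 = 2" "Suc 2 = 3" "Suc 3 = 4" by simp_all
  show "dir_deriv X u p = (\<Sum>k<4. (dir_deriv X (\<lambda>q. frame_coord v q k (u q)) p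
      + shift p (\<lambda>i. frame_coord v p i (u p)) k) *\<^sub>R v k p)"
    unfolding frame_coord_dir_deriv[OF open_U frame_v u p] dir_deriv_X_v[OF p] sum_lessThan_4 e v_4[OF p]
    by (simp add: shift_def algebra_simps)
qed

definition taylor_coord :: "jet \<Rightarrow> (jet \<Rightarrow> real^4) \<Rightarrow> nat \<Rightarrow> real fps" where
  "taylor_coord p u k = taylor X p (\<lambda>q. frame_coord v q k (u q))"

lemma taylor_coord_cong: "p \<in> U \<Longrightarrow> (\<And>q. q \<in> U \<Longrightarrow> u q = w q) \<Longrightarrow> taylor_coord p u k = taylor_coord p w k"
  unfolding taylor_coord_def by (rule taylor_cong[OF open_U]) auto

lemma taylor_coord_add:
  assumes "p \<in> U" "smooth_on U u" "smooth_on U w" "k < 4"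
  shows "taylor_coord p (\<lambda>q. u q + w q) k = taylor_coord p u k + taylor_coord p w k"
proof -
  have "taylor_coord p (\<lambda>q. u q + w q) k = taylor X p (\<lambda>q. frame_coord v q k (u q) + frame_coord v q k (w q))"
    unfolding taylor_coord_def using linear_frame_coord[OF frame_v _ assms(4)]
    by (intro taylor_cong[OF open_U assms(1)]) (simp add: linear_add)
  also have "\<dots> = taylor_coord p u k + taylor_coord p w k"
    unfolding taylor_coord_def by (rule taylor_add[OF open_U assms(1) smooth_X smooth_coord[OF assms(2)] smooth_coord[OF assms(3)]])
  finally show ?thesis .
qed

lemma taylor_coord_scaleR:
  assumes "p \<in> U" "smooth_on U a" "smooth_on U u" "k < 4"
  shows "taylor_coord p (\<lambda>q. a q *\<^sub>R u q) k = taylor X p a * taylor_coord p u k"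
proof -
  have "taylor_coord p (\<lambda>q. a q *\<^sub>R u q) k = taylor X p (\<lambda>q. a q * frame_coord v q k (u q))"
    unfolding taylor_coord_def using linear_frame_coord[OF frame_v _ assms(4)]
    by (intro taylor_cong[OF open_U assms(1)]) (simp add: linear_cmul)
  also have "\<dots> = taylor X p a * taylor_coord p u k"
    unfolding taylor_coord_def by (rule taylor_mult[OF open_U assms(1) smooth_X assms(2) smooth_coord[OF assms(3)]])
  finally show ?thesis .
qed

lemma taylor_coord_minus:
  assumes "p \<in> U" "smooth_on U u" "k < 4"
  shows "taylor_coord p (\<lambda>q. - u q) k = - taylor_coord p u k"
  using taylor_coord_scaleR[OF assms(1) smooth_on_const assms(2,3), of "- 1"]
  by (simp add: taylor_const fps_const_neg[symmetric] del: fps_const_neg)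

lemma taylor_coord_diff:
  assumes "p \<in> U" "smooth_on U u" "smooth_on U w" "k < 4"
  shows "taylor_coord p (\<lambda>q. u q - w q) k = taylor_coord p u k - taylor_coord p w k"
  using taylor_coord_add[OF assms(1,2) smooth_on_minus[OF open_U assms(3)] assms(4)] taylor_coord_minus[OF assms(1,3,4)] by simp

lemma taylor_coord_v: "p \<in> U \<Longrightarrow> i < 4 \<Longrightarrow> k < 4 \<Longrightarrow> taylor_coord p (v i) k = (if i = k then 1 else 0)"
  using taylor_cong[OF open_U, of p "\<lambda>q. frame_coord v q k (v i q)" "\<lambda>_. if i = k then 1 else 0" X]
  by (simp add: taylor_coord_def frame_coord_v taylor_const)

lemma taylor_coord_dir_deriv_X:
  assumes u: "smooth_on U u" and p: "p \<in> U"
  shows "taylor_coord p (dir_deriv X u) 0 = fps_deriv (taylor_coord p u 0) - taylor X p K0 * taylor_coord p u 3"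
    and "taylor_coord p (dir_deriv X u) 1 = fps_deriv (taylor_coord p u 1) + taylor_coord p u 0 + taylor X p K1 * taylor_coord p u 3"
    and "taylor_coord p (dir_deriv X u) 2 = fps_deriv (taylor_coord p u 2) + taylor_coord p u 1 - taylor X p K2 * taylor_coord p u 3"
    and "taylor_coord p (dir_deriv X u) 3 = fps_deriv (taylor_coord p u 3) + taylor_coord p u 2"
proof -
  note sm = smooth_coord[OF u] smooth_K smooth_dir_deriv_X smooth_on_mult[OF open_U] smooth_on_add[OF open_U]
    smooth_on_diff[OF open_U]
  note ty = taylor_add[OF open_U p smooth_X] taylor_diff[OF open_U p smooth_X] taylor_mult[OF open_U p smooth_X]
  have *: "taylor_coord p (dir_deriv X u) k = taylor X p (\<lambda>q. dir_deriv X (\<lambda>q. frame_coord v q k (u q)) q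
      + shift q (\<lambda>i. frame_coord v q i (u q)) k)" if "k < 4" for k
    unfolding taylor_coord_def by (intro taylor_cong[OF open_U p] coord_dir_deriv_X u that)
  have "taylor_coord p (dir_deriv X u) 0 = taylor X p (\<lambda>q. dir_deriv X (\<lambda>q. frame_coord v q 0 (u q)) q
      - K0 q * frame_coord v q 3 (u q))"
    by (subst *) (simp_all add: shift_def)
  also have "\<dots> = fps_deriv (taylor_coord p u 0) - taylor X p K0 * taylor_coord p u 3"
    unfolding taylor_coord_def by (simp add: ty sm taylor_dir_deriv)
  finally show "taylor_coord p (dir_deriv X u) 0 = fps_deriv (taylor_coord p u 0) - taylor X p K0 * taylor_coord p u 3" .
  have "taylor_coord p (dir_deriv X u) 1 = taylor X p (\<lambda>q. dir_deriv X (\<lambda>q. frame_coord v q 1 (u q)) q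
      + (frame_coord v q 0 (u q) + K1 q * frame_coord v q 3 (u q)))"
    by (subst *) (simp_all add: shift_def)
  also have "\<dots> = fps_deriv (taylor_coord p u 1) + taylor_coord p u 0 + taylor X p K1 * taylor_coord p u 3"
    unfolding taylor_coord_def by (simp add: ty sm taylor_dir_deriv)
  finally show "taylor_coord p (dir_deriv X u) 1 = fps_deriv (taylor_coord p u 1) + taylor_coord p u 0 + taylor X p K1 * taylor_coord p u 3" .
  have "taylor_coord p (dir_deriv X u) 2 = taylor X p (\<lambda>q. dir_deriv X (\<lambda>q. frame_coord v q 2 (u q)) q
      + (frame_coord v q 1 (u q) - K2 q * frame_coord v q 3 (u q)))"
    by (subst *) (simp_all add: shift_def)
  also have "\<dots> = fps_deriv (taylor_coord p u 2) + taylor_coord p u 1 - taylor X p K2 * taylor_coord p u 3"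
    unfolding taylor_coord_def by (simp add: ty sm taylor_dir_deriv)
  finally show "taylor_coord p (dir_deriv X u) 2 = fps_deriv (taylor_coord p u 2) + taylor_coord p u 1 - taylor X p K2 * taylor_coord p u 3" .
  have "taylor_coord p (dir_deriv X u) 3 = taylor X p (\<lambda>q. dir_deriv X (\<lambda>q. frame_coord v q 3 (u q)) q
      + frame_coord v q 2 (u q))"
    by (subst *) (simp_all add: shift_def)
  also have "\<dots> = fps_deriv (taylor_coord p u 3) + taylor_coord p u 2"
    unfolding taylor_coord_def by (simp add: ty sm taylor_dir_deriv)
  finally show "taylor_coord p (dir_deriv X u) 3 = fps_deriv (taylor_coord p u 3) + taylor_coord p u 2" .
qed

section \<open>The Wuenschmann invariants\<close>

lemma dir_deriv_scaleR_field:
  "u differentiable (at p) \<Longrightarrow> dir_deriv (\<lambda>q. f q *\<^sub>R Y q) u p = f p *\<^sub>R dir_deriv Y u p"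
  using linear_frechet_derivative[of u "at p"] by (simp add: dir_deriv_def linear_cmul)

text \<open>The bracket with \<open>f X\<close> differs from \<open>f\<close> times the bracket with
  \<open>X\<close> by a multiple of \<open>X\<close>, which \<pi> annihilates. So \<open>ad\<close>
  of the rescaled field becomes repeated application of \<open>f d/dt\<close>.\<close>

lemma scaled_ad:
  fixes f :: "jet \<Rightarrow> real"
  assumes f: "smooth_on U f" and Y: "smooth_on U Y"
  defines "Z \<equiv> \<lambda>j. ad (\<lambda>q. f q *\<^sub>R X q) j Y"
  shows "smooth_on U (Z j)"
    and "p \<in> U \<Longrightarrow> dir_deriv (Z (Suc j)) \<pi> p = f p *\<^sub>R dir_deriv X (dir_deriv (Z j) \<pi>) p"
proof -
  have fX: "smooth_on U (\<lambda>q. f q *\<^sub>R X q)" by (intro smooth_on_scaleR open_U f smooth_X)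
  have Z_Suc: "Z (Suc j) = lie_bracket (\<lambda>q. f q *\<^sub>R X q) (Z j)" for j
    by (simp add: Z_def ad_def)
  show sm: "smooth_on U (Z j)" for j
    by (induction j) (simp_all add: Z_Suc smooth_on_lie_bracket open_U fX, simp add: Z_def ad_def Y)
  assume p: "p \<in> U"
  have 0: "dir_deriv (Z j) (dir_deriv (\<lambda>q. f q *\<^sub>R X q) \<pi>) p = 0"
    by (rule dir_deriv_0[OF open_U p, where c=0])
      (simp add: dir_deriv_scaleR_field differentiable smooth_pi dir_deriv_X_pi)
  show "dir_deriv (Z (Suc j)) \<pi> p = f p *\<^sub>R dir_deriv X (dir_deriv (Z j) \<pi>) p"
    unfolding Z_Suc dir_deriv_lie_bracket[OF open_U smooth_pi fX sm p] 0
    using p by (simp add: dir_deriv_scaleR_field differentiable smooth_on_dir_deriv open_U sm smooth_pi)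
qed

text \<open>After projection, vanishing modulo \<open>X\<close> turns into the exact equation
  \<open>w 4 = 0\<close>.\<close>

lemma scaled_projection:
  fixes f h :: "jet \<Rightarrow> real"
  assumes f: "smooth_on U f" and h: "smooth_on U h"
    and ad4: "\<And>q. q \<in> U \<Longrightarrow> ad (\<lambda>q. f q *\<^sub>R X q) 4 (\<lambda>q. h q *\<^sub>R coord_field 3 q) q \<in> span {X q}"
  obtains w where "\<And>j. smooth_on U (w j)" and "\<And>j q. q \<in> U \<Longrightarrow> w (Suc j) q = f q *\<^sub>R dir_deriv X (w j) q"
    and "\<And>q. q \<in> U \<Longrightarrow> w 0 q = h q *\<^sub>R frechet_derivative \<pi> (at q) (coord_field 3 q)"
    and "\<And>q. q \<in> U \<Longrightarrow> w 0 q = (h q / g q) *\<^sub>R v 0 q" and "\<And>q. q \<in> U \<Longrightarrow> w 4 q = 0"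
proof -
  have Y: "smooth_on U (\<lambda>q. h q *\<^sub>R coord_field 3 q)"
    unfolding coord_field_def by (intro smooth_on_scaleR open_U h smooth_on_const)
  define w where "w j = dir_deriv (ad (\<lambda>q. f q *\<^sub>R X q) j (\<lambda>q. h q *\<^sub>R coord_field 3 q)) \<pi>" for j
  show thesis
  proof
    show "smooth_on U (w j)" for j
      unfolding w_def by (intro smooth_on_dir_deriv open_U smooth_pi scaled_ad(1)[OF f Y])
    show "w (Suc j) q = f q *\<^sub>R dir_deriv X (w j) q" if "q \<in> U" for j q
      using scaled_ad(2)[OF f Y that] by (simp add: w_def)
    show "w 0 q = h q *\<^sub>R frechet_derivative \<pi> (at q) (coord_field 3 q)" if "q \<in> U" for q
      using linear_cmul[OF linear_pi[OF that]] by (simp add: w_def dir_deriv_def ad_def)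
    then show "w 0 q = (h q / g q) *\<^sub>R v 0 q" if "q \<in> U" for q
      using that g_nz[OF that] linear_cmul[OF linear_pi[OF that]] by (simp add: v_def dir_deriv_def V_0)
    show "w 4 q = 0" if "q \<in> U" for q
    proof -
      have "ad (\<lambda>q. f q *\<^sub>R X q) 4 (\<lambda>q. h q *\<^sub>R coord_field 3 q) q \<in> {v. frechet_derivative \<pi> (at q) v = 0}"
        using ad4[OF that] unfolding kernel[OF that] X_def .
      then show ?thesis by (simp add: w_def dir_deriv_def)
    qed
  qed
qed

lemma bryant_wuenschmann_identities:
  fixes f h :: "jet \<Rightarrow> real"
  assumes f: "smooth_on U f" and h: "smooth_on U h" and nz: "\<And>q. q \<in> U \<Longrightarrow> f q \<noteq> 0 \<and> h q \<noteq> 0"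
    and ad4: "\<And>q. q \<in> U \<Longrightarrow> ad (\<lambda>q. f q *\<^sub>R X q) 4 (\<lambda>q. h q *\<^sub>R coord_field 3 q) q \<in> span {X q}"
    and p: "p \<in> U"
  shows "K1 p = - dir_deriv X K2 p" and "100 * K0 p = 9 * K2 p * K2 p - 30 * dir_deriv X K1 p"
proof -
  obtain w where w_smooth: "\<And>j. smooth_on U (w j)" and w_Suc: "\<And>j q. q \<in> U \<Longrightarrow> w (Suc j) q = f q *\<^sub>R dir_deriv X (w j) q"
    and w_0: "\<And>q. q \<in> U \<Longrightarrow> w 0 q = (h q / g q) *\<^sub>R v 0 q" and w_4: "\<And>q. q \<in> U \<Longrightarrow> w 4 q = 0"
    using scaled_projection[OF f h ad4] by metis
  have k: "smooth_on U (\<lambda>q. h q / g q)"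
    using g_nz by (intro smooth_on_divide open_U h smooth_g)
  let ?k = "taylor X p (\<lambda>q. h q / g q)"
  have "fps_nth ?k 0 \<noteq> 0" using nz[OF p] g_nz[OF p] by simp
  then have k0: "?k \<noteq> 0" by (metis fps_zero_nth)
  have 0: "taylor_coord p (w 0) k = (if k = 0 then ?k else 0)" if "k < 4" for k
  proof -
    have "taylor_coord p (w 0) k = taylor_coord p (\<lambda>q. (h q / g q) *\<^sub>R v 0 q) k" using w_0 by (rule taylor_coord_cong[OF p])
    then show ?thesis using taylor_coord_scaleR[OF p k smooth_v that] that by (simp add: taylor_coord_v[OF p])
  qed
  have S: "taylor_coord p (w (Suc j)) k = taylor X p f * taylor_coord p (dir_deriv X (w j)) k" if "k < 4" for j k
  proof -
    have "taylor_coord p (w (Suc j)) k = taylor_coord p (\<lambda>q. f q *\<^sub>R dir_deriv X (w j) q) k" using w_Suc by (rule taylor_coord_cong[OF p])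
    then show ?thesis using taylor_coord_scaleR[OF p f smooth_dir_deriv_X[OF w_smooth] that] by simp
  qed
  have 4: "taylor_coord p (w 4) k = 0" if "k < 4" for k
  proof -
    have "taylor_coord p (w 4) k = taylor_coord p (\<lambda>q. 0 *\<^sub>R v 0 q) k" by (rule taylor_coord_cong[OF p]) (simp add: w_4)
    also have "\<dots> = 0" by (subst taylor_coord_scaleR[OF p smooth_on_const smooth_v that]) simp
    finally show ?thesis .
  qed
  note tcs = 0 S 4 k0 taylor_coord_dir_deriv_X(1,3,4)[OF w_smooth p] taylor_coord_dir_deriv_X(2)[OF w_smooth p, simplified]
  note rule = wuenschmann_identities[where f="taylor X p f" and k="?k" and ?w0.0="\<lambda>j. taylor_coord p (w j) 0"
      and ?w1.0="\<lambda>j. taylor_coord p (w j) 1" and ?w2.0="\<lambda>j. taylor_coord p (w j) 2" and ?w3.0="\<lambda>j. taylor_coord p (w j) 3"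
      and ?K0.0="taylor X p K0" and ?K1.0="taylor X p K1" and ?K2.0="taylor X p K2"]
  have "taylor X p K1 = - fps_deriv (taylor X p K2)"
    using nz[OF p] by (intro rule(1)) (simp_all add: tcs)
  moreover have "100 * taylor X p K0 = 9 * taylor X p K2 * taylor X p K2 - 30 * fps_deriv (taylor X p K1)"
    using nz[OF p] by (intro rule(2)) (simp_all add: tcs)
  ultimately have "fps_nth (taylor X p K1) 0 = fps_nth (- fps_deriv (taylor X p K2)) 0"
    and "fps_nth (100 * taylor X p K0) 0 = fps_nth (9 * taylor X p K2 * taylor X p K2 - 30 * fps_deriv (taylor X p K1)) 0"
    by simp_all
  then show "K1 p = - dir_deriv X K2 p" and "100 * K0 p = 9 * K2 p * K2 p - 30 * dir_deriv X K1 p"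
    unfolding taylor_dir_deriv[symmetric] by (simp_all add: fps_numeral_fps_const)
qed

section \<open>Structure equations\<close>

definition DK2 :: "nat \<Rightarrow> nat \<Rightarrow> jet \<Rightarrow> real" where
  "DK2 i j = dir_deriv (V i) ((dir_deriv X ^^ j) K2)"

lemma smooth_DK2: "smooth_on U (DK2 i j)"
  unfolding DK2_def by (intro smooth_dir_deriv_V smooth_on_dir_deriv_funpow open_U smooth_X smooth_K)

lemma dir_deriv_X_DK2: "p \<in> U \<Longrightarrow> dir_deriv X (DK2 i j) p = DK2 (Suc i) j p + DK2 i (Suc j) p"
  unfolding DK2_def
  using dir_deriv_X_V[of "(dir_deriv X ^^ j) K2" p i] smooth_on_dir_deriv_funpow[OF open_U smooth_X smooth_K(3)]
  by simp

lemma taylor_DK2: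
  assumes "p \<in> U"
  shows "fps_deriv (taylor X p (DK2 i j)) = taylor X p (DK2 (Suc i) j) + taylor X p (DK2 i (Suc j))"
proof -
  have "taylor X p (dir_deriv X (DK2 i j)) = taylor X p (\<lambda>q. DK2 (Suc i) j q + DK2 i (Suc j) q)"
    by (intro taylor_cong[OF open_U assms] dir_deriv_X_DK2)
  then show ?thesis
    unfolding taylor_dir_deriv using taylor_add[OF open_U assms smooth_X smooth_DK2 smooth_DK2] by simp
qed

lemma dir_deriv_v_4:
  assumes p: "p \<in> U"
  shows "dir_deriv Y (v 4) p =
    - K0 p *\<^sub>R dir_deriv Y (v 0) p + K1 p *\<^sub>R dir_deriv Y (v 1) p - K2 p *\<^sub>R dir_deriv Y (v 2) p
    - dir_deriv Y K0 p *\<^sub>R v 0 p + dir_deriv Y K1 p *\<^sub>R v 1 p - dir_deriv Y K2 p *\<^sub>R v 2 p"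
proof -
  note sm = smooth_v smooth_K smooth_on_scaleR[OF open_U] smooth_on_add[OF open_U] smooth_on_diff[OF open_U]
    smooth_on_minus[OF open_U]
  note df = differentiable[OF _ p]
  have "dir_deriv Y (v 4) p = dir_deriv Y (\<lambda>q. - (K0 q *\<^sub>R v 0 q) + K1 q *\<^sub>R v 1 q - K2 q *\<^sub>R v 2 q) p"
    by (rule dir_deriv_cong[OF open_U p]) (simp add: v_4)
  also have "\<dots> = - (dir_deriv Y K0 p *\<^sub>R v 0 p + K0 p *\<^sub>R dir_deriv Y (v 0) p)
      + (dir_deriv Y K1 p *\<^sub>R v 1 p + K1 p *\<^sub>R dir_deriv Y (v 1) p)
      - (dir_deriv Y K2 p *\<^sub>R v 2 p + K2 p *\<^sub>R dir_deriv Y (v 2) p)"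
    by (simp add: dir_deriv_add dir_deriv_diff dir_deriv_minus dir_deriv_scaleR df sm)
  finally show ?thesis by (simp add: algebra_simps)
qed

text \<open>One expansion for two situations: a second index 4 brings in derivatives of the
  \<open>K\<close>s through \<open>v 4\<close>, while for a first index 4 the relation for
  \<open>V 4\<close> is tensorial and \<open>a\<close>, \<open>b\<close>, \<open>c\<close> are
  zero.\<close>

lemma taylor_coord_combination:
  assumes p: "p \<in> U" and k: "k < 4"
    and sm: "smooth_on U A" "smooth_on U B" "smooth_on U C" "smooth_on U a" "smooth_on U b" "smooth_on U c"
  shows "taylor_coord p (\<lambda>q. - K0 q *\<^sub>R A q + K1 q *\<^sub>R B q - K2 q *\<^sub>R C q - a q *\<^sub>R v 0 q + b q *\<^sub>R v 1 q - c q *\<^sub>R v 2 q) k =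
    - taylor X p K0 * taylor_coord p A k + taylor X p K1 * taylor_coord p B k - taylor X p K2 * taylor_coord p C k
    - (if k = 0 then taylor X p a else 0) + (if k = 1 then taylor X p b else 0) - (if k = 2 then taylor X p c else 0)"
proof -
  note sms = sm smooth_v smooth_K smooth_on_scaleR[OF open_U] smooth_on_add[OF open_U] smooth_on_diff[OF open_U]
    smooth_on_minus[OF open_U]
  show ?thesis
    using k by (simp add: taylor_coord_add[OF p] taylor_coord_diff[OF p] taylor_coord_minus[OF p] taylor_coord_scaleR[OF p] taylor_coord_v[OF p] sms)
qed

text \<open>\<open>M i j\<close> will be the projected bracket of \<open>V i\<close> and
  \<open>V j\<close>, or the covariant derivative of \<open>v j\<close> along \<open>V i\<close>; in
  both, differentiation along \<open>X\<close> raises each index in turn.\<close>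

lemma taylor_coord_family:
  assumes sm: "\<And>i j. smooth_on U (M i j)"
    and rec: "\<And>i j q. q \<in> U \<Longrightarrow> dir_deriv X (M i j) q = M (Suc i) j q + M i (Suc j) q"
    and p: "p \<in> U"
  shows "fps_deriv (taylor_coord p (M i j) 0) - taylor X p K0 * taylor_coord p (M i j) 3 = taylor_coord p (M (Suc i) j) 0 + taylor_coord p (M i (Suc j)) 0"
    and "fps_deriv (taylor_coord p (M i j) 1) + taylor_coord p (M i j) 0 + taylor X p K1 * taylor_coord p (M i j) 3 = taylor_coord p (M (Suc i) j) 1 + taylor_coord p (M i (Suc j)) 1"
    and "fps_deriv (taylor_coord p (M i j) 2) + taylor_coord p (M i j) 1 - taylor X p K2 * taylor_coord p (M i j) 3 = taylor_coord p (M (Suc i) j) 2 + taylor_coord p (M i (Suc j)) 2"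
    and "fps_deriv (taylor_coord p (M i j) 3) + taylor_coord p (M i j) 2 = taylor_coord p (M (Suc i) j) 3 + taylor_coord p (M i (Suc j)) 3"
proof -
  have "taylor_coord p (dir_deriv X (M i j)) k = taylor_coord p (M (Suc i) j) k + taylor_coord p (M i (Suc j)) k" if "k < 4" for k
  proof -
    have "taylor_coord p (dir_deriv X (M i j)) k = taylor_coord p (\<lambda>q. M (Suc i) j q + M i (Suc j) q) k"
      by (intro taylor_coord_cong[OF p] rec)
    then show ?thesis using taylor_coord_add[OF p sm sm that] by simp
  qed
  from this[of 0] this[of 1] this[of 2] this[of 3] show
    "fps_deriv (taylor_coord p (M i j) 0) - taylor X p K0 * taylor_coord p (M i j) 3 = taylor_coord p (M (Suc i) j) 0 + taylor_coord p (M i (Suc j)) 0"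
    "fps_deriv (taylor_coord p (M i j) 1) + taylor_coord p (M i j) 0 + taylor X p K1 * taylor_coord p (M i j) 3 = taylor_coord p (M (Suc i) j) 1 + taylor_coord p (M i (Suc j)) 1"
    "fps_deriv (taylor_coord p (M i j) 2) + taylor_coord p (M i j) 1 - taylor X p K2 * taylor_coord p (M i j) 3 = taylor_coord p (M (Suc i) j) 2 + taylor_coord p (M i (Suc j)) 2"
    "fps_deriv (taylor_coord p (M i j) 3) + taylor_coord p (M i j) 2 = taylor_coord p (M (Suc i) j) 3 + taylor_coord p (M i (Suc j)) 3"
    unfolding taylor_coord_dir_deriv_X[OF sm p] by simp_all
qed

lemma dir_deriv_X_V_v:
  assumes p: "p \<in> U"
  shows "dir_deriv X (dir_deriv (V i) (v j)) p = dir_deriv (V (Suc i)) (v j) p + dir_deriv (V i) (v (Suc j)) p"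
  unfolding dir_deriv_X_V[OF smooth_v p]
  using dir_deriv_cong[where f="dir_deriv X (v j)", OF open_U p dir_deriv_X_v] by simp

text \<open>The projection of the bracket, see \<open>pi_bracket_eq\<close>. In this form the Jacobi
  identity with \<open>X\<close> comes from \<open>dir_deriv_X_V_v\<close>.\<close>

definition pi_bracket :: "nat \<Rightarrow> nat \<Rightarrow> jet \<Rightarrow> real^4" where
  "pi_bracket i j q = dir_deriv (V i) (v j) q - dir_deriv (V j) (v i) q"

lemma smooth_pi_bracket: "smooth_on U (pi_bracket i j)"
  unfolding pi_bracket_def[abs_def] by (intro smooth_on_diff open_U smooth_dir_deriv_V smooth_v)

lemma dir_deriv_X_pi_bracket: "p \<in> U \<Longrightarrow> dir_deriv X (pi_bracket i j) p = pi_bracket (Suc i) j p + pi_bracket i (Suc j) p"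
  unfolding pi_bracket_def[abs_def]
  by (simp add: dir_deriv_diff differentiable smooth_dir_deriv_V smooth_v dir_deriv_X_V_v)

lemma pi_bracket_4:
  assumes p: "p \<in> U"
  shows "pi_bracket i 4 p = - K0 p *\<^sub>R pi_bracket i 0 p + K1 p *\<^sub>R pi_bracket i 1 p - K2 p *\<^sub>R pi_bracket i 2 p
    - dir_deriv (V i) K0 p *\<^sub>R v 0 p + dir_deriv (V i) K1 p *\<^sub>R v 1 p - dir_deriv (V i) K2 p *\<^sub>R v 2 p"
  unfolding pi_bracket_def dir_deriv_v_4[OF p] dir_deriv_V_4[OF differentiable[OF smooth_v p] p]
  by (simp add: algebra_simps)

lemma pi_bracket_eq: "p \<in> U \<Longrightarrow> pi_bracket i j p = dir_deriv (lie_bracket (V i) (V j)) \<pi> p"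
  unfolding pi_bracket_def v_def by (rule dir_deriv_lie_bracket[symmetric, OF open_U smooth_pi smooth_V smooth_V])

text \<open>Among the first four \<open>V i\<close> only \<open>V 3\<close> has an
  \<open>x_0\<close>-component, and besides it only \<open>V 2\<close> can have an
  \<open>x_1\<close>-component. So these frame coordinates can be tested in the jet space.\<close>

lemma coord_pi_eq_0:
  assumes p: "p \<in> U" and "w $ 4 = 0" and "w $ 0 = 0"
  shows "frame_coord v p 3 (frechet_derivative \<pi> (at p) w) = 0"
    and "w $ 1 = 0 \<Longrightarrow> frame_coord v p 2 (frechet_derivative \<pi> (at p) w) = 0"
proof -
  let ?e = "\<lambda>i. frame_coord v p i (frechet_derivative \<pi> (at p) w)"
  have "w $ k = (\<Sum>i<4. ?e i *\<^sub>R V i p) $ k" for k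
    by (subst tangent_decomposition[OF p, of w]) (simp add: assms(2))
  then have w: "w $ k = ?e 0 * V 0 p $ k + ?e 1 * V 1 p $ k + ?e 2 * V 2 p $ k + ?e 3 * V 3 p $ k" for k
    by (simp add: sum_lessThan_4)
  show 3: "?e 3 = 0"
    using w[of 0] assms(3) g_nz[OF p] by (simp add: V_nth[OF p, simplified])
  show "?e 2 = 0" if "w $ 1 = 0"
    using w[of 1] that 3 g_nz[OF p] by (simp add: V_nth[OF p, simplified])
qed

lemma lie_bracket_nth_0:
  assumes "\<And>q. q \<in> U \<Longrightarrow> V i q $ k = 0" and "\<And>q. q \<in> U \<Longrightarrow> V j q $ k = 0" and p: "p \<in> U"
  shows "lie_bracket (V i) (V j) p $ k = 0"
  unfolding lie_bracket_nth[OF smooth_V smooth_V p]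
  using dir_deriv_0[where f="\<lambda>q. V i q $ k" and X="V j", OF open_U p assms(1)]
    dir_deriv_0[where f="\<lambda>q. V j q $ k" and X="V i", OF open_U p assms(2)] by simp

text \<open>Fields with an identically vanishing component are closed under brackets. This reflects
  the integrability of the spans of \<open>V 0\<close>, \<open>V 1\<close> and of
  \<open>V 0\<close>, \<open>V 1\<close>, \<open>V 2\<close>.\<close>

lemma pi_bracket_coord:
  assumes p: "p \<in> U"
  shows "frame_coord v p 3 (pi_bracket 0 1 p) = 0" "frame_coord v p 2 (pi_bracket 0 1 p) = 0"
    "frame_coord v p 3 (pi_bracket 1 2 p) = 0"
proof -
  note l = lie_bracket_nth_0[OF _ _ p] V_nth V_nth_4
  show "frame_coord v p 3 (pi_bracket 0 1 p) = 0" "frame_coord v p 2 (pi_bracket 0 1 p) = 0"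
    "frame_coord v p 3 (pi_bracket 1 2 p) = 0"
    unfolding pi_bracket_eq[OF p] dir_deriv_def
    by (intro coord_pi_eq_0[OF p] l; assumption)+
qed

lemma taylor_coord_eq_0: "p \<in> U \<Longrightarrow> (\<And>q. q \<in> U \<Longrightarrow> frame_coord v q k (u q) = 0) \<Longrightarrow> taylor_coord p u k = 0"
  unfolding taylor_coord_def using taylor_cong[OF open_U, of p "\<lambda>q. frame_coord v q k (u q)" "\<lambda>_. 0" X] by simp

end

text \<open>The Bryant-Wuenschmann condition enters as two pointwise identities: unlike the locally
  chosen \<open>f\<close> and \<open>h\<close>, these make sense on all of \<open>U\<close>.\<close>

locale bw_ode = fourth_order_ode +
  assumes K1_eq: "p \<in> U \<Longrightarrow> K1 p = - dir_deriv X K2 p"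
    and K0_eq: "p \<in> U \<Longrightarrow> 100 * K0 p = 9 * K2 p * K2 p - 30 * dir_deriv X K1 p"
begin

lemma taylor_numeral_mult:
  assumes "p \<in> U" and "smooth_on U f"
  shows "taylor X p (\<lambda>q. numeral n * f q) = numeral n * taylor X p f"
  using taylor_mult[OF open_U assms(1) smooth_X smooth_on_const assms(2), of "numeral n"]
  by (simp add: taylor_const numeral_fps_const)

lemma taylor_K1:
  assumes p: "p \<in> U"
  shows "taylor X p K1 = - fps_deriv (taylor X p K2)"
proof -
  have "taylor X p K1 = taylor X p (\<lambda>q. - dir_deriv X K2 q)"
    by (intro taylor_cong[OF open_U p] K1_eq)
  then show ?thesis
    using taylor_minus[OF open_U p smooth_X smooth_dir_deriv_X[OF smooth_K(3)]] by (simp add: taylor_dir_deriv)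
qed

lemma taylor_K0:
  assumes p: "p \<in> U"
  shows "100 * taylor X p K0 = 9 * taylor X p K2 * taylor X p K2 - 30 * fps_deriv (taylor X p K1)"
proof -
  note sm = smooth_K smooth_dir_deriv_X smooth_on_mult[OF open_U] smooth_on_diff[OF open_U]
  have "taylor X p (\<lambda>q. 100 * K0 q) = taylor X p (\<lambda>q. 9 * (K2 q * K2 q) - 30 * dir_deriv X K1 q)"
    by (intro taylor_cong[OF open_U p]) (simp add: K0_eq)
  then show ?thesis
    by (simp add: taylor_numeral_mult[OF p] taylor_diff[OF open_U p smooth_X] taylor_mult[OF open_U p smooth_X] sm taylor_dir_deriv)
qed

lemma dir_deriv_K1:
  assumes p: "p \<in> U"
  shows "dir_deriv (V i) K1 p = - DK2 i 1 p"
proof -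
  have "dir_deriv (V i) K1 p = dir_deriv (V i) (\<lambda>q. - dir_deriv X K2 q) p"
    by (intro dir_deriv_cong[OF open_U p] K1_eq)
  then show ?thesis
    by (simp add: DK2_def dir_deriv_minus differentiable smooth_dir_deriv_X smooth_K p)
qed

lemma dir_deriv_K0:
  assumes p: "p \<in> U"
  shows "100 * dir_deriv (V i) K0 p = 30 * DK2 i 2 p + 18 * K2 p * DK2 i 0 p"
proof -
  note sm = smooth_K smooth_dir_deriv_X smooth_on_mult[OF open_U] smooth_on_add[OF open_U]
  note df = differentiable[OF _ p]
  have "dir_deriv X K1 q = - dir_deriv X (dir_deriv X K2) q" if "q \<in> U" for q
  proof -
    have "dir_deriv X K1 q = dir_deriv X (\<lambda>q. - dir_deriv X K2 q) q"
      by (intro dir_deriv_cong[OF open_U that] K1_eq)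
    then show ?thesis by (simp add: dir_deriv_minus differentiable smooth_dir_deriv_X smooth_K that)
  qed
  then have "dir_deriv (V i) (\<lambda>q. 100 * K0 q) p =
      dir_deriv (V i) (\<lambda>q. 9 * (K2 q * K2 q) + 30 * dir_deriv X (dir_deriv X K2) q) p"
    by (intro dir_deriv_cong[OF open_U p]) (simp add: K0_eq)
  then show ?thesis
    by (simp add: DK2_def numeral_2_eq_2 dir_deriv_add dir_deriv_mult df sm)
qed

lemma taylor_dir_deriv_K1:
  assumes p: "p \<in> U"
  shows "taylor X p (dir_deriv (V i) K1) = - taylor X p (DK2 i 1)"
proof -
  have "taylor X p (dir_deriv (V i) K1) = taylor X p (\<lambda>q. - DK2 i 1 q)"
    by (intro taylor_cong[OF open_U p] dir_deriv_K1)
  then show ?thesis using taylor_minus[OF open_U p smooth_X smooth_DK2] by simp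
qed

lemma taylor_dir_deriv_K0:
  assumes p: "p \<in> U"
  shows "100 * taylor X p (dir_deriv (V i) K0) = 30 * taylor X p (DK2 i 2) + 18 * taylor X p K2 * taylor X p (DK2 i 0)"
proof -
  note sm = smooth_K smooth_DK2 smooth_dir_deriv_V smooth_on_mult[OF open_U] smooth_on_add[OF open_U]
  have "taylor X p (\<lambda>q. 100 * dir_deriv (V i) K0 q) = taylor X p (\<lambda>q. 30 * DK2 i 2 q + 18 * (K2 q * DK2 i 0 q))"
    by (intro taylor_cong[OF open_U p]) (simp add: dir_deriv_K0)
  then show ?thesis
    by (simp add: taylor_numeral_mult[OF p] taylor_add[OF open_U p smooth_X] taylor_mult[OF open_U p smooth_X] sm)
qed

lemma taylor_main:
  assumes p: "p \<in> U" and main: "\<And>q. q \<in> U \<Longrightarrow> 4 * DK2 1 0 q + 3 * DK2 0 1 q = 0"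
  shows "4 * taylor X p (DK2 1 0) + 3 * taylor X p (DK2 0 1) = 0"
proof -
  note sm = smooth_DK2 smooth_on_mult[OF open_U]
  have "taylor X p (\<lambda>q. 4 * DK2 1 0 q + 3 * DK2 0 1 q) = taylor X p (\<lambda>q. 0)"
    by (intro taylor_cong[OF open_U p] main)
  then show ?thesis
    by (simp add: taylor_numeral_mult[OF p] taylor_add[OF open_U p smooth_X] sm)
qed

lemma DK2_identities:
  assumes p: "p \<in> U" and main: "\<And>q. q \<in> U \<Longrightarrow> 4 * DK2 1 0 q + 3 * DK2 0 1 q = 0"
  defines "z \<equiv> \<lambda>i j. taylor X p (DK2 i j)"
  shows "10 * z 2 0 + 5 * z 1 1 + 3 * taylor X p K2 * z 0 0 = 0"
    and "20 * z 3 0 + 5 * z 2 1 + 6 * fps_deriv (taylor X p K2) * z 0 0 - 36 * taylor X p K2 * fps_deriv (z 0 0) = 0"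
proof -
  define c where "c i j k = taylor_coord p (pi_bracket i j) k" for i j k
  have zi0: "dir_deriv (V i) K2 = DK2 i 0" for i by (simp add: DK2_def)
  have c4: "c i 4 k = - taylor X p K0 * c i 0 k + taylor X p K1 * c i 1 k - taylor X p K2 * c i 2 k
    - (if k = 0 then taylor X p (dir_deriv (V i) K0) else 0) + (if k = 1 then taylor X p (dir_deriv (V i) K1) else 0)
    - (if k = 2 then taylor X p (dir_deriv (V i) K2) else 0)" if "k < 4" for i k
    unfolding c_def
    by (subst taylor_coord_combination[OF p that smooth_pi_bracket smooth_pi_bracket smooth_pi_bracket, symmetric])
      (intro smooth_dir_deriv_V smooth_K taylor_coord_cong[OF p] pi_bracket_4)+
  have anti: "c j i k = - c i j k" if "k < 4" for i j k
  proof -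
    have "pi_bracket j i = (\<lambda>q. - pi_bracket i j q)" by (simp add: pi_bracket_def fun_eq_iff)
    then show ?thesis unfolding c_def using taylor_coord_minus[OF p smooth_pi_bracket that] by simp
  qed
  note fam = taylor_coord_family[where M=pi_bracket, OF smooth_pi_bracket _ p, folded c_def]
  \<comment> \<open>\<open>structure_identities\<close> asks for antisymmetry at every
    \<open>k\<close>, while \<open>anti\<close> gives it only for \<open>k < 4\<close>; beyond that
    \<open>c'\<close> is zero.\<close>
  define c' where "c' i j k = (if k < 4 then c i j k else 0)" for i j k
  have c'_eq: "c' i j 0 = c i j 0" "c' i j 1 = c i j 1" "c' i j 2 = c i j 2" "c' i j 3 = c i j 3" for i j
    by (simp_all add: c'_def)
  have c01: "c 0 1 2 = 0" "c 0 1 3 = 0" "c 1 2 3 = 0"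
    unfolding c_def by (rule taylor_coord_eq_0[OF p pi_bracket_coord(2)], assumption, rule taylor_coord_eq_0[OF p pi_bracket_coord(1)], assumption,
      rule taylor_coord_eq_0[OF p pi_bracket_coord(3)], assumption)
  have anti': "c' j i k = - c' i j k" for i j k
    using anti[of k i j] by (cases "k < 4") (simp_all add: c'_def)
  have c4': "c' i 4 0 = - taylor X p K0 * c' i 0 0 + taylor X p K1 * c' i 1 0 - taylor X p K2 * c' i 2 0 - taylor X p (dir_deriv (V i) K0)"
    "c' i 4 1 = - taylor X p K0 * c' i 0 1 + taylor X p K1 * c' i 1 1 - taylor X p K2 * c' i 2 1 - z i 1"
    "c' i 4 2 = - taylor X p K0 * c' i 0 2 + taylor X p K1 * c' i 1 2 - taylor X p K2 * c' i 2 2 - z i 0"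
    "c' i 4 3 = - taylor X p K0 * c' i 0 3 + taylor X p K1 * c' i 1 3 - taylor X p K2 * c' i 2 3" for i
    using c4[of 0 i] c4[of 1 i] c4[of 2 i] c4[of 3 i]
    unfolding c'_eq by (simp_all add: z_def zi0 taylor_dir_deriv_K1[OF p])
  have rec: "fps_deriv (c' i j 0) - taylor X p K0 * c' i j 3 = c' (Suc i) j 0 + c' i (Suc j) 0"
      "fps_deriv (c' i j 1) + c' i j 0 + taylor X p K1 * c' i j 3 = c' (Suc i) j 1 + c' i (Suc j) 1"
      "fps_deriv (c' i j 2) + c' i j 1 - taylor X p K2 * c' i j 3 = c' (Suc i) j 2 + c' i (Suc j) 2"
      "fps_deriv (c' i j 3) + c' i j 2 = c' (Suc i) j 3 + c' i (Suc j) 3" for i j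
    unfolding c'_eq by (rule fam, rule dir_deriv_X_pi_bracket, assumption)+
  have c01': "c' 0 1 2 = 0" "c' 0 1 3 = 0" "c' 1 2 3 = 0" unfolding c'_eq by (fact c01)+
  have z': "fps_deriv (z i j) = z (Suc i) j + z i (Suc j)" for i j unfolding z_def by (rule taylor_DK2[OF p])
  have y0: "100 * taylor X p (dir_deriv (V i) K0) = 30 * z i 2 + 18 * taylor X p K2 * z i 0" for i
    unfolding z_def by (rule taylor_dir_deriv_K0[OF p])
  have main': "4 * z 1 0 + 3 * z 0 1 = 0" unfolding z_def by (rule taylor_main[OF p main])
  note rule = structure_identities[where c=c' and z=z and ?y0.0="\<lambda>i. taylor X p (dir_deriv (V i) K0)"
      and ?K0.0="taylor X p K0" and ?K1.0="taylor X p K1" and ?K2.0="taylor X p K2"]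
  show "10 * z 2 0 + 5 * z 1 1 + 3 * taylor X p K2 * z 0 0 = 0"
    by (rule rule(1)) (fact rec anti' c01' z' c4' y0 main' taylor_K1[OF p] taylor_K0[OF p])+
  show "20 * z 3 0 + 5 * z 2 1 + 6 * fps_deriv (taylor X p K2) * z 0 0 - 36 * taylor X p K2 * fps_deriv (z 0 0) = 0"
    by (rule rule(2)) (fact rec anti' c01' z' c4' y0 main' taylor_K1[OF p] taylor_K0[OF p])+
qed

end

section \<open>Necessity\<close>

lemma bilinear_expand:
  fixes B :: "'a::euclidean_space \<Rightarrow> 'a \<Rightarrow> 'a"
  assumes "bilinear B"
  shows "B u w = (\<Sum>a\<in>Basis. \<Sum>b\<in>Basis. (u \<bullet> a) *\<^sub>R (w \<bullet> b) *\<^sub>R B a b)"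
proof -
  have lin: "linear (\<lambda>x. B x y)" "linear (B x)" for x y using assms by (auto simp: bilinear_def)
  have "B u w = (\<Sum>a\<in>Basis. (u \<bullet> a) *\<^sub>R B a w)" by (rule linear_sum_Basis[OF lin(1)])
  also have "\<dots> = (\<Sum>a\<in>Basis. (u \<bullet> a) *\<^sub>R (\<Sum>b\<in>Basis. (w \<bullet> b) *\<^sub>R B a b))"
    by (intro sum.cong refl arg_cong[of _ _ "scaleR _"] linear_sum_Basis[OF lin(2)])
  finally show ?thesis by (simp add: scaleR_sum_right)
qed

context fourth_order_ode
begin

lemma smooth_christoffel:
  assumes \<Gamma>: "connection_on (\<pi> ` U) \<Gamma>" and sm: "smooth_on U u" "smooth_on U w"
  shows "smooth_on U (\<lambda>q. \<Gamma> (\<pi> q) (u q) (w q))"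
proof -
  have \<Gamma>': "smooth_on U (\<lambda>q. \<Gamma> (\<pi> q) a b)" for a b
    using \<Gamma> by (intro smooth_on_compose[OF open_U subset_refl smooth_pi]) (auto simp: connection_on_def)
  have "smooth_on U (\<lambda>q. \<Sum>a\<in>Basis. \<Sum>b\<in>Basis. (u q \<bullet> a) *\<^sub>R (w q \<bullet> b) *\<^sub>R \<Gamma> (\<pi> q) a b)"
    by (intro smooth_on_sum smooth_on_scaleR smooth_on_inner open_U sm \<Gamma>' smooth_on_const)
  then show ?thesis
  proof (rule smooth_on_eqI[OF _ open_U])
    fix q assume "q \<in> U"
    then have "bilinear (\<Gamma> (\<pi> q))" using \<Gamma> by (auto simp: connection_on_def)
    then show "\<Gamma> (\<pi> q) (u q) (w q) = (\<Sum>a\<in>Basis. \<Sum>b\<in>Basis. (u q \<bullet> a) *\<^sub>R (w q \<bullet> b) *\<^sub>R \<Gamma> (\<pi> q) a b)"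
      by (rule bilinear_expand)
  qed
qed

text \<open>The symbols are composed with \<pi> and hence constant along \<open>X\<close>; only the
  two arguments contribute.\<close>

lemma dir_deriv_X_christoffel:
  assumes \<Gamma>: "connection_on (\<pi> ` U) \<Gamma>" and sm: "smooth_on U u" "smooth_on U w" and p: "p \<in> U"
  shows "dir_deriv X (\<lambda>q. \<Gamma> (\<pi> q) (u q) (w q)) p =
    \<Gamma> (\<pi> p) (dir_deriv X u p) (w p) + \<Gamma> (\<pi> p) (u p) (dir_deriv X w p)"
proof -
  have bil: "bilinear (\<Gamma> (\<pi> q))" if "q \<in> U" for q using \<Gamma> that by (auto simp: connection_on_def)
  have \<Gamma>': "smooth_on U (\<lambda>q. \<Gamma> (\<pi> q) a b)" for a b
    using \<Gamma> by (intro smooth_on_compose[OF open_U subset_refl smooth_pi]) (auto simp: connection_on_def)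
  have 0: "dir_deriv X (\<lambda>q. \<Gamma> (\<pi> q) a b) p = 0" for a b
  proof -
    have d: "(\<lambda>y. \<Gamma> y a b) differentiable (at (\<pi> p))"
      using \<Gamma> p by (auto simp: connection_on_def intro: smooth_on_imp_differentiable)
    show ?thesis
      unfolding dir_deriv_compose[OF differentiable[OF smooth_pi p] d] dir_deriv_X_pi[OF p]
      using linear_frechet_derivative[OF d] by (rule linear_0)
  qed
  have in': "dir_deriv X (\<lambda>q. u q \<bullet> a) p = dir_deriv X u p \<bullet> a" if "smooth_on U u" for u :: "jet \<Rightarrow> real^4" and a
    using differentiable[OF that p] by (simp add: dir_deriv_def frechet_derivative_inner)
  note sms = sm \<Gamma>' smooth_on_inner[OF open_U] smooth_on_scaleR[OF open_U] smooth_on_sum[OF open_U]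
  note df = differentiable[OF _ p]
  have "dir_deriv X (\<lambda>q. \<Gamma> (\<pi> q) (u q) (w q)) p =
      dir_deriv X (\<lambda>q. \<Sum>a\<in>Basis. \<Sum>b\<in>Basis. (u q \<bullet> a) *\<^sub>R (w q \<bullet> b) *\<^sub>R \<Gamma> (\<pi> q) a b) p"
    by (intro dir_deriv_cong[OF open_U p] bilinear_expand bil)
  also have "\<dots> = (\<Sum>a\<in>Basis. \<Sum>b\<in>Basis. (dir_deriv X u p \<bullet> a) *\<^sub>R (w p \<bullet> b) *\<^sub>R \<Gamma> (\<pi> p) a b) +
      (\<Sum>a\<in>Basis. \<Sum>b\<in>Basis. (u p \<bullet> a) *\<^sub>R (dir_deriv X w p \<bullet> b) *\<^sub>R \<Gamma> (\<pi> p) a b)"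
    by (simp add: dir_deriv_sum dir_deriv_scaleR dir_deriv_mult df sms smooth_on_mult[OF open_U] in' 0
      sum.distrib algebra_simps)
  finally show ?thesis unfolding bilinear_expand[OF bil[OF p], symmetric] .
qed

lemma span_coord:
  assumes p: "p \<in> U"
  shows "w \<in> span {v 0 p, v 1 p} \<Longrightarrow> frame_coord v p 2 w = 0 \<and> frame_coord v p 3 w = 0"
    and "w \<in> span {v 0 p, v 1 p, v 2 p} \<Longrightarrow> frame_coord v p 3 w = 0"
proof -
  have sub: "subspace {w. frame_coord v p k w = 0}" if "k < 4" for k
    using linear_frame_coord[OF frame_v p that] by (rule linear_subspace_kernel)
  note s = span_minimal[OF _ sub] frame_coord_v[OF p]
  show "w \<in> span {v 0 p, v 1 p} \<Longrightarrow> frame_coord v p 2 w = 0 \<and> frame_coord v p 3 w = 0"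
    using s(1)[of "{v 0 p, v 1 p}" 2] s(1)[of "{v 0 p, v 1 p}" 3] s(2)[of 0] s(2)[of 1] by auto
  show "w \<in> span {v 0 p, v 1 p, v 2 p} \<Longrightarrow> frame_coord v p 3 w = 0"
    using s(1)[of "{v 0 p, v 1 p, v 2 p}" 3] s(2)[of 0] s(2)[of 1] s(2)[of 2] by auto
qed

text \<open>\<open>N i j\<close> is the covariant derivative of \<open>v j\<close> along
  \<open>V i\<close>, pulled back to the jet space, where it obeys the recursion of the projected
  brackets. The cone condition and total geodesy become vanishing coordinates, and the two ways of
  reaching index 4 supply the other hypotheses of \<open>totally_geodesic_identity\<close>.\<close>

lemma totally_geodesic_necessary:
  assumes \<Gamma>: "connection_on (\<pi> ` U) \<Gamma>"
    and para: "\<And>i q. q \<in> U \<Longrightarrow> dir_deriv (V i) (v 0) q + \<Gamma> (\<pi> q) (v i q) (v 0 q) \<in> span {v 0 q, v 1 q}"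
    and geo: "\<And>i q. q \<in> U \<Longrightarrow> i < 3 \<Longrightarrow> dir_deriv (V i) (v 2) q + \<Gamma> (\<pi> q) (v i q) (v 2 q) \<in> span {v 0 q, v 1 q, v 2 q}"
    and p: "p \<in> U"
  shows "4 * DK2 1 0 p + 3 * DK2 0 1 p = 0"
proof -
  define N where "N i j q = dir_deriv (V i) (v j) q + \<Gamma> (\<pi> q) (v i q) (v j q)" for i j q
  have bil: "bilinear (\<Gamma> (\<pi> q))" if "q \<in> U" for q using \<Gamma> that by (auto simp: connection_on_def)
  have lin: "linear (\<lambda>x. \<Gamma> (\<pi> q) x y)" "linear (\<Gamma> (\<pi> q) x)" if "q \<in> U" for q x y
    using bil[OF that] by (auto simp: bilinear_def)
  have sm: "smooth_on U (N i j)" for i j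
    unfolding N_def by (intro smooth_on_add open_U smooth_dir_deriv_V smooth_v smooth_christoffel[OF \<Gamma>])
  have rec: "dir_deriv X (N i j) q = N (Suc i) j q + N i (Suc j) q" if "q \<in> U" for i j q
    unfolding N_def
    using that by (simp add: dir_deriv_add differentiable smooth_dir_deriv_V smooth_v smooth_christoffel[OF \<Gamma>]
      dir_deriv_X_christoffel[OF \<Gamma>] dir_deriv_X_v dir_deriv_X_V_v)
  define n where "n i j k = taylor_coord p (N i j) k" for i j k
  note fam = taylor_coord_family[where M=N, OF sm _ p, folded n_def]
  have n0: "n i 0 2 = 0" "n i 0 3 = 0" for i
    unfolding n_def using para span_coord(1) by (auto intro!: taylor_coord_eq_0[OF p] simp: N_def)
  have n2: "n i 2 3 = 0" if "i < 3" for i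
    unfolding n_def using geo span_coord(2) that by (auto intro!: taylor_coord_eq_0[OF p] simp: N_def)
  have N4: "N i 4 q = - K0 q *\<^sub>R N i 0 q + K1 q *\<^sub>R N i 1 q - K2 q *\<^sub>R N i 2 q
    - dir_deriv (V i) K0 q *\<^sub>R v 0 q + dir_deriv (V i) K1 q *\<^sub>R v 1 q - dir_deriv (V i) K2 q *\<^sub>R v 2 q" if "q \<in> U" for i q
    unfolding N_def dir_deriv_v_4[OF that] v_4[OF that]
    by (simp add: linear_add[OF lin(2)[OF that]] linear_diff[OF lin(2)[OF that]] linear_cmul[OF lin(2)[OF that]]
      linear_neg[OF lin(2)[OF that]] algebra_simps)
  have n4: "n i 4 k = - taylor X p K0 * n i 0 k + taylor X p K1 * n i 1 k - taylor X p K2 * n i 2 k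
    - (if k = 0 then taylor X p (dir_deriv (V i) K0) else 0) + (if k = 1 then taylor X p (dir_deriv (V i) K1) else 0)
    - (if k = 2 then taylor X p (dir_deriv (V i) K2) else 0)" if "k < 4" for i k
    unfolding n_def
    by (subst taylor_coord_combination[OF p that sm sm sm, symmetric])
      (intro smooth_dir_deriv_V smooth_K taylor_coord_cong[OF p] N4)+
  have N4': "N 4 j q = - K0 q *\<^sub>R N 0 j q + K1 q *\<^sub>R N 1 j q - K2 q *\<^sub>R N 2 j q
    - 0 *\<^sub>R v 0 q + 0 *\<^sub>R v 1 q - 0 *\<^sub>R v 2 q" if "q \<in> U" for j q
    unfolding N_def dir_deriv_V_4[OF differentiable[OF smooth_v that] that] v_4[OF that]
    by (simp add: linear_add[OF lin(1)[OF that]] linear_diff[OF lin(1)[OF that]] linear_cmul[OF lin(1)[OF that]]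
      linear_neg[OF lin(1)[OF that]] algebra_simps)
  have n4': "n 4 j k = - taylor X p K0 * n 0 j k + taylor X p K1 * n 1 j k - taylor X p K2 * n 2 j k
    - (if k = 0 then taylor X p (\<lambda>_. 0) else 0) + (if k = 1 then taylor X p (\<lambda>_. 0) else 0)
    - (if k = 2 then taylor X p (\<lambda>_. 0) else 0)" if "k < 4" for j k
    unfolding n_def
    by (subst taylor_coord_combination[OF p that sm sm sm, symmetric])
      (intro smooth_on_const taylor_coord_cong[OF p] N4')+
  have zi0: "dir_deriv (V i) K2 = DK2 i 0" for i by (simp add: DK2_def)
  have "4 * taylor X p (DK2 1 0) + 3 * taylor X p (DK2 0 1) = 0"
  proof (rule totally_geodesic_identity[where n=n and z="\<lambda>i j. taylor X p (DK2 i j)"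
        and ?K0.0="taylor X p K0" and ?K1.0="taylor X p K1" and ?K2.0="taylor X p K2", OF _ _ _ _ n0 n2])
    show "fps_deriv (n i j 0) - taylor X p K0 * n i j 3 = n (Suc i) j 0 + n i (Suc j) 0"
      "fps_deriv (n i j 1) + n i j 0 + taylor X p K1 * n i j 3 = n (Suc i) j 1 + n i (Suc j) 1"
      "fps_deriv (n i j 2) + n i j 1 - taylor X p K2 * n i j 3 = n (Suc i) j 2 + n i (Suc j) 2"
      "fps_deriv (n i j 3) + n i j 2 = n (Suc i) j 3 + n i (Suc j) 3" for i j
      by (rule fam, rule rec, assumption)+
    show "n i 4 2 = - taylor X p K0 * n i 0 2 + taylor X p K1 * n i 1 2 - taylor X p K2 * n i 2 2 - taylor X p (DK2 i 0)" for i
      using n4[of 2 i] by (simp add: zi0)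
    show "n i 4 3 = - taylor X p K0 * n i 0 3 + taylor X p K1 * n i 1 3 - taylor X p K2 * n i 2 3" for i
      using n4[of 3 i] by simp
    show "n 4 0 1 = - taylor X p K0 * n 0 0 1 + taylor X p K1 * n 1 0 1 - taylor X p K2 * n 2 0 1"
      using n4'[of 1 0] by simp
    show "fps_deriv (taylor X p (DK2 0 0)) = taylor X p (DK2 1 0) + taylor X p (DK2 0 1)"
      using taylor_DK2[OF p, of 0 0] by simp
  qed
  then have "fps_nth (4 * taylor X p (DK2 1 0) + 3 * taylor X p (DK2 0 1)) 0 = 0" by simp
  then show ?thesis by (simp add: numeral_fps_const)
qed

end

section \<open>Slices\<close>

definition slice_dir :: "real^3 \<Rightarrow> jet" where
  "slice_dir u = axis 1 (u $ 1) + axis 2 (u $ 2) + axis 3 (u $ 3)"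

text \<open>\<open>slice_dir\<close> is the derivative of every \<open>slice c a\<close>;
  \<open>slice_param\<close> inverts it on vectors without \<open>x_0\<close>- and
  \<open>t\<close>-components.\<close>

definition slice_param :: "jet \<Rightarrow> real^3" where
  "slice_param w = axis 1 (w $ 1) + axis 2 (w $ 2) + axis 3 (w $ 3)"

lemma slice_dir_nth: "slice_dir u $ 0 = 0" "slice_dir u $ 1 = u $ 1" "slice_dir u $ 2 = u $ 2"
  "slice_dir u $ 3 = u $ 3" "slice_dir u $ 4 = 0"
  by (simp_all add: slice_dir_def axis_def)

lemma slice_param_nth: "slice_param w $ 1 = w $ 1" "slice_param w $ 2 = w $ 2" "slice_param w $ 3 = w $ 3"
  by (simp_all add: slice_param_def axis_def)

lemma slice_eq: "slice c a u = (axis 4 c + axis 0 a) + slice_dir u"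
  by (simp add: slice_def slice_dir_def add_ac)

lemma linear_slice_dir: "linear slice_dir"
proof (rule linearI)
  show "slice_dir (x + y) = slice_dir x + slice_dir y" for x y
    by (rule jet_eqI) (simp_all add: slice_dir_nth)
  show "slice_dir (r *\<^sub>R x) = r *\<^sub>R slice_dir x" for r x
    by (rule jet_eqI) (simp_all add: slice_dir_nth)
qed

lemma linear_slice_param: "linear slice_param"
  by (rule linearI) (simp_all add: slice_param_nth vec_eq_iff forall_3)

lemma slice_dir_param: "w $ 0 = 0 \<Longrightarrow> w $ 4 = 0 \<Longrightarrow> slice_dir (slice_param w) = w"
  by (rule jet_eqI) (simp_all add: slice_dir_nth slice_param_nth)

lemma slice_surj: "slice (q $ 4) (q $ 0) (slice_param q) = q"
  by (rule jet_eqI) (simp_all add: slice_def axis_def slice_param_nth)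

lemma smooth_on_slice: "open D \<Longrightarrow> smooth_on D (slice c a)"
  unfolding slice_eq[abs_def] by (intro smooth_on_add smooth_on_const smooth_on_linear linear_slice_dir)

lemma dir_deriv_slice: "dir_deriv Y (slice c a) u = slice_dir (Y u)"
proof -
  have "(slice c a has_derivative slice_dir) (at u)"
    unfolding slice_eq[abs_def]
    using has_derivative_add[OF has_derivative_const linear_imp_has_derivative[OF linear_slice_dir]] by simp
  then show ?thesis by (rule dir_deriv_eqI)
qed

lemma slice_differentiable: "slice c a differentiable (at u)"
  using smooth_on_slice[OF open_UNIV] smooth_on_imp_differentiable by blast

lemma open_slice_domain:
  assumes "open U"
  shows "open {u. slice c a u \<in> U}"
proof -
  have "continuous_on UNIV (slice c a)"
    using slice_differentiable by (intro continuous_at_imp_continuous_on) (auto intro: differentiable_imp_continuous_within)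
  from open_vimage[OF assms this] show ?thesis by (simp add: vimage_def)
qed

lemma smooth_on_comp_slice:
  assumes "open U" and "smooth_on U f"
  shows "smooth_on {u. slice c a u \<in> U} (\<lambda>u. f (slice c a u))"
  by (rule smooth_on_compose[OF open_slice_domain[OF assms(1)] _ smooth_on_slice[OF open_slice_domain[OF assms(1)]] assms(2)]) auto

lemma dir_deriv_comp_slice:
  assumes "f differentiable (at (slice c a u))"
  shows "dir_deriv Y (\<lambda>u. f (slice c a u)) u = frechet_derivative f (at (slice c a u)) (slice_dir (Y u))"
  unfolding dir_deriv_compose[OF slice_differentiable assms] dir_deriv_slice ..

context fourth_order_ode
begin

lemma coord_3_eq_0_imp_span:
  assumes "p \<in> U" and "frame_coord v p 3 w = 0"
  shows "w \<in> span {v 0 p, v 1 p, v 2 p}"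
proof -
  have "frame_coord v p 0 w *\<^sub>R v 0 p + frame_coord v p 1 w *\<^sub>R v 1 p + frame_coord v p 2 w *\<^sub>R v 2 p
      \<in> span {v 0 p, v 1 p, v 2 p}"
    by (intro span_add span_mul; rule span_base; simp)
  then show ?thesis using frame_coord_expand[OF frame_v assms(1), of w] assms(2) by (simp add: sum_lessThan_4)
qed

lemma V_in_slice: "q \<in> U \<Longrightarrow> i < 3 \<Longrightarrow> slice_dir (slice_param (V i q)) = V i q"
  using V_nth[of q] by (intro slice_dir_param V_nth_4) (auto simp: less_Suc_eq eval_nat_numeral)

text \<open>The slices are tangent to \<open>V 0\<close>, \<open>V 1\<close>, \<open>V 2\<close>, so
  \<open>v 0\<close>, \<open>v 1\<close>, \<open>v 2\<close> span the tangent spaces of their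
  projections. Written as a kernel, total geodesy becomes the vanishing of one coordinate.\<close>

lemma range_pi_slice:
  assumes "slice c a u \<in> U"
  shows "range (frechet_derivative (\<lambda>u. \<pi> (slice c a u)) (at u)) = {w. frame_coord v (slice c a u) 3 w = 0}"
proof -
  let ?q = "slice c a u"
  have D: "frechet_derivative (\<lambda>u. \<pi> (slice c a u)) (at u) w = frechet_derivative \<pi> (at ?q) (slice_dir w)" for w
    using dir_deriv_comp_slice[OF differentiable[OF smooth_pi assms], of "\<lambda>_. w"] by (simp add: dir_deriv_def)
  show ?thesis
  proof (intro equalityI subsetI)
    fix w assume "w \<in> range (frechet_derivative (\<lambda>u. \<pi> (slice c a u)) (at u))"
    then show "w \<in> {w. frame_coord v ?q 3 w = 0}"
      unfolding D using coord_pi_eq_0(1)[OF assms] by (auto simp: slice_dir_nth)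
  next
    fix w assume "w \<in> {w. frame_coord v ?q 3 w = 0}"
    then have "w = (\<Sum>i<4. frame_coord v ?q i w *\<^sub>R v i ?q)" "frame_coord v ?q 3 w = 0"
      using frame_coord_expand[OF frame_v assms] by simp_all
    then have w: "w = (\<Sum>i<3. frame_coord v ?q i w *\<^sub>R v i ?q)"
      by (simp add: sum_lessThan_4 sum_lessThan_3)
    let ?W = "\<Sum>i<3. frame_coord v ?q i w *\<^sub>R V i ?q"
    have "frechet_derivative \<pi> (at ?q) ?W = w"
      using linear_pi[OF assms] w by (simp add: linear_sum linear_cmul v_def dir_deriv_def)
    moreover have "slice_dir (slice_param ?W) = ?W"
      using V_in_slice[OF assms] linear_slice_dir linear_slice_param by (simp add: linear_sum linear_cmul)
    ultimately have "w = frechet_derivative (\<lambda>u. \<pi> (slice c a u)) (at u) (slice_param ?W)" unfolding D by simp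
    then show "w \<in> range (frechet_derivative (\<lambda>u. \<pi> (slice c a u)) (at u))" by blast
  qed
qed

lemma totally_geodesic_imp:
  assumes geo: "totally_geodesic \<Gamma> {u. slice (q $ 4) (q $ 0) u \<in> U} (\<lambda>u. \<pi> (slice (q $ 4) (q $ 0) u))"
    and q: "q \<in> U" and i: "i < 3"
  shows "dir_deriv (V i) (v 2) q + \<Gamma> (\<pi> q) (v i q) (v 2 q) \<in> span {v 0 q, v 1 q, v 2 q}"
proof -
  let ?\<sigma> = "slice (q $ 4) (q $ 0)" and ?u = "slice_param q"
  let ?D = "{u. ?\<sigma> u \<in> U}" and ?\<phi> = "\<lambda>u. \<pi> (?\<sigma> u)"
  have D: "open ?D" by (rule open_slice_domain[OF open_U])
  have u: "?\<sigma> ?u = q" by (rule slice_surj)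
  \<comment> \<open>The test fields: \<open>V j\<close> read in the parameters of the slice through
    \<open>q\<close>. For \<open>j < 3\<close> the derivative of \<open>?\<phi>\<close> takes
    \<open>Z j\<close> to \<open>v j\<close>.\<close>
  define Z where "Z j u = slice_param (V j (?\<sigma> u))" for j u
  have Z: "smooth_on ?D (Z j)" for j
    unfolding Z_def by (rule smooth_on_linear_compose[OF linear_slice_param D smooth_on_comp_slice[OF open_U smooth_V]])
  have Z_\<phi>: "dir_deriv (Z j) ?\<phi> u = v j (?\<sigma> u)" if "u \<in> ?D" "j < 3" for j u
    using that V_in_slice[of "?\<sigma> u" j]
    by (simp add: dir_deriv_comp_slice differentiable smooth_pi Z_def v_def dir_deriv_def[of "V j"])
  have "dir_deriv (Z i) (dir_deriv (Z 2) ?\<phi>) ?u = dir_deriv (Z i) (\<lambda>u. v 2 (?\<sigma> u)) ?u"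
    using q u by (intro dir_deriv_cong[OF D] Z_\<phi>) auto
  also have "\<dots> = dir_deriv (V i) (v 2) q"
    using V_in_slice[OF q i] differentiable[OF smooth_v q]
    by (subst dir_deriv_comp_slice) (simp_all add: u Z_def dir_deriv_def)
  finally have "cov_deriv_along \<Gamma> ?\<phi> (Z i) (dir_deriv (Z 2) ?\<phi>) ?u = dir_deriv (V i) (v 2) q + \<Gamma> (\<pi> q) (v i q) (v 2 q)"
    using q i by (simp add: cov_deriv_along_def Z_\<phi> u)
  moreover have "cov_deriv_along \<Gamma> ?\<phi> (Z i) (dir_deriv (Z 2) ?\<phi>) ?u \<in> range (frechet_derivative ?\<phi> (at ?u))"
    using geo Z q u unfolding totally_geodesic_def by simp
  ultimately have "frame_coord v q 3 (dir_deriv (V i) (v 2) q + \<Gamma> (\<pi> q) (v i q) (v 2 q)) = 0"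
    using range_pi_slice[of "q $ 4" "q $ 0" ?u] q by (simp add: u)
  then show ?thesis by (rule coord_3_eq_0_imp_span[OF q])
qed

text \<open>The normal part of the derivative is bilinear over functions, since derivatives of
  coefficients contribute only tangent vectors. Hence the fields \<open>V i\<close> with
  \<open>i < 3\<close> suffice as test fields.\<close>

lemma totally_geodesicI:
  assumes bil: "\<And>q. q \<in> U \<Longrightarrow> bilinear (\<Gamma> (\<pi> q))"
    and geo: "\<And>q i j. q \<in> U \<Longrightarrow> i < 3 \<Longrightarrow> j < 3 \<Longrightarrow>
      frame_coord v q 3 (dir_deriv (V i) (v j) q + \<Gamma> (\<pi> q) (v i q) (v j q)) = 0"
  shows "totally_geodesic \<Gamma> {u. slice c a u \<in> U} (\<lambda>u. \<pi> (slice c a u))"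
  unfolding totally_geodesic_def
proof (intro allI impI ballI)
  let ?\<sigma> = "slice c a"
  let ?D = "{u. ?\<sigma> u \<in> U}" and ?\<phi> = "\<lambda>u. \<pi> (?\<sigma> u)"
  fix Y Z :: "real^3 \<Rightarrow> real^3" and u
  assume Y: "smooth_on ?D Y" and Z: "smooth_on ?D Z" and u: "u \<in> ?D"
  let ?q = "?\<sigma> u"
  have q: "?q \<in> U" using u by simp
  have D: "open ?D" by (rule open_slice_domain[OF open_U])
  have \<phi>: "smooth_on ?D ?\<phi>"
    by (rule smooth_on_comp_slice[OF open_U smooth_pi])
  have W_\<phi>: "dir_deriv W ?\<phi> u = frechet_derivative \<pi> (at (?\<sigma> u)) (slice_dir (W u))" if "u \<in> ?D" for W u
    using that by (simp add: dir_deriv_comp_slice differentiable smooth_pi)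
  define z where "z W i u = frame_coord v (?\<sigma> u) i (dir_deriv W ?\<phi> u)" for W i u
  have frame: "frame_on ?D (\<lambda>i u. v i (?\<sigma> u))"
    using frame_v D unfolding frame_on_def
    by (auto intro: smooth_on_comp_slice[OF open_U smooth_v])
  \<comment> \<open>Cramer's formula is pointwise, so coordinates along the slice are literally
    those of the frame pulled back to the parameter domain, where smoothness is known.\<close>
  have z_eq: "z W i u = frame_coord (\<lambda>i u. v i (?\<sigma> u)) u i (dir_deriv W ?\<phi> u)" for W i u
    unfolding z_def frame_coord_def frame_matrix_def by (rule refl)
  have z_smooth: "smooth_on ?D (z W i)" if "smooth_on ?D W" for W i
    unfolding z_eq[abs_def] by (intro smooth_on_frame_coord[OF D frame] smooth_on_dir_deriv D that \<phi>)
  have z3: "z W 3 u = 0" if "u \<in> ?D" for W u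
    unfolding z_def W_\<phi>[OF that] using that by (intro coord_pi_eq_0) (simp_all add: slice_dir_nth)
  have exp: "dir_deriv W ?\<phi> u = (\<Sum>i<3. z W i u *\<^sub>R v i (?\<sigma> u))" if "u \<in> ?D" for W u
    using frame_coord_expand[OF frame_v, of "?\<sigma> u" "dir_deriv W ?\<phi> u"] z3[OF that, of W] that
    by (simp add: z_def sum_lessThan_4 sum_lessThan_3)
  have vs: "smooth_on ?D (\<lambda>u. v i (?\<sigma> u))" for i
    by (rule smooth_on_comp_slice[OF open_U smooth_v])
  have "dir_deriv Y (dir_deriv Z ?\<phi>) u = dir_deriv Y (\<lambda>u. \<Sum>i<3. z Z i u *\<^sub>R v i (?\<sigma> u)) u"
    by (intro dir_deriv_cong[OF D u] exp)
  also have "\<dots> = (\<Sum>i<3. dir_deriv Y (z Z i) u *\<^sub>R v i ?q + z Z i u *\<^sub>R dir_deriv Y (\<lambda>u. v i (?\<sigma> u)) u)"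
    using u D vs z_smooth[OF Z]
    by (subst dir_deriv_sum) (auto intro!: sum.cong dir_deriv_scaleR smooth_on_imp_differentiable[of ?D] smooth_on_scaleR)
  also have "\<dots> = (\<Sum>i<3. dir_deriv Y (z Z i) u *\<^sub>R v i ?q +
      z Z i u *\<^sub>R (\<Sum>j<3. z Y j u *\<^sub>R dir_deriv (V j) (v i) ?q))"
  proof (intro sum.cong refl arg_cong2[of _ _ _ _ "(+)"] arg_cong[of _ _ "scaleR _"])
    fix i
    have lin: "linear (frechet_derivative (v i) (at ?q))" by (intro linear_frechet_derivative differentiable smooth_v q)
    have "slice_dir (Y u) = (\<Sum>j<4. z Y j u *\<^sub>R V j ?q)"
      using tangent_decomposition[OF q, of "slice_dir (Y u)"] by (simp add: slice_dir_nth z_def W_\<phi>[OF u])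
    also have "\<dots> = (\<Sum>j<3. z Y j u *\<^sub>R V j ?q)"
      using z3[OF u, of Y] by (simp add: sum_lessThan_4 sum_lessThan_3)
    finally show "dir_deriv Y (\<lambda>u. v i (?\<sigma> u)) u = (\<Sum>j<3. z Y j u *\<^sub>R dir_deriv (V j) (v i) ?q)"
      using dir_deriv_comp_slice[OF differentiable[OF smooth_v q]]
      by (simp add: linear_sum[OF lin] linear_cmul[OF lin] dir_deriv_def)
  qed
  finally have d: "dir_deriv Y (dir_deriv Z ?\<phi>) u = \<dots>" .
  have lin: "linear (\<lambda>x. \<Gamma> (\<pi> ?q) x y)" "linear (\<Gamma> (\<pi> ?q) x)" for x y
    using bil[OF q] by (auto simp: bilinear_def)
  have "\<Gamma> (?\<phi> u) (dir_deriv Y ?\<phi> u) (dir_deriv Z ?\<phi> u) =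
      (\<Sum>i<3. z Z i u *\<^sub>R (\<Sum>j<3. z Y j u *\<^sub>R \<Gamma> (\<pi> ?q) (v j ?q) (v i ?q)))"
    unfolding exp[OF u] by (simp add: linear_sum[OF lin(2)] linear_cmul[OF lin(2)] linear_sum[OF lin(1)] linear_cmul[OF lin(1)])
  with d have eq: "cov_deriv_along \<Gamma> ?\<phi> Y (dir_deriv Z ?\<phi>) u =
      (\<Sum>i<3. dir_deriv Y (z Z i) u *\<^sub>R v i ?q +
        z Z i u *\<^sub>R (\<Sum>j<3. z Y j u *\<^sub>R (dir_deriv (V j) (v i) ?q + \<Gamma> (\<pi> ?q) (v j ?q) (v i ?q))))"
    by (simp add: cov_deriv_along_def sum.distrib scaleR_add_right)
  have sub: "subspace {w. frame_coord v ?q 3 w = 0}"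
    using linear_frame_coord[OF frame_v q, of 3] by (intro linear_subspace_kernel) simp
  define G where "G j i = dir_deriv (V j) (v i) ?q + \<Gamma> (\<pi> ?q) (v j ?q) (v i ?q)" for i j
  have G: "frame_coord v ?q 3 (G j i) = 0" if "i < 3" "j < 3" for i j
    unfolding G_def using geo[OF q that(2,1)] .
  have "cov_deriv_along \<Gamma> ?\<phi> Y (dir_deriv Z ?\<phi>) u \<in> {w. frame_coord v ?q 3 w = 0}"
    unfolding eq G_def[symmetric] using G
    by (intro subspace_sum[OF sub] subspace_add[OF sub] subspace_scale[OF sub]) (auto simp: frame_coord_v[OF q])
  then show "cov_deriv_along \<Gamma> ?\<phi> Y (dir_deriv Z ?\<phi>) u \<in> range (frechet_derivative ?\<phi> (at u))"
    using range_pi_slice[OF q] by simp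
qed

end

section \<open>Rational normal curves\<close>

lemma smooth_on_power:
  fixes f :: "'a::euclidean_space \<Rightarrow> real"
  shows "open S \<Longrightarrow> smooth_on S f \<Longrightarrow> smooth_on S (\<lambda>x. f x ^ n)"
  by (induction n) (simp_all add: smooth_on_mult)

lemma rational_normal_eq:
  "rational_normal E s y = E 0 y + s *\<^sub>R E 1 y + s\<^sup>2 *\<^sub>R E 2 y + s ^ 3 *\<^sub>R E 3 y"
  by (simp add: rational_normal_def sum_lessThan_4)

definition rational_tangent :: "(nat \<Rightarrow> real^4 \<Rightarrow> real^4) \<Rightarrow> real \<Rightarrow> real^4 \<Rightarrow> real^4" where
  "rational_tangent E s y = E 1 y + (2 * s) *\<^sub>R E 2 y + (3 * s\<^sup>2) *\<^sub>R E 3 y"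

lemma vector_derivative_rational_normal:
  "vector_derivative (\<lambda>s. rational_normal E s y) (at s) = rational_tangent E s y"
proof (rule vector_derivative_at)
  show "((\<lambda>s. rational_normal E s y) has_vector_derivative rational_tangent E s y) (at s)"
    unfolding rational_normal_eq rational_tangent_def
    by (auto intro!: derivative_eq_intros simp: algebra_simps)
qed

context fourth_order_ode
begin

lemma frame_on_compose_pi:
  assumes "\<And>i. i < 4 \<Longrightarrow> smooth_on (\<pi> ` U) (E i)" and "\<And>y. y \<in> \<pi> ` U \<Longrightarrow> span ((\<lambda>i. E i y) ` {..<4}) = UNIV"
  shows "frame_on U (\<lambda>i p. E i (\<pi> p))"
  unfolding frame_on_def using assms smooth_on_compose[OF open_U subset_refl smooth_pi] by blast

text \<open>Two sources of variation: the parameter moves along the curve, with velocity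
  \<open>rational_tangent\<close>, and the frame \<open>E\<close> moves with the base point.\<close>

lemma dir_deriv_rational_normal:
  assumes E: "\<And>i. i < 4 \<Longrightarrow> smooth_on (\<pi> ` U) (E i)" and s: "smooth_on U s" and p: "p \<in> U"
  shows "dir_deriv Y (\<lambda>q. rational_normal E (s q) (\<pi> q)) p =
    dir_deriv Y s p *\<^sub>R rational_tangent E (s p) (\<pi> p)
      + dir_deriv (\<lambda>_. dir_deriv Y \<pi> p) (rational_normal E (s p)) (\<pi> p)"
proof -
  let ?y' = "dir_deriv Y \<pi> p"
  have E': "E i differentiable (at (\<pi> p))" if "i < 4" for i
    using E[OF that] p by (auto intro: smooth_on_imp_differentiable)
  have sE: "smooth_on U (\<lambda>q. E i (\<pi> q))" if "i < 4" for i
    by (rule smooth_on_compose[OF open_U subset_refl smooth_pi E[OF that]])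
  have DE: "dir_deriv Y (\<lambda>q. E i (\<pi> q)) p = dir_deriv (\<lambda>_. ?y') (E i) (\<pi> p)" if "i < 4" for i
    using dir_deriv_compose[OF differentiable[OF smooth_pi p] E'[OF that]] by (simp add: dir_deriv_def)
  note df = differentiable[OF _ p]
  note sm = sE s smooth_on_mult[OF open_U] smooth_on_scaleR[OF open_U] smooth_on_add[OF open_U]
  have 1: "dir_deriv Y (\<lambda>q. rational_normal E (s q) (\<pi> q)) p =
      dir_deriv Y (\<lambda>q. E 0 (\<pi> q) + s q *\<^sub>R E 1 (\<pi> q) + (s q * s q) *\<^sub>R E 2 (\<pi> q) + (s q * (s q * s q)) *\<^sub>R E 3 (\<pi> q)) p"
    by (simp add: rational_normal_eq power2_eq_square power3_eq_cube mult.assoc)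
  have 2: "dir_deriv (\<lambda>_. ?y') (rational_normal E (s p)) (\<pi> p) =
      dir_deriv (\<lambda>_. ?y') (\<lambda>y. E 0 y + s p *\<^sub>R E 1 y + (s p * s p) *\<^sub>R E 2 y + (s p * (s p * s p)) *\<^sub>R E 3 y) (\<pi> p)"
    by (simp add: rational_normal_eq[abs_def] power2_eq_square power3_eq_cube mult.assoc)
  have 3: "dir_deriv (\<lambda>_. ?y') (\<lambda>y. E 0 y + s p *\<^sub>R E 1 y + (s p * s p) *\<^sub>R E 2 y + (s p * (s p * s p)) *\<^sub>R E 3 y) (\<pi> p) =
     dir_deriv (\<lambda>_. ?y') (E 0) (\<pi> p) + s p *\<^sub>R dir_deriv (\<lambda>_. ?y') (E 1) (\<pi> p) + (s p * s p) *\<^sub>R dir_deriv (\<lambda>_. ?y') (E 2) (\<pi> p)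
     + (s p * (s p * s p)) *\<^sub>R dir_deriv (\<lambda>_. ?y') (E 3) (\<pi> p)"
    using E' by (simp add: dir_deriv_add dir_deriv_scaleR)
  have 4: "dir_deriv Y (\<lambda>q. E 0 (\<pi> q) + s q *\<^sub>R E 1 (\<pi> q) + (s q * s q) *\<^sub>R E 2 (\<pi> q) + (s q * (s q * s q)) *\<^sub>R E 3 (\<pi> q)) p =
    dir_deriv (\<lambda>_. ?y') (E 0) (\<pi> p) + (dir_deriv Y s p *\<^sub>R E 1 (\<pi> p) + s p *\<^sub>R dir_deriv (\<lambda>_. ?y') (E 1) (\<pi> p))
    + ((2 * s p * dir_deriv Y s p) *\<^sub>R E 2 (\<pi> p) + (s p * s p) *\<^sub>R dir_deriv (\<lambda>_. ?y') (E 2) (\<pi> p))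
    + ((3 * s p * s p * dir_deriv Y s p) *\<^sub>R E 3 (\<pi> p) + (s p * (s p * s p)) *\<^sub>R dir_deriv (\<lambda>_. ?y') (E 3) (\<pi> p))"
    using sm by (simp add: dir_deriv_add dir_deriv_scaleR dir_deriv_mult df DE algebra_simps)
  show ?thesis
    unfolding 1 2 3 4 by (simp add: rational_tangent_def power2_eq_square algebra_simps)
qed

text \<open>\<open>canonical_frame\<close> gives a parameter at each point without any regularity.
  The frame coordinates of \<open>v 0\<close> are \<open>a\<close>, \<open>a s\<close>,
  \<open>a s^2\<close>, \<open>a s^3\<close>, so \<open>s\<close> is a quotient of the first two and
  therefore smooth.\<close>

lemma canonical_frame_param:
  assumes cf: "canonical_frame F U \<pi> E"
  obtains m s where "smooth_on U m" and "smooth_on U s" and "\<And>p. p \<in> U \<Longrightarrow> m p \<noteq> 0"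
    and "\<And>p. p \<in> U \<Longrightarrow> v 0 p = m p *\<^sub>R rational_normal E (s p) (\<pi> p)"
proof -
  have E: "\<And>i. i < 4 \<Longrightarrow> smooth_on (\<pi> ` U) (E i)" and sp: "\<And>y. y \<in> \<pi> ` U \<Longrightarrow> span ((\<lambda>i. E i y) ` {..<4}) = UNIV"
    using cf by (auto simp: canonical_frame_def)
  define E' where "E' i p = E i (\<pi> p)" for i p
  have fr: "frame_on U E'" unfolding E'_def using E sp by (rule frame_on_compose_pi)
  define c where "c k p = frame_coord E' p k (v 0 p)" for k p
  have c: "smooth_on U (c k)" for k unfolding c_def by (rule smooth_on_frame_coord[OF open_U fr smooth_v])
  have ex: "\<exists>a s. v 0 p = a *\<^sub>R rational_normal E s (\<pi> p)" if p: "p \<in> U" for p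
  proof -
    obtain s where "frechet_derivative \<pi> (at p) (coord_field 3 p) \<in> span {rational_normal E s (\<pi> p)}"
      using cf p unfolding canonical_frame_def by blast
    then obtain a where "frechet_derivative \<pi> (at p) (coord_field 3 p) = a *\<^sub>R rational_normal E s (\<pi> p)"
      by (auto simp: span_singleton)
    then have "v 0 p = (g p * a) *\<^sub>R rational_normal E s (\<pi> p)"
      using linear_pi[OF p] by (simp add: v_def dir_deriv_def V_0 linear_cmul)
    then show ?thesis by blast
  qed
  have key: "c 0 p \<noteq> 0 \<and> v 0 p = c 0 p *\<^sub>R rational_normal E (c 1 p / c 0 p) (\<pi> p)" if p: "p \<in> U" for p
  proof -
    obtain a s where as: "v 0 p = a *\<^sub>R rational_normal E s (\<pi> p)" using ex[OF p] by blast
    then have "v 0 p = (\<Sum>i<4. (a * s ^ i) *\<^sub>R E' i p)"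
      by (simp add: rational_normal_def E'_def scaleR_sum_right)
    from frame_coord_unique[OF fr p this] have ci: "c i p = a * s ^ i" if "i < 4" for i
      using that by (simp add: c_def)
    have "v 0 p \<noteq> 0"
      using frame_coord_v[OF p, of 0 0] linear_0[OF linear_frame_coord[OF frame_v p, of 0]] by auto
    then have "a \<noteq> 0" using as by auto
    then show ?thesis using ci[of 0] ci[of 1] as by simp
  qed
  show thesis
  proof
    show "smooth_on U (c 0)" by (rule c)
    show "smooth_on U (\<lambda>p. c 1 p / c 0 p)" using key by (intro smooth_on_divide open_U c) auto
  qed (use key in auto)
qed

text \<open>Moving along a solution traces the cone over one point of the solution space, so
  \<open>v 0\<close> and its derivative \<open>v 1\<close> span the osculating plane at the
  parameter \<open>s\<close>, the plane in which \<open>paraconformal_connection\<close> keeps the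
  derivative.\<close>

lemma paraconformal_imp:
  assumes cf: "canonical_frame F U \<pi> E" and pc: "paraconformal_connection E (\<pi> ` U) \<Gamma>" and p: "p \<in> U"
  shows "dir_deriv Y (v 0) p + \<Gamma> (\<pi> p) (dir_deriv Y \<pi> p) (v 0 p) \<in> span {v 0 p, v 1 p}"
proof -
  obtain m s where m: "smooth_on U m" and s: "smooth_on U s" and nz: "\<And>p. p \<in> U \<Longrightarrow> m p \<noteq> 0"
    and v0: "\<And>p. p \<in> U \<Longrightarrow> v 0 p = m p *\<^sub>R rational_normal E (s p) (\<pi> p)"
    using canonical_frame_param[OF cf] by blast
  have E: "\<And>i. i < 4 \<Longrightarrow> smooth_on (\<pi> ` U) (E i)" using cf by (auto simp: canonical_frame_def)
  have lin: "linear (\<Gamma> (\<pi> p) x)" for x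
    using pc p by (auto simp: paraconformal_connection_def connection_on_def bilinear_def)
  let ?R = "rational_normal E (s p) (\<pi> p)" and ?R' = "rational_tangent E (s p) (\<pi> p)"
  have Rs: "smooth_on U (\<lambda>q. rational_normal E (s q) (\<pi> q))"
    unfolding rational_normal_def
    by (intro smooth_on_sum open_U smooth_on_scaleR smooth_on_compose[OF open_U subset_refl smooth_pi E] smooth_on_power s) auto
  have D: "dir_deriv Y (v 0) p = dir_deriv Y m p *\<^sub>R ?R + (m p * dir_deriv Y s p) *\<^sub>R ?R'
      + m p *\<^sub>R dir_deriv (\<lambda>_. dir_deriv Y \<pi> p) (rational_normal E (s p)) (\<pi> p)" for Y
  proof -
    have "dir_deriv Y (v 0) p = dir_deriv Y (\<lambda>q. m q *\<^sub>R rational_normal E (s q) (\<pi> q)) p"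
      by (intro dir_deriv_cong[OF open_U p] v0)
    then show ?thesis
      using dir_deriv_scaleR[OF differentiable[OF m p] differentiable[OF Rs p], of Y] dir_deriv_rational_normal[where Y=Y, OF E s p]
      by (simp add: algebra_simps)
  qed
  let ?N = "dir_deriv (\<lambda>_. dir_deriv Y \<pi> p) (rational_normal E (s p)) (\<pi> p) + \<Gamma> (\<pi> p) (dir_deriv Y \<pi> p) ?R"
  have "?N \<in> span {?R, ?R'}"
    using pc p unfolding paraconformal_connection_def cov_deriv_def vector_derivative_rational_normal
    by (auto dest!: spec[of _ "\<lambda>_. dir_deriv Y \<pi> p"])
  then obtain a b where ab: "?N = a *\<^sub>R ?R + b *\<^sub>R ?R'"
    by (auto simp: span_insert span_singleton) (metis add.commute diff_add_cancel)
  have lhs: "dir_deriv Y (v 0) p + \<Gamma> (\<pi> p) (dir_deriv Y \<pi> p) (v 0 p) =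
      dir_deriv Y m p *\<^sub>R ?R + (m p * dir_deriv Y s p) *\<^sub>R ?R' + m p *\<^sub>R ?N"
    unfolding D by (simp add: v0[OF p] linear_cmul[OF lin] algebra_simps)
  have v1: "v 1 p = dir_deriv X m p *\<^sub>R ?R + (m p * dir_deriv X s p) *\<^sub>R ?R'"
  proof -
    have "rational_normal E (s p) differentiable (at (\<pi> p))"
      unfolding rational_normal_def[abs_def]
      using smooth_on_imp_differentiable[OF E] p by (intro differentiable_sum) auto
    from linear_0[OF linear_frechet_derivative[OF this]] have "dir_deriv (\<lambda>_. dir_deriv X \<pi> p) (rational_normal E (s p)) (\<pi> p) = 0"
      unfolding dir_deriv_X_pi[OF p] by (simp add: dir_deriv_def)
    then show ?thesis using D[of X] dir_deriv_X_v[OF p, of 0] by simp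
  qed
  have R: "?R \<in> span {v 0 p, v 1 p}"
  proof -
    have "?R = (1 / m p) *\<^sub>R v 0 p" using v0[OF p] nz[OF p] by simp
    then show ?thesis by (simp add: span_mul span_base)
  qed
  \<comment> \<open>The parameter moves along each solution, for otherwise \<open>v 1\<close> would
    be a multiple of \<open>v 0\<close>.\<close>
  have "dir_deriv X s p \<noteq> 0"
  proof
    assume "dir_deriv X s p = 0"
    then have "v 1 p = (dir_deriv X m p / m p) *\<^sub>R v 0 p"
      using v1 v0[OF p] nz[OF p] by simp
    then have "frame_coord v p 1 (v 1 p) = (dir_deriv X m p / m p) * frame_coord v p 1 (v 0 p)"
      using linear_cmul[OF linear_frame_coord[OF frame_v p, of 1]] by simp
    then show False using frame_coord_v[OF p, of 1 1] frame_coord_v[OF p, of 0 1] by simp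
  qed
  then have "?R' = (1 / (m p * dir_deriv X s p)) *\<^sub>R (v 1 p - dir_deriv X m p *\<^sub>R ?R)"
    using v1 nz[OF p] by simp
  also have "\<dots> \<in> span {v 0 p, v 1 p}"
    using R by (intro span_mul span_diff) (auto intro: span_base)
  finally have R': "?R' \<in> span {v 0 p, v 1 p}" .
  show ?thesis
    unfolding lhs ab using R R' by (intro span_add span_mul) auto
qed

section \<open>Flow boxes\<close>

text \<open>A neighbourhood in which all solutions over \<open>N\<close> are parametrized by the
  same interval of \<open>t\<close>. Smoothness is required of the section \<open>t = t0\<close>: a
  function constant along solutions is recovered from its values there.\<close>

definition flow_box :: "jet set \<Rightarrow> (real^4) set \<Rightarrow> real set \<Rightarrow> real \<Rightarrow> (real^4 \<Rightarrow> real \<Rightarrow> jet) \<Rightarrow> bool" where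
  "flow_box W N I t0 \<gamma> \<longleftrightarrow> open W \<and> W \<subseteq> U \<and> open N \<and> open I \<and> convex I \<and> t0 \<in> I \<and>
     (\<forall>y\<in>N. \<forall>t\<in>I. \<gamma> y t \<in> W \<and> \<pi> (\<gamma> y t) = y \<and> \<gamma> y t $ 4 = t \<and>
        (\<gamma> y has_vector_derivative X (\<gamma> y t)) (at t)) \<and>
     (\<forall>p\<in>W. \<pi> p \<in> N \<and> p $ 4 \<in> I \<and> \<gamma> (\<pi> p) (p $ 4) = p) \<and>
     smooth_on N (\<lambda>y. \<gamma> y t0)"

lemma flow_box_exists:
  assumes p0: "p0 \<in> U"
  obtains W N I t0 \<gamma> where "flow_box W N I t0 \<gamma>" and "p0 \<in> W"
proof -
  \<comment> \<open>\<open>inverse_function_theorem\<close> is about maps of a space to itself, so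
    the target of (\<pi>, t) is identified with the jet space.\<close>
  have "DIM((real^4) \<times> real) = DIM(jet)" by simp
  then obtain L :: "(real^4) \<times> real \<Rightarrow> jet" and M where L: "linear L" and M: "linear M"
    and M_L: "\<And>x. M (L x) = x" and L_M: "\<And>x. L (M x) = x"
    by (rule isomorphisms_UNIV_UNIV) metis
  define \<Phi> where "\<Phi> p = L (\<pi> p, p $ 4)" for p
  have pair: "smooth_on U (\<lambda>p. (\<pi> p, p $ 4))"
  proof -
    have "linear (\<lambda>y :: real^4. (y, 0 :: real))" "linear (\<lambda>t :: real. (0 :: real^4, t))"
      by (auto intro!: linearI)
    then have "smooth_on U (\<lambda>p. (\<pi> p, 0) + (0, p $ 4))"
      by (intro smooth_on_add open_U smooth_on_linear_compose[where f="\<lambda>y. (y, 0)"]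
        smooth_on_linear_compose[where f="\<lambda>t. (0, t)"] smooth_pi smooth_on_vec_nth smooth_on_ident)
    then show ?thesis by simp
  qed
  have \<Phi>: "smooth_on U \<Phi>" unfolding \<Phi>_def by (rule smooth_on_linear_compose[OF L open_U pair])
  have d\<Phi>: "frechet_derivative \<Phi> (at p) w = L (frechet_derivative \<pi> (at p) w, w $ 4)" if "p \<in> U" for p w
  proof -
    have "((\<lambda>p. p $ 4) has_derivative (\<lambda>w. w $ 4)) (at p)" for p :: jet
      by (intro bounded_linear_imp_has_derivative bounded_linear_vec_nth)
    then have "((\<lambda>p. (\<pi> p, p $ 4)) has_derivative (\<lambda>w. (frechet_derivative \<pi> (at p) w, w $ 4))) (at p)"
      using smooth_on_has_derivative[OF smooth_pi that] by (intro has_derivative_Pair)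
    then have "(\<Phi> has_derivative (\<lambda>w. L (frechet_derivative \<pi> (at p) w, w $ 4))) (at p)"
      unfolding \<Phi>_def[abs_def] using L
      by (intro bounded_linear.has_derivative[of L]) (simp_all add: linear_conv_bounded_linear)
    then show ?thesis by (simp add: frechet_derivative_eqI)
  qed
  \<comment> \<open>The inverse of the derivative of \<Phi>, written out by
    \<open>tangent_decomposition\<close>; being built from smooth fields it depends smoothly on the
    point.\<close>
  define H where "H u p = snd (M u) *\<^sub>R X p + (\<Sum>i<4. frame_coord v p i (fst (M u)) *\<^sub>R V i p)" for u p
  have H_smooth: "smooth_on U (H u)" for u
    unfolding H_def by (intro smooth_on_add smooth_on_sum smooth_on_scaleR open_U smooth_X smooth_V smooth_on_const smooth_coord)
  have \<Phi>H: "frechet_derivative \<Phi> (at p) (H u p) = u" if "p \<in> U" for u p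
  proof -
    have "frechet_derivative \<pi> (at p) (H u p) = fst (M u)"
      using linear_pi[OF that] pi_V_sum[OF that] frame_coord_expand[OF frame_v that] dir_deriv_X_pi[OF that]
      by (simp add: H_def linear_add linear_cmul dir_deriv_def)
    moreover have "H u p $ 4 = snd (M u)"
      by (simp add: H_def V_nth_4[OF that])
    ultimately show ?thesis by (simp add: d\<Phi>[OF that] L_M)
  qed
  have H\<Phi>: "H (frechet_derivative \<Phi> (at p) w) p = w" if "p \<in> U" for w p
    using tangent_decomposition[OF that, of w] by (simp add: H_def d\<Phi>[OF that] M_L)
  have linH: "linear (\<lambda>u. H u p)" if "p \<in> U" for p
    using linear_frame_coord[OF frame_v that] M
    by (intro linearI) (simp_all add: H_def linear_add linear_cmul sum_lessThan_4 algebra_simps)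
  define \<Phi>' where "\<Phi>' p = Blinfun (frechet_derivative \<Phi> (at p))" for p
  have bl: "bounded_linear (frechet_derivative \<Phi> (at p))" if "p \<in> U" for p
    using has_derivative_bounded_linear[OF smooth_on_has_derivative[OF \<Phi> that]] .
  have \<Phi>'_apply: "blinfun_apply (\<Phi>' p) = frechet_derivative \<Phi> (at p)" if "p \<in> U" for p
    unfolding \<Phi>'_def by (rule bounded_linear_Blinfun_apply[OF bl[OF that]])
  have cont: "continuous_on U \<Phi>'"
  proof (rule continuous_on_blinfun_componentwise)
    fix b :: jet
    have "continuous_on U (\<lambda>p. frechet_derivative \<Phi> (at p) b)"
      using smooth_on_frechet[OF \<Phi>, of b] by (metis Ck_on.simps(1) smooth_on_def)
    then show "continuous_on U (\<lambda>p. blinfun_apply (\<Phi>' p) b)"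
      by (rule continuous_on_eq) (simp add: \<Phi>'_apply)
  qed
  have inv: "Blinfun (\<lambda>u. H u p0) o\<^sub>L \<Phi>' p0 = id_blinfun"
    using linH[OF p0] by (intro blinfun_eqI)
      (simp add: bounded_linear_Blinfun_apply linear_conv_bounded_linear \<Phi>'_apply[OF p0] H\<Phi>[OF p0])
  have der\<Phi>: "(\<Phi> has_derivative blinfun_apply (\<Phi>' p)) (at p)" if "p \<in> U" for p
    unfolding \<Phi>'_apply[OF that] by (rule smooth_on_has_derivative[OF \<Phi> that])
  obtain U' V' G G' where U': "open U'" "U' \<subseteq> U" "p0 \<in> U'" and V': "open V'" "\<Phi> p0 \<in> V'"
    and hom: "homeomorphism U' V' \<Phi> G"
    and G: "\<And>z. z \<in> V' \<Longrightarrow> (G has_derivative G' z) (at z)"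
    and G': "\<And>z. z \<in> V' \<Longrightarrow> G' z = Hilbert_Choice.inv (blinfun_apply (\<Phi>' (G z)))"
    and bij: "\<And>z. z \<in> V' \<Longrightarrow> bij (blinfun_apply (\<Phi>' (G z)))"
    by (rule inverse_function_theorem[OF open_U der\<Phi> cont p0 inv], assumption) (rule that)
  have GU: "G z \<in> U'" and \<Phi>G: "\<Phi> (G z) = z" if "z \<in> V'" for z
    using hom that by (auto simp: homeomorphism_def)
  have G\<Phi>: "G (\<Phi> p) = p" and \<Phi>V: "\<Phi> p \<in> V'" if "p \<in> U'" for p
    using hom that by (auto simp: homeomorphism_def)
  have G'_eq: "G' z u = H u (G z)" if "z \<in> V'" for z u
  proof -
    have q: "G z \<in> U" using GU[OF that] U' by blast
    have "blinfun_apply (\<Phi>' (G z)) (H u (G z)) = u" by (simp add: \<Phi>'_apply[OF q] \<Phi>H[OF q])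
    then show ?thesis unfolding G'[OF that] using bij[OF that] by (metis bij_inv_eq_iff)
  qed
  \<comment> \<open>Bootstrapping: the derivatives of \<open>G\<close> are \<open>H u\<close>
    composed with \<open>G\<close>, so \<open>G\<close> gains one degree of smoothness at each
    step.\<close>
  have "Ck_on k V' G" for k
  proof (induction k)
    case 0
    show ?case using hom by (simp add: homeomorphism_def)
  next
    case (Suc k)
    show ?case
    proof (rule Ck_on_SucI)
      show "G differentiable (at z)" if "z \<in> V'" for z using G[OF that] by (auto simp: differentiable_def)
      fix u
      have "Ck_on k V' (\<lambda>z. H u (G z))"
        using GU U' H_smooth by (intro Ck_on_compose[OF V'(1) _ Suc.IH, where T=U]) (auto simp: smooth_on_def)
      then show "Ck_on k V' (\<lambda>z. frechet_derivative G (at z) u)"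
        by (rule Ck_on_eqI[OF _ V'(1)]) (simp add: frechet_derivative_eqI[OF G] G'_eq)
    qed
  qed
  then have G_smooth: "smooth_on V' G" by (simp add: smooth_on_def)
  have "continuous_on UNIV L" using L linear_continuous_on linear_linear by blast
  then have "open (L -` V')" by (rule open_vimage[OF V'(1)])
  moreover have "(\<pi> p0, p0 $ 4) \<in> L -` V'" using V'(2) by (simp add: \<Phi>_def)
  ultimately obtain N B where N: "open N" "\<pi> p0 \<in> N" and B: "open B" "p0 $ 4 \<in> B" and NB: "N \<times> B \<subseteq> L -` V'"
    by (auto elim!: open_prod_elim)
  obtain e where e: "e > 0" "ball (p0 $ 4) e \<subseteq> B" using B by (meson openE)
  define I where "I = ball (p0 $ 4) e"
  define \<gamma> where "\<gamma> y t = G (L (y, t))" for y t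
  define W where "W = {p \<in> U'. \<pi> p \<in> N \<and> p $ 4 \<in> I}"
  have NI: "L (y, t) \<in> V'" if "y \<in> N" "t \<in> I" for y t
  proof -
    have "t \<in> B" using e(2) that(2) unfolding I_def by blast
    then show ?thesis using NB that(1) by blast
  qed
  have inW: "\<gamma> y t \<in> U'" "\<pi> (\<gamma> y t) = y" "\<gamma> y t $ 4 = t" if "y \<in> N" "t \<in> I" for y t
  proof -
    show "\<gamma> y t \<in> U'" unfolding \<gamma>_def by (rule GU[OF NI[OF that]])
    have "M (\<Phi> (\<gamma> y t)) = M (L (y, t))" unfolding \<gamma>_def by (simp add: \<Phi>G[OF NI[OF that]])
    then show "\<pi> (\<gamma> y t) = y" "\<gamma> y t $ 4 = t" by (simp_all add: \<Phi>_def M_L)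
  qed
  have \<gamma>': "(\<gamma> y has_vector_derivative X (\<gamma> y t)) (at t)" if "y \<in> N" "t \<in> I" for y t
  proof -
    have q: "\<gamma> y t \<in> U" using inW[OF that] U' by blast
    have "((\<lambda>t. (y, t)) has_derivative (\<lambda>h. (0, h))) (at t)"
      by (intro has_derivative_Pair has_derivative_const has_derivative_ident)
    then have "((\<lambda>t. L (y, t)) has_derivative (\<lambda>h. L (0, h))) (at t)"
      using L by (intro bounded_linear.has_derivative[of L]) (simp_all add: linear_conv_bounded_linear)
    from has_derivative_compose[OF this, of G "G' (L (y, t))"] G[OF NI[OF that]]
    have "(\<gamma> y has_derivative (\<lambda>h. G' (L (y, t)) (L (0, h)))) (at t)"
      by (simp add: \<gamma>_def[abs_def])
    moreover have "G' (L (y, t)) (L (0, h)) = h *\<^sub>R X (\<gamma> y t)" for h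
      unfolding G'_eq[OF NI[OF that]] using linear_0[OF linear_frame_coord[OF frame_v q]]
      by (simp add: H_def M_L \<gamma>_def)
    ultimately show ?thesis by (simp add: has_vector_derivative_def)
  qed
  have "open W"
  proof -
    have "continuous_on U' (\<lambda>p. (\<pi> p, p $ 4))"
      using smooth_on_subset[OF pair U'(2)] by (metis Ck_on.simps(1) smooth_on_def)
    then have "open ((\<lambda>p. (\<pi> p, p $ 4)) -` (N \<times> I) \<inter> U')"
      using U' N by (subst (asm) continuous_on_open_vimage) (auto simp: I_def open_Times)
    also have "(\<lambda>p. (\<pi> p, p $ 4)) -` (N \<times> I) \<inter> U' = W" by (auto simp: W_def)
    finally show ?thesis .
  qed
  have "smooth_on N (\<lambda>y. \<gamma> y (p0 $ 4))"
  proof -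
    have "linear (\<lambda>y. L (y, 0))"
      using L by (intro linearI) (simp_all flip: linear_add linear_cmul)
    then have "smooth_on N (\<lambda>y. L (y, 0) + L (0, p0 $ 4))"
      by (intro smooth_on_add N smooth_on_linear smooth_on_const)
    moreover have "L (y, 0) + L (0, p0 $ 4) = L (y, p0 $ 4)" for y
      using linear_add[OF L, of "(y, 0)" "(0, p0 $ 4)"] by simp
    ultimately have "smooth_on N (\<lambda>y. L (y, p0 $ 4))" by simp
    then show ?thesis
      unfolding \<gamma>_def using NI e by (intro smooth_on_compose[OF N(1) _ _ G_smooth]) (auto simp: I_def)
  qed
  then have "flow_box W N I (p0 $ 4) \<gamma>"
    unfolding flow_box_def using \<open>open W\<close> U' N e inW \<gamma>' G\<Phi>
    by (auto simp: W_def I_def) (simp add: \<gamma>_def \<Phi>_def[symmetric] G\<Phi>)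
  moreover have "p0 \<in> W" using U' N e by (simp add: W_def I_def)
  ultimately show thesis by (rule that)
qed

lemma flow_box_image:
  assumes "flow_box W N I t0 \<gamma>"
  shows "\<pi> ` W = N"
  using assms unfolding flow_box_def by force

lemma flow_box_has_vector_derivative:
  assumes fb: "flow_box W N I t0 \<gamma>" and f: "\<And>p. p \<in> W \<Longrightarrow> f differentiable (at p)" and "y \<in> N" "t \<in> I"
  shows "((\<lambda>t. f (\<gamma> y t)) has_vector_derivative dir_deriv X f (\<gamma> y t)) (at t)"
proof -
  have \<gamma>: "\<gamma> y t \<in> W" "(\<gamma> y has_derivative (\<lambda>h. h *\<^sub>R X (\<gamma> y t))) (at t)"
    using fb assms(3,4) by (auto simp: flow_box_def has_vector_derivative_def)
  have lin: "linear (frechet_derivative f (at (\<gamma> y t)))" by (rule linear_frechet_derivative[OF f[OF \<gamma>(1)]])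
  have "((\<lambda>t. f (\<gamma> y t)) has_derivative (\<lambda>h. frechet_derivative f (at (\<gamma> y t)) (h *\<^sub>R X (\<gamma> y t)))) (at t)"
    by (rule has_derivative_compose[OF \<gamma>(2) differentiable_imp_has_derivative[OF f[OF \<gamma>(1)]]])
  then show ?thesis by (simp add: has_vector_derivative_def dir_deriv_def linear_cmul[OF lin])
qed

lemma flow_box_constant:
  assumes fb: "flow_box W N I t0 \<gamma>" and f: "\<And>p. p \<in> W \<Longrightarrow> f differentiable (at p)"
    and 0: "\<And>p. p \<in> W \<Longrightarrow> dir_deriv X f p = 0" and p: "p \<in> W"
  shows "f p = f (\<gamma> (\<pi> p) t0)"
proof -
  have I: "convex I" "t0 \<in> I" and y: "\<pi> p \<in> N" "p $ 4 \<in> I" "\<gamma> (\<pi> p) (p $ 4) = p"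
    using fb p by (auto simp: flow_box_def)
  have "((\<lambda>t. f (\<gamma> (\<pi> p) t)) has_derivative (\<lambda>h. 0)) (at t within I)" if "t \<in> I" for t
  proof -
    have "\<gamma> (\<pi> p) t \<in> W" using fb y that by (auto simp: flow_box_def)
    from 0[OF this] flow_box_has_vector_derivative[OF fb f y(1) that] show ?thesis
      by (simp add: has_vector_derivative_def has_derivative_at_withinI)
  qed
  then obtain c where "\<forall>t\<in>I. f (\<gamma> (\<pi> p) t) = c" using has_derivative_zero_constant[OF I(1)] by blast
  then show ?thesis using I(2) y(2,3) by metis
qed

lemma flow_box_solution_space:
  assumes fb: "flow_box W N I t0 \<gamma>"
  shows "solution_space F W \<pi>"
  unfolding solution_space_def
proof (intro conjI ballI allI)
  show "open W" using fb by (simp add: flow_box_def)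
  show "smooth_on W \<pi>" using fb by (auto simp: flow_box_def intro: smooth_on_subset[OF smooth_pi])
  show "{v. frechet_derivative \<pi> (at p) v = 0} = span {total_deriv F p}" if "p \<in> W" for p
    using fb that by (intro kernel) (auto simp: flow_box_def)
  show "connected {p \<in> W. \<pi> p = y}" for y
  proof (cases "y \<in> N")
    case True
    have "{p \<in> W. \<pi> p = y} = \<gamma> y ` I"
    proof (intro equalityI subsetI)
      fix p assume "p \<in> {p \<in> W. \<pi> p = y}"
      then have "p = \<gamma> y (p $ 4)" "p $ 4 \<in> I" using fb by (auto simp: flow_box_def)
      then show "p \<in> \<gamma> y ` I" by blast
    qed (use fb True in \<open>auto simp: flow_box_def\<close>)
    moreover have "continuous_on I (\<gamma> y)"
      using fb True unfolding flow_box_def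
      by (intro continuous_at_imp_continuous_on) (auto intro: has_vector_derivative_continuous)
    moreover have "connected I" using fb by (auto simp: flow_box_def intro: convex_connected)
    ultimately show ?thesis by (metis connected_continuous_image)
  next
    case False
    then have empty: "{p \<in> W. \<pi> p = y} = {}" using fb by (auto simp: flow_box_def)
    show ?thesis unfolding empty by simp
  qed
qed

end

section \<open>Construction of the connection\<close>

locale geodesic_ode = bw_ode +
  assumes main: "q \<in> U \<Longrightarrow> 4 * DK2 1 0 q + 3 * DK2 0 1 q = 0"
begin

text \<open>A 1-form that vanishes on \<open>X\<close> is given by its values on \<open>V 0\<close>
  to \<open>V 3\<close>. Its value on \<open>V 4\<close> is forced by the relation for
  \<open>V 4\<close>, and the Lie derivative at \<open>V 3\<close> refers to it.\<close>

definition extend :: "(nat \<Rightarrow> jet \<Rightarrow> real) \<Rightarrow> nat \<Rightarrow> jet \<Rightarrow> real" where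
  "extend b i p = (if i < 4 then b i p else - K0 p * b 0 p + K1 p * b 1 p - K2 p * b 2 p)"

text \<open>
  The values on the fields \<open>V i\<close> of the iterated Lie derivatives along \<open>X\<close> of the 1-form \<open>\<beta>\<close>
  that occurs in \<open>\<nabla> (v 0) = \<alpha> v 0 + \<beta> v 1\<close>. Total geodesy forces \<open>\<beta>\<close> to vanish on \<open>V 0\<close>, \<open>V 1\<close>, \<open>V 2\<close>,
  and comparing the two expressions for \<open>\<nabla> (v 4)\<close> determines \<open>\<beta> (V 3)\<close> and \<open>\<alpha> = - 3/2 \<beta>'\<close>.
\<close>

primrec beta :: "nat \<Rightarrow> nat \<Rightarrow> jet \<Rightarrow> real" where
  "beta 0 = (\<lambda>i p. if i = 3 then - DK2 0 0 p / 5 else 0)"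
| "beta (Suc m) = extend (\<lambda>i p. dir_deriv X (beta m i) p - beta m (Suc i) p)"

lemma smooth_beta: "smooth_on U (beta m i)"
proof (induction m arbitrary: i)
  case 0
  have "smooth_on U (\<lambda>p. - DK2 0 0 p / 5)"
    by (intro smooth_on_divide smooth_on_minus open_U smooth_DK2 smooth_on_const) simp
  then show ?case by (cases "i = 3") simp_all
next
  case (Suc m)
  have *: "smooth_on U (\<lambda>p. dir_deriv X (beta m i) p - beta m (Suc i) p)" for i
    by (intro smooth_on_diff open_U smooth_dir_deriv_X Suc.IH)
  have "smooth_on U (\<lambda>p. - K0 p * (dir_deriv X (beta m 0) p - beta m (Suc 0) p)
      + K1 p * (dir_deriv X (beta m 1) p - beta m (Suc 1) p) - K2 p * (dir_deriv X (beta m 2) p - beta m (Suc 2) p))"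
    by (intro smooth_on_add smooth_on_diff smooth_on_mult smooth_on_minus open_U smooth_K smooth_dir_deriv_X Suc.IH)
  then show ?case using *[of i] by (cases "i < 4") (simp_all add: extend_def[abs_def])
qed

text \<open>At \<open>m = 0\<close> both sides vanish: the form is zero on \<open>V 0\<close>,
  \<open>V 1\<close>, \<open>V 2\<close>, so the default value 0 at index 4 is the right
  one.\<close>

lemma beta_4: "beta m 4 p = - K0 p * beta m 0 p + K1 p * beta m 1 p - K2 p * beta m 2 p"
  by (cases m) (simp_all add: extend_def)

lemma dir_deriv_X_beta: "i < 4 \<Longrightarrow> dir_deriv X (beta m i) p = beta (Suc m) i p + beta m (Suc i) p"
  by (simp add: extend_def)

lemmas [simp del] = beta.simps(2)

lemma taylor_beta:
  assumes p: "p \<in> U" and i: "i < 4"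
  shows "fps_deriv (taylor X p (beta m i)) = taylor X p (beta (Suc m) i) + taylor X p (beta m (Suc i))"
proof -
  have "taylor X p (dir_deriv X (beta m i)) = taylor X p (\<lambda>q. beta (Suc m) i q + beta m (Suc i) q)"
    by (intro taylor_cong[OF open_U p] dir_deriv_X_beta i)
  then show ?thesis
    unfolding taylor_dir_deriv using taylor_add[OF open_U p smooth_X smooth_beta smooth_beta] by simp
qed

lemma taylor_combination:
  assumes p: "p \<in> U" and sm: "smooth_on U a" "smooth_on U b" "smooth_on U c"
  shows "taylor X p (\<lambda>q. - K0 q * a q + K1 q * b q - K2 q * c q) =
    - taylor X p K0 * taylor X p a + taylor X p K1 * taylor X p b - taylor X p K2 * taylor X p c"
proof -
  note sms = sm smooth_K smooth_on_mult[OF open_U] smooth_on_add[OF open_U] smooth_on_diff[OF open_U] smooth_on_minus[OF open_U]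
  show ?thesis
    by (simp add: taylor_add[OF open_U p smooth_X] taylor_diff[OF open_U p smooth_X] taylor_minus[OF open_U p smooth_X]
      taylor_mult[OF open_U p smooth_X] sms)
qed

lemma taylor_beta_4:
  "p \<in> U \<Longrightarrow> taylor X p (beta m 4) =
    - taylor X p K0 * taylor X p (beta m 0) + taylor X p K1 * taylor X p (beta m 1) - taylor X p K2 * taylor X p (beta m 2)"
  using taylor_combination[OF _ smooth_beta smooth_beta smooth_beta] by (simp add: beta_4[abs_def])

lemma taylor_DK2_4:
  assumes p: "p \<in> U"
  shows "taylor X p (DK2 4 j) =
    - taylor X p K0 * taylor X p (DK2 0 j) + taylor X p K1 * taylor X p (DK2 1 j) - taylor X p K2 * taylor X p (DK2 2 j)"
proof -
  have "taylor X p (DK2 4 j) = taylor X p (\<lambda>q. - K0 q * DK2 0 j q + K1 q * DK2 1 j q - K2 q * DK2 2 j q)"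
    unfolding DK2_def
    using dir_deriv_V_4[OF differentiable[OF smooth_on_dir_deriv_funpow[OF open_U smooth_X smooth_K(3)]]]
    by (intro taylor_cong[OF open_U p]) simp
  then show ?thesis using taylor_combination[OF p smooth_DK2 smooth_DK2 smooth_DK2] by simp
qed

definition conn_coeff :: "nat \<Rightarrow> nat \<Rightarrow> nat \<Rightarrow> jet \<Rightarrow> real" where
  "conn_coeff i j k q = connection_coeff (\<lambda>m i. beta m i q) (K0 q) (K1 q) (K2 q) i j k"

lemma smooth_conn_coeff:
  assumes "k < 4"
  shows "smooth_on U (conn_coeff i j k)"
proof -
  note sms = smooth_beta smooth_K smooth_on_const smooth_on_mult[OF open_U] smooth_on_add[OF open_U] smooth_on_diff[OF open_U]
    smooth_on_minus[OF open_U]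
  show ?thesis
    using assms
    by (induction j k rule: connection_coeff_induct)
      (unfold conn_coeff_def[abs_def], simp_all only: connection_coeff_simps, (intro conjI sms)+)
qed

lemma taylor_conn_coeff:
  assumes p: "p \<in> U" and k: "k < 4"
  shows "taylor X p (conn_coeff i j k) =
    connection_coeff (\<lambda>m i. taylor X p (beta m i)) (taylor X p K0) (taylor X p K1) (taylor X p K2) i j k"
proof -
  note sms = smooth_beta smooth_K smooth_on_const smooth_on_mult[OF open_U]
  have n: "taylor X p (\<lambda>q. - numeral n * beta m i q) = - numeral n * taylor X p (beta m i)" for n m
    using taylor_minus[OF open_U p smooth_X smooth_on_mult[OF open_U smooth_on_const smooth_beta]]
      taylor_numeral_mult[OF p smooth_beta] by simp
  have m: "taylor X p (\<lambda>q. 2 * a q * beta m i q) = 2 * taylor X p a * taylor X p (beta m i)" if "smooth_on U a" for a m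
    using taylor_mult[OF open_U p smooth_X smooth_on_mult[OF open_U smooth_on_const that] smooth_beta]
      taylor_numeral_mult[OF p that] by simp
  note ty = n m[OF smooth_K(1)] m[OF smooth_K(2)] m[OF smooth_K(3)] taylor_numeral_mult[OF p smooth_beta]
    taylor_minus[OF open_U p smooth_X smooth_beta]
    taylor_add[OF open_U p smooth_X] taylor_diff[OF open_U p smooth_X]
  show ?thesis
    using k
    by (induction j k rule: connection_coeff_induct)
      (unfold conn_coeff_def[abs_def], simp_all only: connection_coeff_simps ty sms taylor_0)
qed

lemma conn_coeff_4:
  assumes "k < 4"
  shows "conn_coeff 4 j k p = - K0 p * conn_coeff 0 j k p + K1 p * conn_coeff 1 j k p - K2 p * conn_coeff 2 j k p"
  using assms
  by (induction j k rule: connection_coeff_induct)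
    (unfold conn_coeff_def, simp_all only: connection_coeff_simps beta_4, simp_all add: algebra_simps)

text \<open>The identities of power series, read at the constant coefficient. For
  \<open>j = 3\<close> the bracketed terms are twice the coordinates of \<nabla> (v 4) prescribed by
  the relation for \<open>v 4\<close>.\<close>

lemma conn_coeff_recursion:
  assumes p: "p \<in> U" and i: "i < 4"
  shows "j < 3 \<Longrightarrow> dir_deriv X (conn_coeff i j 0) p - K0 p * conn_coeff i j 3 p = conn_coeff (Suc i) j 0 p + conn_coeff i (Suc j) 0 p"
    and "j < 3 \<Longrightarrow> dir_deriv X (conn_coeff i j 1) p + conn_coeff i j 0 p + K1 p * conn_coeff i j 3 p = conn_coeff (Suc i) j 1 p + conn_coeff i (Suc j) 1 p"
    and "j < 3 \<Longrightarrow> dir_deriv X (conn_coeff i j 2) p + conn_coeff i j 1 p - K2 p * conn_coeff i j 3 p = conn_coeff (Suc i) j 2 p + conn_coeff i (Suc j) 2 p"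
    and "j < 3 \<Longrightarrow> dir_deriv X (conn_coeff i j 3) p + conn_coeff i j 2 p = conn_coeff (Suc i) j 3 p + conn_coeff i (Suc j) 3 p"
    and "dir_deriv X (conn_coeff i 3 0) p - K0 p * conn_coeff i 3 3 p = conn_coeff (Suc i) 3 0 p
      + (- K0 p * conn_coeff i 0 0 p + K1 p * conn_coeff i 1 0 p - K2 p * conn_coeff i 2 0 p - 2 * dir_deriv (V i) K0 p)"
    and "dir_deriv X (conn_coeff i 3 1) p + conn_coeff i 3 0 p + K1 p * conn_coeff i 3 3 p = conn_coeff (Suc i) 3 1 p
      + (- K0 p * conn_coeff i 0 1 p + K1 p * conn_coeff i 1 1 p - K2 p * conn_coeff i 2 1 p + 2 * dir_deriv (V i) K1 p)"
    and "dir_deriv X (conn_coeff i 3 2) p + conn_coeff i 3 1 p - K2 p * conn_coeff i 3 3 p = conn_coeff (Suc i) 3 2 p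
      + (- K0 p * conn_coeff i 0 2 p + K1 p * conn_coeff i 1 2 p - K2 p * conn_coeff i 2 2 p - 2 * dir_deriv (V i) K2 p)"
    and "dir_deriv X (conn_coeff i 3 3) p + conn_coeff i 3 2 p = conn_coeff (Suc i) 3 3 p
      + (- K0 p * conn_coeff i 0 3 p + K1 p * conn_coeff i 1 3 p - K2 p * conn_coeff i 2 3 p)"
proof -
  define B where "B m i = taylor X p (beta m i)" for m i
  define z where "z i j = taylor X p (DK2 i j)" for i j
  define c where "c i j k = taylor X p (conn_coeff i j k)" for i j k
  have c: "connection_coeff B (taylor X p K0) (taylor X p K1) (taylor X p K2) i j k = c i j k" if "k < 4" for i j k
    unfolding c_def taylor_conn_coeff[OF p that] B_def ..
  have 1: "fps_deriv (B m i) = B (Suc m) i + B m (Suc i)" if "i < 4" for m i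
    unfolding B_def by (rule taylor_beta[OF p that])
  have 2: "B m 4 = - taylor X p K0 * B m 0 + taylor X p K1 * B m 1 - taylor X p K2 * B m 2" for m
    unfolding B_def by (rule taylor_beta_4[OF p])
  have 3: "B 0 0 = 0" "B 0 1 = 0" "B 0 2 = 0" by (simp_all add: B_def)
  have 4: "5 * B 0 3 = - z 0 0"
  proof -
    have "5 * B 0 3 = taylor X p (\<lambda>q. 5 * beta 0 3 q)"
      unfolding B_def by (rule taylor_numeral_mult[OF p smooth_beta, symmetric])
    also have "\<dots> = - z 0 0"
      unfolding z_def by (simp add: taylor_minus[OF open_U p smooth_X smooth_DK2])
    finally show ?thesis .
  qed
  have 5: "fps_deriv (z i j) = z (Suc i) j + z i (Suc j)" for i j unfolding z_def by (rule taylor_DK2[OF p])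
  have 6: "z 4 j = - taylor X p K0 * z 0 j + taylor X p K1 * z 1 j - taylor X p K2 * z 2 j" for j
    unfolding z_def by (rule taylor_DK2_4[OF p])
  have 7: "100 * taylor X p (dir_deriv (V i) K0) = 30 * z i 2 + 18 * taylor X p K2 * z i 0" for i
    unfolding z_def by (rule taylor_dir_deriv_K0[OF p])
  have 8: "4 * z 1 0 + 3 * z 0 1 = 0" unfolding z_def by (rule taylor_main[OF p main])
  have 9: "10 * z 2 0 + 5 * z 1 1 + 3 * taylor X p K2 * z 0 0 = 0"
    unfolding z_def by (rule DK2_identities(1)[OF p main])
  have 10: "20 * z 3 0 + 5 * z 2 1 + 6 * fps_deriv (taylor X p K2) * z 0 0 - 36 * taylor X p K2 * fps_deriv (z 0 0) = 0"
    unfolding z_def by (rule DK2_identities(2)[OF p main])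
  have c': "connection_coeff B (taylor X p K0) (taylor X p K1) (taylor X p K2) i j 0 = c i j 0"
    "connection_coeff B (taylor X p K0) (taylor X p K1) (taylor X p K2) i j 1 = c i j 1"
    "connection_coeff B (taylor X p K0) (taylor X p K1) (taylor X p K2) i j 2 = c i j 2"
    "connection_coeff B (taylor X p K0) (taylor X p K1) (taylor X p K2) i j 3 = c i j 3" for i j
    by (rule c, simp)+
  note R = connection_coeff_recursion[where B=B and z=z and ?y0.0="\<lambda>i. taylor X p (dir_deriv (V i) K0)"
      and ?K0.0="taylor X p K0" and ?K1.0="taylor X p K1" and ?K2.0="taylor X p K2", unfolded c',
      OF _ 2 3 4 5 6 7 taylor_K1[OF p] taylor_K0[OF p] 8 9 10 i]
  have R': "j < 3 \<Longrightarrow> fps_deriv (c i j 0) - taylor X p K0 * c i j 3 = c (Suc i) j 0 + c i (Suc j) 0"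
    "j < 3 \<Longrightarrow> fps_deriv (c i j 1) + c i j 0 + taylor X p K1 * c i j 3 = c (Suc i) j 1 + c i (Suc j) 1"
    "j < 3 \<Longrightarrow> fps_deriv (c i j 2) + c i j 1 - taylor X p K2 * c i j 3 = c (Suc i) j 2 + c i (Suc j) 2"
    "j < 3 \<Longrightarrow> fps_deriv (c i j 3) + c i j 2 = c (Suc i) j 3 + c i (Suc j) 3" for j
    using R(1-4)[OF 1, where j=j] by blast+
  have R'': "fps_deriv (c i 3 0) - taylor X p K0 * c i 3 3 = c (Suc i) 3 0 +
      (- taylor X p K0 * c i 0 0 + taylor X p K1 * c i 1 0 - taylor X p K2 * c i 2 0 - 2 * taylor X p (dir_deriv (V i) K0))"
    "fps_deriv (c i 3 1) + c i 3 0 + taylor X p K1 * c i 3 3 = c (Suc i) 3 1 +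
      (- taylor X p K0 * c i 0 1 + taylor X p K1 * c i 1 1 - taylor X p K2 * c i 2 1 - 2 * z i 1)"
    "fps_deriv (c i 3 2) + c i 3 1 - taylor X p K2 * c i 3 3 = c (Suc i) 3 2 +
      (- taylor X p K0 * c i 0 2 + taylor X p K1 * c i 1 2 - taylor X p K2 * c i 2 2 - 2 * z i 0)"
    "fps_deriv (c i 3 3) + c i 3 2 = c (Suc i) 3 3 +
      (- taylor X p K0 * c i 0 3 + taylor X p K1 * c i 1 3 - taylor X p K2 * c i 2 3)"
    using R(5-8)[OF 1] by blast+
  note arg = arg_cong[of _ _ "\<lambda>f. fps_nth f 0"]
  have D: "fps_nth (fps_deriv (c i j k)) 0 = dir_deriv X (conn_coeff i j k) p" "fps_nth (c i j k) 0 = conn_coeff i j k p" for i j k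
    unfolding c_def taylor_dir_deriv[symmetric] by simp_all
  have z0: "fps_nth (z i 0) 0 = dir_deriv (V i) K2 p" "fps_nth (z i 1) 0 = - dir_deriv (V i) K1 p"
    unfolding z_def using dir_deriv_K1[OF p, of i] by (simp_all add: DK2_def)
  note S = D z0 fps_mult_nth_0 fps_add_nth fps_sub_nth fps_neg_nth taylor_nth_0
  show "j < 3 \<Longrightarrow> dir_deriv X (conn_coeff i j 0) p - K0 p * conn_coeff i j 3 p = conn_coeff (Suc i) j 0 p + conn_coeff i (Suc j) 0 p"
    using arg[OF R'(1)[of j]] by (simp only: S)
  show "j < 3 \<Longrightarrow> dir_deriv X (conn_coeff i j 1) p + conn_coeff i j 0 p + K1 p * conn_coeff i j 3 p = conn_coeff (Suc i) j 1 p + conn_coeff i (Suc j) 1 p"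
    using arg[OF R'(2)[of j]] by (simp only: S)
  show "j < 3 \<Longrightarrow> dir_deriv X (conn_coeff i j 2) p + conn_coeff i j 1 p - K2 p * conn_coeff i j 3 p = conn_coeff (Suc i) j 2 p + conn_coeff i (Suc j) 2 p"
    using arg[OF R'(3)[of j]] by (simp only: S)
  show "j < 3 \<Longrightarrow> dir_deriv X (conn_coeff i j 3) p + conn_coeff i j 2 p = conn_coeff (Suc i) j 3 p + conn_coeff i (Suc j) 3 p"
    using arg[OF R'(4)[of j]] by (simp only: S)
  show "dir_deriv X (conn_coeff i 3 0) p - K0 p * conn_coeff i 3 3 p = conn_coeff (Suc i) 3 0 p
      + (- K0 p * conn_coeff i 0 0 p + K1 p * conn_coeff i 1 0 p - K2 p * conn_coeff i 2 0 p - 2 * dir_deriv (V i) K0 p)"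
    using arg[OF R''(1)] by (simp only: S) simp
  show "dir_deriv X (conn_coeff i 3 1) p + conn_coeff i 3 0 p + K1 p * conn_coeff i 3 3 p = conn_coeff (Suc i) 3 1 p
      + (- K0 p * conn_coeff i 0 1 p + K1 p * conn_coeff i 1 1 p - K2 p * conn_coeff i 2 1 p + 2 * dir_deriv (V i) K1 p)"
    using arg[OF R''(2)] by (simp only: S) simp
  show "dir_deriv X (conn_coeff i 3 2) p + conn_coeff i 3 1 p - K2 p * conn_coeff i 3 3 p = conn_coeff (Suc i) 3 2 p
      + (- K0 p * conn_coeff i 0 2 p + K1 p * conn_coeff i 1 2 p - K2 p * conn_coeff i 2 2 p - 2 * dir_deriv (V i) K2 p)"
    using arg[OF R''(3)] by (simp only: S) simp
  show "dir_deriv X (conn_coeff i 3 3) p + conn_coeff i 3 2 p = conn_coeff (Suc i) 3 3 p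
      + (- K0 p * conn_coeff i 0 3 p + K1 p * conn_coeff i 1 3 p - K2 p * conn_coeff i 2 3 p)"
    using arg[OF R''(4)] by (simp only: S)
qed

definition nabla :: "nat \<Rightarrow> nat \<Rightarrow> jet \<Rightarrow> real^4" where
  "nabla i j q = (\<Sum>k<4. (conn_coeff i j k q / 2) *\<^sub>R v k q)"

lemma smooth_nabla: "smooth_on U (nabla i j)"
  unfolding nabla_def[abs_def]
  by (intro smooth_on_sum smooth_on_scaleR smooth_on_divide open_U smooth_v smooth_conn_coeff smooth_on_const) auto

lemma dir_deriv_X_nabla:
  assumes p: "p \<in> U"
  shows "dir_deriv X (nabla i j) p =
    ((dir_deriv X (conn_coeff i j 0) p - K0 p * conn_coeff i j 3 p) / 2) *\<^sub>R v 0 p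
    + ((dir_deriv X (conn_coeff i j 1) p + conn_coeff i j 0 p + K1 p * conn_coeff i j 3 p) / 2) *\<^sub>R v 1 p
    + ((dir_deriv X (conn_coeff i j 2) p + conn_coeff i j 1 p - K2 p * conn_coeff i j 3 p) / 2) *\<^sub>R v 2 p
    + ((dir_deriv X (conn_coeff i j 3) p + conn_coeff i j 2 p) / 2) *\<^sub>R v 3 p"
proof -
  have e: "Suc 0 = 1" "Suc 1 = 2" "Suc 2 = 3" "Suc 3 = 4" by simp_all
  have h: "smooth_on U (\<lambda>q. conn_coeff i j k q / 2)" if "k < 4" for k
    using that by (intro smooth_on_divide open_U smooth_conn_coeff smooth_on_const) auto
  have h': "dir_deriv X (\<lambda>q. conn_coeff i j k q / 2) p = dir_deriv X (conn_coeff i j k) p / 2" if "k < 4" for k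
    using dir_deriv_mult[OF differentiable[OF smooth_conn_coeff[OF that] p], of "\<lambda>_. 1 / 2"] by simp
  have "dir_deriv X (nabla i j) p = (\<Sum>k<4. dir_deriv X (\<lambda>q. (conn_coeff i j k q / 2) *\<^sub>R v k q) p)"
    unfolding nabla_def[abs_def]
    by (intro dir_deriv_sum differentiable[OF _ p] smooth_on_scaleR open_U h smooth_v) simp
  also have "\<dots> = (\<Sum>k<4. (dir_deriv X (conn_coeff i j k) p / 2) *\<^sub>R v k p + (conn_coeff i j k p / 2) *\<^sub>R v (Suc k) p)"
    using dir_deriv_scaleR[OF differentiable[OF h p] differentiable[OF smooth_v p]] h'
    by (intro sum.cong refl) (simp add: dir_deriv_X_v[OF p])
  also have "\<dots> = ((dir_deriv X (conn_coeff i j 0) p - K0 p * conn_coeff i j 3 p) / 2) *\<^sub>R v 0 p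
    + ((dir_deriv X (conn_coeff i j 1) p + conn_coeff i j 0 p + K1 p * conn_coeff i j 3 p) / 2) *\<^sub>R v 1 p
    + ((dir_deriv X (conn_coeff i j 2) p + conn_coeff i j 1 p - K2 p * conn_coeff i j 3 p) / 2) *\<^sub>R v 2 p
    + ((dir_deriv X (conn_coeff i j 3) p + conn_coeff i j 2 p) / 2) *\<^sub>R v 3 p"
    unfolding sum_lessThan_4 e v_4[OF p] by (simp add: algebra_simps add_divide_distrib diff_divide_distrib)
  finally show ?thesis .
qed

text \<open>The future value of the Christoffel symbols on \<open>v i\<close> and
  \<open>v j\<close>.\<close>

definition chris_coeff :: "nat \<Rightarrow> nat \<Rightarrow> jet \<Rightarrow> real^4" where
  "chris_coeff i j q = nabla i j q - dir_deriv (V i) (v j) q"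

lemma smooth_chris_coeff: "smooth_on U (chris_coeff i j)"
  unfolding chris_coeff_def[abs_def] by (intro smooth_on_diff open_U smooth_nabla smooth_dir_deriv_V smooth_v)

lemma chris_coeff_4: "p \<in> U \<Longrightarrow> chris_coeff 4 j p = - K0 p *\<^sub>R chris_coeff 0 j p + K1 p *\<^sub>R chris_coeff 1 j p - K2 p *\<^sub>R chris_coeff 2 j p"
  unfolding chris_coeff_def dir_deriv_V_4[OF differentiable[OF smooth_v]] nabla_def
  by (simp add: sum_lessThan_4 conn_coeff_4 algebra_simps add_divide_distrib diff_divide_distrib)

text \<open>Covariant and ordinary derivatives obey the same recursion, and for \<open>j = 3\<close>
  the derivatives of the \<open>K\<close>s occur in both and cancel. The difference therefore
  behaves like a constant tensor evaluated on the moving frame.\<close>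

lemma dir_deriv_X_chris_coeff:
  assumes p: "p \<in> U" and i: "i < 4"
  shows "j < 3 \<Longrightarrow> dir_deriv X (chris_coeff i j) p = chris_coeff i (Suc j) p + chris_coeff (Suc i) j p"
    and "dir_deriv X (chris_coeff i 3) p = (- K0 p *\<^sub>R chris_coeff i 0 p + K1 p *\<^sub>R chris_coeff i 1 p - K2 p *\<^sub>R chris_coeff i 2 p) + chris_coeff (Suc i) 3 p"
proof -
  have d: "dir_deriv X (chris_coeff i j) p = dir_deriv X (nabla i j) p - (dir_deriv (V (Suc i)) (v j) p + dir_deriv (V i) (v (Suc j)) p)" for j
    unfolding chris_coeff_def[abs_def]
    by (simp add: dir_deriv_diff differentiable smooth_nabla smooth_dir_deriv_V smooth_v p dir_deriv_X_V_v)
  show "dir_deriv X (chris_coeff i j) p = chris_coeff i (Suc j) p + chris_coeff (Suc i) j p" if "j < 3"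
    unfolding d dir_deriv_X_nabla[OF p] conn_coeff_recursion(1-4)[OF p i that]
    by (simp add: chris_coeff_def nabla_def sum_lessThan_4 add_divide_distrib algebra_simps)
  have e: "Suc 3 = 4" by simp
  show "dir_deriv X (chris_coeff i 3) p = (- K0 p *\<^sub>R chris_coeff i 0 p + K1 p *\<^sub>R chris_coeff i 1 p - K2 p *\<^sub>R chris_coeff i 2 p) + chris_coeff (Suc i) 3 p"
    unfolding d dir_deriv_X_nabla[OF p] conn_coeff_recursion(5-8)[OF p i] e dir_deriv_v_4[OF p]
    by (simp add: chris_coeff_def nabla_def sum_lessThan_4 add_divide_distrib diff_divide_distrib algebra_simps)
qed

text \<open>For a linear map with the values \<open>A i\<close> on \<open>v i\<close>,
  \<open>H i\<close> is the value on \<open>v i\<close> of its derivative along \<open>X\<close>: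
  the motion of the frame contributes \<open>A (i + 1)\<close>, which is cancelled by the change of
  the coordinates of the fixed vector \<open>u\<close>.\<close>

lemma dir_deriv_X_contraction:
  assumes p: "p \<in> U" and A: "\<And>i. i < 4 \<Longrightarrow> smooth_on U (A i)"
    and A': "\<And>i. i < 3 \<Longrightarrow> dir_deriv X (A i) p = A (Suc i) p + H i"
      "dir_deriv X (A 3) p = (- K0 p *\<^sub>R A 0 p + K1 p *\<^sub>R A 1 p - K2 p *\<^sub>R A 2 p) + H 3"
  shows "dir_deriv X (\<lambda>q. \<Sum>i<4. frame_coord v q i u *\<^sub>R A i q) p = (\<Sum>i<4. frame_coord v p i u *\<^sub>R H i)"
proof -
  have e: "Suc 0 = 1" "Suc 1 = 2" "Suc 2 = 3" by simp_all
  let ?c = "\<lambda>i. frame_coord v p i u"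
  have c: "smooth_on U (\<lambda>q. frame_coord v q i u)" for i by (rule smooth_coord[OF smooth_on_const])
  have "dir_deriv X (\<lambda>q. frame_coord v q k u) p = - shift p (\<lambda>i. ?c i) k" if "k < 4" for k
    using coord_dir_deriv_X[OF smooth_on_const p that, of u] linear_0[OF linear_frame_coord[OF frame_v p that]] by simp
  from this[of 0] this[of 1] this[of 2] this[of 3]
  have c': "dir_deriv X (\<lambda>q. frame_coord v q 0 u) p = K0 p * ?c 3" "dir_deriv X (\<lambda>q. frame_coord v q 1 u) p = - ?c 0 - K1 p * ?c 3"
    "dir_deriv X (\<lambda>q. frame_coord v q 2 u) p = - ?c 1 + K2 p * ?c 3" "dir_deriv X (\<lambda>q. frame_coord v q 3 u) p = - ?c 2"
    by (simp_all add: shift_def)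
  have a: "dir_deriv X (A 0) p = A 1 p + H 0" "dir_deriv X (A 1) p = A 2 p + H 1" "dir_deriv X (A 2) p = A 3 p + H 2"
    using A'(1)[of 0] A'(1)[of 1] A'(1)[of 2] unfolding e by simp_all
  have "dir_deriv X (\<lambda>q. \<Sum>i<4. frame_coord v q i u *\<^sub>R A i q) p =
      (\<Sum>i<4. dir_deriv X (\<lambda>q. frame_coord v q i u *\<^sub>R A i q) p)"
    by (intro dir_deriv_sum differentiable[OF _ p] smooth_on_scaleR open_U c A) simp
  also have "\<dots> = (\<Sum>i<4. dir_deriv X (\<lambda>q. frame_coord v q i u) p *\<^sub>R A i p + ?c i *\<^sub>R dir_deriv X (A i) p)"
    by (intro sum.cong refl dir_deriv_scaleR differentiable[OF _ p] c A) simp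
  also have "\<dots> = (\<Sum>i<4. ?c i *\<^sub>R H i)"
    unfolding sum_lessThan_4 c' A'(2) a by (simp add: algebra_simps)
  finally show ?thesis .
qed

definition christoffel_at :: "jet \<Rightarrow> real^4 \<Rightarrow> real^4 \<Rightarrow> real^4" where
  "christoffel_at p u w = (\<Sum>i<4. frame_coord v p i u *\<^sub>R (\<Sum>j<4. frame_coord v p j w *\<^sub>R chris_coeff i j p))"

lemma smooth_contraction: "smooth_on U (\<lambda>q. \<Sum>j<4. frame_coord v q j w *\<^sub>R chris_coeff i j q)"
  by (intro smooth_on_sum smooth_on_scaleR open_U smooth_coord smooth_on_const smooth_chris_coeff)

lemma smooth_christoffel_at: "smooth_on U (\<lambda>p. christoffel_at p u w)"
  unfolding christoffel_at_def
  by (intro smooth_on_sum[OF open_U] smooth_on_scaleR[OF open_U] smooth_coord smooth_on_const smooth_contraction)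

lemma dir_deriv_X_christoffel_at:
  assumes p: "p \<in> U"
  shows "dir_deriv X (\<lambda>p. christoffel_at p u w) p = 0"
proof -
  \<comment> \<open>Contracting the second slot leaves only the shift of the first index;
    contracting the first slot then leaves nothing.\<close>
  have A: "dir_deriv X (\<lambda>q. \<Sum>j<4. frame_coord v q j w *\<^sub>R chris_coeff i j q) p = (\<Sum>j<4. frame_coord v p j w *\<^sub>R chris_coeff (Suc i) j p)"
    if "i < 4" for i
    by (intro dir_deriv_X_contraction[OF p smooth_chris_coeff] dir_deriv_X_chris_coeff[OF p that])
  have e: "Suc 3 = 4" by simp
  have "dir_deriv X (\<lambda>p. christoffel_at p u w) p = (\<Sum>i<4. frame_coord v p i u *\<^sub>R 0)"
    unfolding christoffel_at_def
  proof (rule dir_deriv_X_contraction[OF p smooth_contraction])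
    show "dir_deriv X (\<lambda>q. \<Sum>j<4. frame_coord v q j w *\<^sub>R chris_coeff i j q) p = (\<Sum>j<4. frame_coord v p j w *\<^sub>R chris_coeff (Suc i) j p) + 0"
      if "i < 3" for i using A[of i] that by simp
    show "dir_deriv X (\<lambda>q. \<Sum>j<4. frame_coord v q j w *\<^sub>R chris_coeff 3 j q) p =
      - K0 p *\<^sub>R (\<Sum>j<4. frame_coord v p j w *\<^sub>R chris_coeff 0 j p) + K1 p *\<^sub>R (\<Sum>j<4. frame_coord v p j w *\<^sub>R chris_coeff 1 j p)
      - K2 p *\<^sub>R (\<Sum>j<4. frame_coord v p j w *\<^sub>R chris_coeff 2 j p) + 0"
      using A[of 3] unfolding e by (simp add: chris_coeff_4[OF p] sum_lessThan_4 algebra_simps)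
  qed
  then show ?thesis by simp
qed

lemma bilinear_christoffel_at:
  assumes p: "p \<in> U"
  shows "bilinear (christoffel_at p)"
  unfolding bilinear_def
proof (intro conjI allI)
  have lin: "linear (frame_coord v p i)" if "i < 4" for i by (rule linear_frame_coord[OF frame_v p that])
  show "linear (\<lambda>w. christoffel_at p u w)" for u
    using lin by (intro linearI) (simp_all add: christoffel_at_def linear_add linear_cmul sum_lessThan_4 algebra_simps)
  show "linear (\<lambda>u. christoffel_at p u w)" for w
    using lin by (intro linearI) (simp_all add: christoffel_at_def linear_add linear_cmul sum_lessThan_4 algebra_simps)
qed

lemma christoffel_at_v:
  assumes p: "p \<in> U" and i: "i < 4" and j: "j < 4"
  shows "christoffel_at p (v i p) (v j p) = chris_coeff i j p"
proof -
  have d: "(\<Sum>m<4. (if l = m then 1 else 0 :: real) *\<^sub>R f m) = f l" if "l < 4" for l and f :: "nat \<Rightarrow> real^4"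
  proof -
    have "(\<Sum>m<4. (if l = m then 1 else 0 :: real) *\<^sub>R f m) = (\<Sum>m<4. if m = l then f m else 0)"
      by (intro sum.cong) auto
    then show ?thesis using that by simp
  qed
  have "christoffel_at p (v i p) (v j p) =
      (\<Sum>i'<4. (if i = i' then 1 else 0) *\<^sub>R (\<Sum>j'<4. (if j = j' then 1 else 0) *\<^sub>R chris_coeff i' j' p))"
    unfolding christoffel_at_def using i j by (intro sum.cong refl) (simp add: frame_coord_v[OF p])
  then show ?thesis unfolding d[OF i] d[OF j] .
qed

end

section \<open>Sufficiency\<close>

text \<open>The coordinates of the two spanning vectors are \<open>s^k\<close> and
  \<open>k s^(k-1)\<close>. These span the solutions of the recurrence
  \<open>c (k+2) - 2 s c (k+1) + s^2 c k = 0\<close>, whose characteristic polynomial has the double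
  root \<open>s\<close>.\<close>

lemma span_rational_iff:
  assumes fr: "frame_on N E" and y: "y \<in> N"
  defines "c \<equiv> \<lambda>i w. frame_coord E y i w"
  shows "w \<in> span {rational_normal E s y, rational_tangent E s y} \<longleftrightarrow>
    s\<^sup>2 * c 0 w - 2 * s * c 1 w + c 2 w = 0 \<and> s\<^sup>2 * c 1 w - 2 * s * c 2 w + c 3 w = 0"
proof
  assume "w \<in> span {rational_normal E s y, rational_tangent E s y}"
  then obtain a b where ab: "w = a *\<^sub>R rational_normal E s y + b *\<^sub>R rational_tangent E s y"
    by (auto simp: span_insert span_singleton) (metis add.commute diff_add_cancel)
  have w: "w = (\<Sum>i<4. (if i = 0 then a else if i = 1 then a * s + b else if i = 2 then a * s\<^sup>2 + 2 * b * s
      else a * s ^ 3 + 3 * b * s\<^sup>2) *\<^sub>R E i y)"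
    unfolding ab rational_normal_eq rational_tangent_def by (simp add: sum_lessThan_4 algebra_simps)
  have "c 0 w = a" "c 1 w = a * s + b" "c 2 w = a * s\<^sup>2 + 2 * b * s" "c 3 w = a * s ^ 3 + 3 * b * s\<^sup>2"
    unfolding c_def by (simp_all add: frame_coord_unique[OF fr y w])
  then show "s\<^sup>2 * c 0 w - 2 * s * c 1 w + c 2 w = 0 \<and> s\<^sup>2 * c 1 w - 2 * s * c 2 w + c 3 w = 0"
    by (simp add: power2_eq_square power3_eq_cube algebra_simps)
next
  assume "s\<^sup>2 * c 0 w - 2 * s * c 1 w + c 2 w = 0 \<and> s\<^sup>2 * c 1 w - 2 * s * c 2 w + c 3 w = 0"
  then have c2: "c 2 w = 2 * s * c 1 w - s\<^sup>2 * c 0 w" and c3: "c 3 w = 2 * s * c 2 w - s\<^sup>2 * c 1 w" by auto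
  have "w = c 0 w *\<^sub>R E 0 y + c 1 w *\<^sub>R E 1 y + c 2 w *\<^sub>R E 2 y + c 3 w *\<^sub>R E 3 y"
    using frame_coord_expand[OF fr y, of w] by (simp add: c_def sum_lessThan_4)
  also have "\<dots> = c 0 w *\<^sub>R rational_normal E s y + (c 1 w - s * c 0 w) *\<^sub>R rational_tangent E s y"
    unfolding c3 c2 rational_normal_eq rational_tangent_def
    by (simp add: vec_eq_iff algebra_simps power2_eq_square power3_eq_cube)
  finally show "w \<in> span {rational_normal E s y, rational_tangent E s y}"
    by (metis (no_types, lifting) insertI1 insertI2 span_add span_base span_mul)
qed

text \<open>Being in the span is a polynomial condition on the parameter, so it may be tested on infinitely many values.\<close>

lemma span_rational_extend:
  assumes fr: "frame_on N E" and y: "y \<in> N" and T: "infinite T"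
    and span: "\<And>s. s \<in> T \<Longrightarrow> (\<Sum>i<4. s ^ i *\<^sub>R P i) \<in> span {rational_normal E s y, rational_tangent E s y}"
  shows "(\<Sum>i<4. s ^ i *\<^sub>R P i) \<in> span {rational_normal E s y, rational_tangent E s y}"
proof -
  define c where "c j w = frame_coord E y j w" for j w
  define p where "p j = [:c j (P 0), c j (P 1), c j (P 2), c j (P 3):]" for j
  have p: "poly (p j) s = c j (\<Sum>i<4. s ^ i *\<^sub>R P i)" if "j < 4" for j s
  proof -
    have "linear (c j)" unfolding c_def by (rule linear_frame_coord[OF fr y that])
    then show ?thesis
      by (simp add: p_def sum_lessThan_4 linear_add linear_cmul power2_eq_square power3_eq_cube algebra_simps)
  qed
  define q1 q2 where "q1 = [:0, 0, 1:] * p 0 - [:0, 2:] * p 1 + p 2" and "q2 = [:0, 0, 1:] * p 1 - [:0, 2:] * p 2 + p 3"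
  have iff: "(\<Sum>i<4. s ^ i *\<^sub>R P i) \<in> span {rational_normal E s y, rational_tangent E s y} \<longleftrightarrow> poly q1 s = 0 \<and> poly q2 s = 0" for s
    unfolding span_rational_iff[OF fr y] c_def[symmetric]
    by (simp add: q1_def q2_def p power2_eq_square algebra_simps)
  have "T \<subseteq> {s. poly q1 s = 0}" "T \<subseteq> {s. poly q2 s = 0}" using span iff by auto
  then have "q1 = 0" "q2 = 0" using T poly_roots_finite finite_subset by blast+
  then show ?thesis using iff by simp
qed

text \<open>A Taylor shift by \<open>- s\<close> followed by one by \<open>s\<close>, truncated at
  order three; \<open>c\<close> and \<open>d\<close> stand for \<open>s^2/2\<close> and
  \<open>s^3/6\<close>.\<close>

lemma cubic_shift:
  fixes u0 u1 u2 u3 :: "'a::real_vector"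
  assumes "s * s = 2 * c"
  shows "u0 - s *\<^sub>R u1 + c *\<^sub>R u2 - d *\<^sub>R u3 + s *\<^sub>R (u1 - s *\<^sub>R u2 + c *\<^sub>R u3) + c *\<^sub>R (u2 - s *\<^sub>R u3) + d *\<^sub>R u3 = u0"
proof -
  have "u0 - s *\<^sub>R u1 + c *\<^sub>R u2 - d *\<^sub>R u3 + s *\<^sub>R (u1 - s *\<^sub>R u2 + c *\<^sub>R u3) + c *\<^sub>R (u2 - s *\<^sub>R u3) + d *\<^sub>R u3 =
      u0 + (2 * c - s * s) *\<^sub>R u2"
    by (simp add: algebra_simps scaleR_2[symmetric])
  then show ?thesis by (simp add: assms)
qed

text \<open>A finite connected set of reals is at most a point, and a constant function has no
  nonzero derivative.\<close>

lemma continuous_image_infinite: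
  fixes f :: "real \<Rightarrow> real"
  assumes "open I" and "connected I" and "t0 \<in> I"
    and f: "\<And>t. t \<in> I \<Longrightarrow> (f has_real_derivative f' t) (at t)" and "f' t0 \<noteq> 0"
  shows "infinite (f ` I)"
proof
  assume fin: "finite (f ` I)"
  have "continuous_on I f" using f by (intro continuous_at_imp_continuous_on) (auto intro: DERIV_isCont)
  then have "connected (f ` I)" by (rule connected_continuous_image[OF _ assms(2)])
  with fin have "f ` I = {} \<or> (\<exists>x. f ` I = {x})" by (simp add: connected_finite_iff_sing)
  then have const: "f t = f t0" if "t \<in> I" for t
    using imageI[OF that, of f] imageI[OF assms(3), of f] by (metis empty_iff singletonD)
  have "(f has_real_derivative 0) (at t0)"
    by (rule DERIV_cong_ev[THEN iffD2, OF refl _ refl DERIV_const[of "f t0"]])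
      (use eventually_nhds assms(1,3) const in blast)
  then show False using DERIV_unique[OF f[OF assms(3)]] assms(5) by auto
qed

section \<open>Solutions as cubic curves, and the descent of the connection\<close>

context geodesic_ode
begin

text \<open>Repeated differentiation of \<open>v 0 = w 0 / k\<close> expresses \<open>v j\<close> by
  \<open>w 0\<close> to \<open>w j\<close>. Smoothness of the coefficients is part of the induction
  because they are differentiated again.\<close>

lemma scaled_frame_span:
  assumes f: "smooth_on U f" and f_nz: "\<And>q. q \<in> U \<Longrightarrow> f q \<noteq> 0" and k: "smooth_on U k" and k_nz: "\<And>q. q \<in> U \<Longrightarrow> k q \<noteq> 0"
    and w: "\<And>j. smooth_on U (w j)" and w_Suc: "\<And>j q. q \<in> U \<Longrightarrow> w (Suc j) q = f q *\<^sub>R dir_deriv X (w j) q"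
    and w_0: "\<And>q. q \<in> U \<Longrightarrow> w 0 q = k q *\<^sub>R v 0 q" and p: "p \<in> U"
  shows "span ((\<lambda>i. w i p) ` {..<4}) = UNIV"
proof -
  have "\<exists>a. (\<forall>i. smooth_on U (a i)) \<and> (\<forall>q\<in>U. v j q = (\<Sum>i\<le>j. a i q *\<^sub>R w i q))" for j
  proof (induction j)
    case 0
    have "smooth_on U (\<lambda>q. inverse (k q))" using k_nz by (intro smooth_on_inverse open_U k) auto
    then show ?case using w_0 k_nz by (intro exI[of _ "\<lambda>i q. inverse (k q)"]) simp
  next
    case (Suc j)
    then obtain a where a: "\<And>i. smooth_on U (a i)" and v: "\<And>q. q \<in> U \<Longrightarrow> v j q = (\<Sum>i\<le>j. a i q *\<^sub>R w i q)" by blast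
    \<comment> \<open>The derivative of \<open>w (i - 1)\<close> is \<open>w i / f\<close>, so each
      coefficient receives its own derivative and its predecessor divided by
      \<open>f\<close>.\<close>
    define b where "b i q = (if i \<le> j then dir_deriv X (a i) q else 0) + (if i = 0 then 0 else a (i - 1) q / f q)" for i q
    have "smooth_on U (b i)" for i
    proof -
      have "smooth_on U (\<lambda>q. if i \<le> j then dir_deriv X (a i) q else 0)"
        using smooth_dir_deriv_X[OF a] by (cases "i \<le> j") simp_all
      moreover have "smooth_on U (\<lambda>q. if i = 0 then 0 else a (i - 1) q / f q)"
        using smooth_on_divide[OF open_U a f f_nz] by (cases "i = 0") simp_all
      ultimately show ?thesis unfolding b_def[abs_def] by (rule smooth_on_add[OF open_U])
    qed
    moreover have "v (Suc j) q = (\<Sum>i\<le>Suc j. b i q *\<^sub>R w i q)" if q: "q \<in> U" for q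
    proof -
      have "v (Suc j) q = dir_deriv X (\<lambda>q. \<Sum>i\<le>j. a i q *\<^sub>R w i q) q"
        unfolding dir_deriv_X_v[OF q, symmetric] by (intro dir_deriv_cong[OF open_U q] v)
      also have "\<dots> = (\<Sum>i\<le>j. dir_deriv X (\<lambda>q. a i q *\<^sub>R w i q) q)"
        by (intro dir_deriv_sum differentiable[OF _ q] smooth_on_scaleR open_U a w)
      also have "\<dots> = (\<Sum>i\<le>j. dir_deriv X (a i) q *\<^sub>R w i q + (a i q / f q) *\<^sub>R w (Suc i) q)"
        using dir_deriv_scaleR[OF differentiable[OF a q] differentiable[OF w q]] w_Suc[OF q] f_nz[OF q]
        by (intro sum.cong refl) simp
      also have "\<dots> = (\<Sum>i\<le>j. dir_deriv X (a i) q *\<^sub>R w i q) + (\<Sum>i\<le>j. (a i q / f q) *\<^sub>R w (Suc i) q)"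
        by (rule sum.distrib)
      also have "(\<Sum>i\<le>j. dir_deriv X (a i) q *\<^sub>R w i q) = (\<Sum>i\<le>Suc j. (if i \<le> j then dir_deriv X (a i) q else 0) *\<^sub>R w i q)"
        by simp
      also have "(\<Sum>i\<le>j. (a i q / f q) *\<^sub>R w (Suc i) q) = (\<Sum>i\<le>Suc j. (if i = 0 then 0 else a (i - 1) q / f q) *\<^sub>R w i q)"
        by (simp add: sum.atMost_Suc_shift del: sum.atMost_Suc)
      finally show ?thesis by (simp only: b_def scaleR_add_left sum.distrib)
    qed
    ultimately show ?case by blast
  qed
  then have ex: "\<exists>a. v j p = (\<Sum>i\<le>j. a i p *\<^sub>R w i p)" for j using p by metis
  have "v j p \<in> span ((\<lambda>i. w i p) ` {..<4})" if "j < 4" for j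
  proof -
    obtain a where v: "v j p = (\<Sum>i\<le>j. a i p *\<^sub>R w i p)" using ex by blast
    show ?thesis unfolding v using that by (intro span_sum span_mul span_base) auto
  qed
  then have "span ((\<lambda>i. v i p) ` {..<4}) \<subseteq> span ((\<lambda>i. w i p) ` {..<4})"
    by (intro span_minimal subspace_span) auto
  then show ?thesis using frame_v p by (auto simp: frame_on_def)
qed

text \<open>
  In a parameter \<open>s\<close> with \<open>ds/dt = 1/f\<close> the derivatives \<open>w j\<close> satisfy \<open>d/ds (w j) = w (j + 1)\<close> and
  \<open>w 4 = 0\<close>, so that \<open>w 0\<close> is a cubic polynomial in \<open>s\<close> along each solution.
\<close>

lemma rational_parameter:
  assumes fb: "flow_box W N I t0 \<gamma>"
    and f: "smooth_on U f" and f_nz: "\<And>q. q \<in> U \<Longrightarrow> f q \<noteq> 0"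
    and w: "\<And>j. smooth_on U (w j)" and w_Suc: "\<And>j q. q \<in> U \<Longrightarrow> w (Suc j) q = f q *\<^sub>R dir_deriv X (w j) q"
    and w_4: "\<And>q. q \<in> U \<Longrightarrow> w 4 q = 0" and y: "y \<in> N" and t: "t \<in> I"
  shows "\<exists>s. w 0 (\<gamma> y t) = rational_normal (\<lambda>i y. (1 / fact i) *\<^sub>R w i (\<gamma> y t0)) s y"
proof -
  have \<gamma>: "\<gamma> y \<tau> \<in> W" "\<gamma> y \<tau> \<in> U" if "\<tau> \<in> I" for \<tau> using fb y that by (auto simp: flow_box_def)
  \<comment> \<open>The antiderivative of \<open>1/f\<close> is taken on the compact interval
    between \<open>t0\<close> and \<open>t\<close>, which lies in \<open>I\<close>.\<close>
  define a b where "a = min t0 t" and "b = max t0 t"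
  have ab: "t0 \<in> {a..b}" "t \<in> {a..b}" by (auto simp: a_def b_def)
  have "closed_segment t0 t \<subseteq> I" using fb t by (auto simp: flow_box_def closed_segment_subset)
  then have abI: "{a..b} \<subseteq> I" by (auto simp: a_def b_def closed_segment_eq_real_ivl split: if_splits)
  have W: "W \<subseteq> U" using fb by (simp add: flow_box_def)
  have fd: "((\<lambda>\<tau>. f (\<gamma> y \<tau>)) has_vector_derivative dir_deriv X f (\<gamma> y \<tau>)) (at \<tau>)" if "\<tau> \<in> I" for \<tau>
    by (rule flow_box_has_vector_derivative[OF fb _ y that]) (use W differentiable[OF f] in blast)
  have "continuous_on {a..b} (\<lambda>\<tau>. 1 / f (\<gamma> y \<tau>))"
    using fd abI f_nz \<gamma> by (intro continuous_intros continuous_at_imp_continuous_on)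
      (auto intro: has_vector_derivative_continuous)
  then obtain S where S: "\<And>\<tau>. \<tau> \<in> {a..b} \<Longrightarrow> (S has_vector_derivative 1 / f (\<gamma> y \<tau>)) (at \<tau> within {a..b})"
    using antiderivative_continuous by blast
  define s where "s \<tau> = S \<tau> - S t0" for \<tau>
  have s: "(s has_real_derivative 1 / f (\<gamma> y \<tau>)) (at \<tau> within {a..b})" if "\<tau> \<in> {a..b}" for \<tau>
    using S[OF that] unfolding s_def has_real_derivative_iff_has_vector_derivative
    by (auto intro!: derivative_eq_intros)
  have w0: "w (4 + j) q = 0" if "q \<in> U" for j q
    using that
  proof (induction j arbitrary: q)
    case (Suc j)
    then show ?case
      using dir_deriv_0[where f="w (4 + j)" and X=X and c=0, OF open_U Suc.prems] w_Suc[OF Suc.prems, of "4 + j"] by simp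
  qed (simp add: w_4)
  have wd: "((\<lambda>\<tau>. w j (\<gamma> y \<tau>)) has_vector_derivative (1 / f (\<gamma> y \<tau>)) *\<^sub>R w (Suc j) (\<gamma> y \<tau>)) (at \<tau> within {a..b})"
    if "\<tau> \<in> {a..b}" for j \<tau>
  proof -
    have "\<tau> \<in> I" using that abI by blast
    have "((\<lambda>\<tau>. w j (\<gamma> y \<tau>)) has_vector_derivative dir_deriv X (w j) (\<gamma> y \<tau>)) (at \<tau>)"
      by (rule flow_box_has_vector_derivative[OF fb _ y \<open>\<tau> \<in> I\<close>]) (use W differentiable[OF w] in blast)
    moreover have "dir_deriv X (w j) (\<gamma> y \<tau>) = (1 / f (\<gamma> y \<tau>)) *\<^sub>R w (Suc j) (\<gamma> y \<tau>)"
      using w_Suc[OF \<gamma>(2)[OF \<open>\<tau> \<in> I\<close>]] f_nz[OF \<gamma>(2)[OF \<open>\<tau> \<in> I\<close>]] by simp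
    ultimately show ?thesis by (simp add: has_vector_derivative_at_within)
  qed
  \<comment> \<open>The Taylor polynomial of \<open>w j\<close> at \<tau> in the parameter
    \<open>s\<close>, evaluated at parameter value 0. Its derivative telescopes down to
    \<open>w (j + 4) = 0\<close>, so it is constant, with the value of \<open>w j\<close> at
    \<open>t0\<close>.\<close>
  define Q where "Q j \<tau> = w j (\<gamma> y \<tau>) - s \<tau> *\<^sub>R w (Suc j) (\<gamma> y \<tau>) + (s \<tau> * s \<tau> / 2) *\<^sub>R w (Suc (Suc j)) (\<gamma> y \<tau>)
    - (s \<tau> * s \<tau> * s \<tau> / 6) *\<^sub>R w (Suc (Suc (Suc j))) (\<gamma> y \<tau>)" for j \<tau>
  have "(Q j has_vector_derivative 0) (at \<tau> within {a..b})" if \<tau>: "\<tau> \<in> {a..b}" for j \<tau>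
  proof -
    have "\<gamma> y \<tau> \<in> U" using \<gamma> \<tau> abI by blast
    have 4: "w (Suc (Suc (Suc (Suc j)))) (\<gamma> y \<tau>) = 0" using w0[OF \<open>\<gamma> y \<tau> \<in> U\<close>, of j] by (simp add: numeral_eq_Suc)
    have 2: "((\<lambda>\<tau>. s \<tau> * s \<tau> / 2) has_real_derivative s \<tau> * (1 / f (\<gamma> y \<tau>))) (at \<tau> within {a..b})"
      by (auto intro!: derivative_eq_intros s[OF \<tau>])
    have 3: "((\<lambda>\<tau>. s \<tau> * s \<tau> * s \<tau> / 6) has_real_derivative (s \<tau> * s \<tau> / 2) * (1 / f (\<gamma> y \<tau>))) (at \<tau> within {a..b})"
      by (auto intro!: derivative_eq_intros s[OF \<tau>])
    note D = has_vector_derivative_diff[OF has_vector_derivative_add[OF has_vector_derivative_diff[OF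
        wd[OF \<tau>, of j] has_vector_derivative_scaleR[OF s[OF \<tau>] wd[OF \<tau>, of "Suc j"]]]
        has_vector_derivative_scaleR[OF 2 wd[OF \<tau>, of "Suc (Suc j)"]]]
        has_vector_derivative_scaleR[OF 3 wd[OF \<tau>, of "Suc (Suc (Suc j))"]]]
    show ?thesis
      unfolding Q_def[abs_def] by (rule D[THEN has_vector_derivative_eq_rhs]) (simp add: 4)
  qed
  then have "\<exists>c. \<forall>\<tau>\<in>{a..b}. Q j \<tau> = c" for j
    by (intro has_derivative_zero_constant) (auto simp: has_vector_derivative_def)
  then have Q: "Q j t = Q j t0" for j using ab by metis
  have s0: "s t0 = 0" by (simp add: s_def)
  let ?u = "\<lambda>j. w j (\<gamma> y t)" and ?s = "s t"
  have c: "w j (\<gamma> y t0) = ?u j - ?s *\<^sub>R ?u (Suc j) + (?s * ?s / 2) *\<^sub>R ?u (Suc (Suc j)) - (?s * ?s * ?s / 6) *\<^sub>R ?u (Suc (Suc (Suc j)))" for j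
    using Q[of j] by (simp add: Q_def s0)
  have n: "1 = Suc 0" "2 = Suc (Suc 0)" "3 = Suc (Suc (Suc 0))" by simp_all
  have u: "?u (Suc (Suc (Suc (Suc j)))) = 0" for j using w0[OF \<gamma>(2)[OF t], of j] by (simp add: numeral_eq_Suc)
  have half: "?s * ?s = 2 * (?s * ?s / 2)" by (simp only: times_divide_eq_right nonzero_mult_div_cancel_left zero_neq_numeral not_False_eq_True)
  note cs = cubic_shift[where d="?s * ?s * ?s / 6", OF half, of "?u 0" "?u (Suc 0)" "?u (Suc (Suc 0))" "?u (Suc (Suc (Suc 0)))"]
  have c0: "w 0 (\<gamma> y t0) = ?u 0 - ?s *\<^sub>R ?u (Suc 0) + (?s * ?s / 2) *\<^sub>R ?u (Suc (Suc 0)) - (?s * ?s * ?s / 6) *\<^sub>R ?u (Suc (Suc (Suc 0)))"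
    "w (Suc 0) (\<gamma> y t0) = ?u (Suc 0) - ?s *\<^sub>R ?u (Suc (Suc 0)) + (?s * ?s / 2) *\<^sub>R ?u (Suc (Suc (Suc 0)))"
    "w (Suc (Suc 0)) (\<gamma> y t0) = ?u (Suc (Suc 0)) - ?s *\<^sub>R ?u (Suc (Suc (Suc 0)))"
    "w (Suc (Suc (Suc 0))) (\<gamma> y t0) = ?u (Suc (Suc (Suc 0)))"
    using c[of 0] c[of "Suc 0"] c[of "Suc (Suc 0)"] c[of "Suc (Suc (Suc 0))"]
    unfolding u scaleR_zero_right diff_zero add_0_right by - assumption+
  have "rational_normal (\<lambda>i y. (1 / fact i) *\<^sub>R w i (\<gamma> y t0)) ?s y =
      w 0 (\<gamma> y t0) + ?s *\<^sub>R w (Suc 0) (\<gamma> y t0) + (?s * ?s / 2) *\<^sub>R w (Suc (Suc 0)) (\<gamma> y t0)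
      + (?s * ?s * ?s / 6) *\<^sub>R w (Suc (Suc (Suc 0))) (\<gamma> y t0)"
    unfolding rational_normal_eq by (simp add: fact_numeral power2_eq_square power3_eq_cube numeral_2_eq_2 numeral_3_eq_3)
  also have "\<dots> = w 0 (\<gamma> y t)"
    unfolding c0 by (rule cs)
  finally show ?thesis by (intro exI[of _ ?s]) (rule sym)
qed

text \<open>Total geodesy and the behaviour of \<nabla> (v 0) are read off from \<open>nabla\<close>
  along each solution. What remains is the cone condition for every parameter, also for those that
  the solutions inside \<open>W\<close> do not reach.\<close>

lemma connection_exists:
  assumes f: "smooth_on U f" and h: "smooth_on U h" and nz: "\<And>q. q \<in> U \<Longrightarrow> f q \<noteq> 0 \<and> h q \<noteq> 0"
    and ad4: "\<And>q. q \<in> U \<Longrightarrow> ad (\<lambda>q. f q *\<^sub>R X q) 4 (\<lambda>q. h q *\<^sub>R coord_field 3 q) q \<in> span {X q}"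
    and fb: "flow_box W N I t0 \<gamma>"
  obtains E \<Gamma> where "canonical_frame F W \<pi> E" and "paraconformal_connection E (\<pi> ` W) \<Gamma>"
    and "\<And>c a. totally_geodesic \<Gamma> {u. slice c a u \<in> W} (\<lambda>u. \<pi> (slice c a u))"
proof -
  have W: "open W" "W \<subseteq> U" and N: "open N" and I: "open I" "convex I" "t0 \<in> I"
    and \<gamma>: "\<And>y t. y \<in> N \<Longrightarrow> t \<in> I \<Longrightarrow> \<gamma> y t \<in> W \<and> \<pi> (\<gamma> y t) = y"
    and W\<gamma>: "\<And>p. p \<in> W \<Longrightarrow> \<pi> p \<in> N \<and> p $ 4 \<in> I \<and> \<gamma> (\<pi> p) (p $ 4) = p"
    and \<sigma>: "smooth_on N (\<lambda>y. \<gamma> y t0)"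
    using fb by (auto simp: flow_box_def)
  have image: "\<pi> ` W = N" by (rule flow_box_image[OF fb])
  have f_nz: "\<And>q. q \<in> U \<Longrightarrow> f q \<noteq> 0" using nz by blast
  interpret W: fourth_order_ode F g K0 K1 K2 W \<pi> by (rule restrict[OF W])
  obtain w where w: "\<And>j. smooth_on U (w j)" and w_Suc: "\<And>j q. q \<in> U \<Longrightarrow> w (Suc j) q = f q *\<^sub>R dir_deriv X (w j) q"
    and w_0': "\<And>q. q \<in> U \<Longrightarrow> w 0 q = h q *\<^sub>R frechet_derivative \<pi> (at q) (coord_field 3 q)"
    and w_0: "\<And>q. q \<in> U \<Longrightarrow> w 0 q = (h q / g q) *\<^sub>R v 0 q" and w_4: "\<And>q. q \<in> U \<Longrightarrow> w 4 q = 0"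
    using scaled_projection[OF f h ad4] by metis
  define k where "k q = h q / g q" for q
  have k: "smooth_on U k" unfolding k_def using g_nz by (intro smooth_on_divide open_U h smooth_g)
  have k_nz: "k q \<noteq> 0" if "q \<in> U" for q using nz[OF that] g_nz[OF that] by (simp add: k_def)
  have w0: "w 0 q = k q *\<^sub>R v 0 q" if "q \<in> U" for q using w_0[OF that] by (simp add: k_def)
  \<comment> \<open>The coefficients of the cubic \<open>w 0\<close> in the parameter that is 0 at
    \<open>t0\<close>.\<close>
  define E where "E i y = (1 / fact i) *\<^sub>R w i (\<gamma> y t0)" for i y
  have \<gamma>0: "(\<lambda>y. \<gamma> y t0) ` N \<subseteq> U" using \<gamma> I W by blast
  have E_smooth: "smooth_on N (E i)" for i
    unfolding E_def[abs_def]
    by (rule smooth_on_scaleR[OF N smooth_on_const smooth_on_compose[OF N \<gamma>0 \<sigma> w]])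
  have E_span: "span ((\<lambda>i. E i y) ` {..<4}) = UNIV" if y: "y \<in> N" for y
  proof -
    have "\<gamma> y t0 \<in> U" using \<gamma>0 y by blast
    have sp: "span ((\<lambda>i. w i (\<gamma> y t0)) ` {..<4}) = UNIV"
      by (rule scaled_frame_span[OF f f_nz k k_nz w w_Suc w0 \<open>\<gamma> y t0 \<in> U\<close>])
    have "w i (\<gamma> y t0) \<in> span ((\<lambda>i. E i y) ` {..<4})" if "i < 4" for i
    proof -
      have "w i (\<gamma> y t0) = fact i *\<^sub>R E i y" by (simp add: E_def)
      also have "\<dots> \<in> span ((\<lambda>i. E i y) ` {..<4})" using that by (intro span_mul span_base) auto
      finally show ?thesis .
    qed
    then have "span ((\<lambda>i. w i (\<gamma> y t0)) ` {..<4}) \<subseteq> span ((\<lambda>i. E i y) ` {..<4})"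
      by (intro span_minimal subspace_span) auto
    then show ?thesis unfolding sp by (rule top.extremum_uniqueI)
  qed
  have E_frame: "frame_on N E" unfolding frame_on_def using E_smooth E_span by blast
  have E_pi: "frame_on W (\<lambda>i p. E i (\<pi> p))"
    by (rule W.frame_on_compose_pi) (use E_smooth E_span in \<open>auto simp: image\<close>)
  \<comment> \<open>In the frame \<open>E\<close> the vector \<open>w 0\<close> has the coordinates
    1, \<open>s\<close>, \<open>s^2\<close>, \<open>s^3\<close>, so the one of index 1 is the
    parameter itself and is smooth, whereas \<open>rational_parameter\<close> asserts mere
    existence.\<close>
  define s where "s p = frame_coord (\<lambda>i p. E i (\<pi> p)) p 1 (w 0 p)" for p
  have s_smooth: "smooth_on W s"
    unfolding s_def by (rule smooth_on_frame_coord[OF W(1) E_pi smooth_on_subset[OF w W(2)]])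
  have R: "w 0 p = rational_normal E (s p) (\<pi> p)" if p: "p \<in> W" for p
  proof -
    obtain r where r: "w 0 p = rational_normal E r (\<pi> p)"
      using rational_parameter[OF fb f f_nz w w_Suc w_4, of "\<pi> p" "p $ 4"] W\<gamma>[OF p] unfolding E_def[abs_def] by auto
    then have "w 0 p = (\<Sum>i<4. r ^ i *\<^sub>R E i (\<pi> p))" by (simp add: rational_normal_def)
    from frame_coord_unique[OF E_pi p this, of 1] have "s p = r" by (simp add: s_def)
    then show ?thesis using r by simp
  qed
  have "canonical_frame F W \<pi> E"
    unfolding canonical_frame_def image
  proof (intro conjI allI impI ballI)
    show "solution_space F W \<pi>" by (rule flow_box_solution_space[OF fb])
    show "smooth_on N (E i)" for i by (rule E_smooth)
    show "span ((\<lambda>i. E i y) ` {..<4}) = UNIV" if "y \<in> N" for y by (rule E_span[OF that])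
    show "\<exists>s. frechet_derivative \<pi> (at p) (coord_field 3 p) \<in> span {rational_normal E s (\<pi> p)}" if p: "p \<in> W" for p
    proof -
      have "p \<in> U" using p W by blast
      then have "frechet_derivative \<pi> (at p) (coord_field 3 p) = (1 / h p) *\<^sub>R rational_normal E (s p) (\<pi> p)"
        using w_0' nz unfolding R[OF p, symmetric] by simp
      then show ?thesis by (metis span_base span_mul singletonI)
    qed
  qed
  \<comment> \<open>Taken from the section \<open>t = t0\<close>; by \<open>\<Gamma>_pi\<close> any
    other point of the same solution gives the same symbols.\<close>
  define \<Gamma> where "\<Gamma> y u w = christoffel_at (\<gamma> y t0) u w" for y u w
  have \<Gamma>_pi: "\<Gamma> (\<pi> p) = christoffel_at p" if p: "p \<in> W" for p
  proof (intro ext)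
    fix u z
    have "christoffel_at p u z = christoffel_at (\<gamma> (\<pi> p) t0) u z"
      by (rule flow_box_constant[OF fb _ _ p])
        (use W differentiable[OF smooth_christoffel_at] dir_deriv_X_christoffel_at in blast)+
    then show "\<Gamma> (\<pi> p) u z = christoffel_at p u z" by (simp add: \<Gamma>_def)
  qed
  have conn: "connection_on N \<Gamma>"
    unfolding connection_on_def
  proof (intro conjI ballI allI)
    show "bilinear (\<Gamma> y)" if "y \<in> N" for y
    proof -
      have "\<gamma> y t0 \<in> U" using \<gamma>0 that by blast
      then show ?thesis unfolding \<Gamma>_def[abs_def] by (rule bilinear_christoffel_at)
    qed
    show "smooth_on N (\<lambda>y. \<Gamma> y u w)" for u w
      unfolding \<Gamma>_def by (rule smooth_on_compose[OF N \<gamma>0 \<sigma> smooth_christoffel_at])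
  qed
  have nabla_eq: "dir_deriv (V i) (v j) p + \<Gamma> (\<pi> p) (v i p) (v j p) = nabla i j p" if "p \<in> W" "i < 4" "j < 4" for p i j
  proof -
    have "p \<in> U" using that W by blast
    then show ?thesis using that by (simp add: \<Gamma>_pi christoffel_at_v chris_coeff_def)
  qed
  have geo: "totally_geodesic \<Gamma> {u. slice c a u \<in> W} (\<lambda>u. \<pi> (slice c a u))" for c a
  proof (rule W.totally_geodesicI)
    show "bilinear (\<Gamma> (\<pi> q))" if "q \<in> W" for q using conn that image by (auto simp: connection_on_def)
    show "frame_coord v q 3 (dir_deriv (V i) (v j) q + \<Gamma> (\<pi> q) (v i q) (v j q)) = 0" if q: "q \<in> W" and "i < 3" "j < 3" for q i j
    proof -
      have i: "i = 0 \<or> i = 1 \<or> i = 2" and j: "j = 0 \<or> j = 1 \<or> j = 2" using that by auto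
      have n: "dir_deriv (V i) (v j) q + \<Gamma> (\<pi> q) (v i q) (v j q) = (\<Sum>k<4. (conn_coeff i j k q / 2) *\<^sub>R v k q)"
        using nabla_eq[OF q, of i j] that by (simp add: nabla_def)
      have "frame_coord v q 3 (dir_deriv (V i) (v j) q + \<Gamma> (\<pi> q) (v i q) (v j q)) = conn_coeff i j 3 q / 2"
        by (rule frame_coord_unique[OF W.frame_v q n]) simp
      also have "conn_coeff i j 3 q = 0"
        unfolding conn_coeff_def using i j by (elim disjE) (simp_all only: connection_coeff_simps, simp_all)
      finally show ?thesis by simp
    qed
  qed
  have para0: "dir_deriv (\<lambda>_. A) (v 0) p + \<Gamma> (\<pi> p) (frechet_derivative \<pi> (at p) A) (v 0 p) \<in> span {v 0 p, v 1 p}"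
    if p: "p \<in> W" and A: "A = (\<Sum>i<4. e i *\<^sub>R V i p)" for p A e
  proof -
    have pU: "p \<in> U" using p W by blast
    have lin: "linear (frechet_derivative (v 0) (at p))" by (intro linear_frechet_derivative differentiable smooth_v pU)
    have lin': "linear (\<lambda>u. \<Gamma> (\<pi> p) u (v 0 p))" unfolding \<Gamma>_pi[OF p] using bilinear_christoffel_at[OF pU] by (simp add: bilinear_def)
    have "dir_deriv (\<lambda>_. A) (v 0) p + \<Gamma> (\<pi> p) (frechet_derivative \<pi> (at p) A) (v 0 p) =
        (\<Sum>i<4. e i *\<^sub>R (dir_deriv (V i) (v 0) p + \<Gamma> (\<pi> p) (v i p) (v 0 p)))"
      unfolding A pi_V_sum[OF pU]
      by (simp add: dir_deriv_def linear_sum[OF lin] linear_cmul[OF lin] linear_sum[OF lin'] linear_cmul[OF lin']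
        sum.distrib scaleR_add_right)
    also have "\<dots> = (\<Sum>i<4. e i *\<^sub>R nabla i 0 p)"
      by (intro sum.cong refl arg_cong[of _ _ "scaleR _"] nabla_eq[OF p]) simp_all
    also have "\<dots> \<in> span {v 0 p, v 1 p}"
    proof (intro span_sum span_mul)
      fix i
      have "nabla i 0 p = (conn_coeff i 0 0 p / 2) *\<^sub>R v 0 p + (conn_coeff i 0 1 p / 2) *\<^sub>R v 1 p"
        unfolding nabla_def sum_lessThan_4 by (simp only: conn_coeff_def connection_coeff_simps) simp
      also have "\<dots> \<in> span {v 0 p, v 1 p}" by (intro span_add span_mul; rule span_base; simp)
      finally show "nabla i 0 p \<in> span {v 0 p, v 1 p}" .
    qed
    finally show ?thesis .
  qed
  have E_smooth': "\<And>i. i < 4 \<Longrightarrow> smooth_on (\<pi> ` W) (E i)" using E_smooth image by simp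
  have wW: "smooth_on W (w j)" for j by (rule smooth_on_subset[OF w W(2)])
  have kW: "smooth_on W k" by (rule smooth_on_subset[OF k W(2)])
  have D: "dir_deriv Y (w 0) p = dir_deriv Y s p *\<^sub>R rational_tangent E (s p) (\<pi> p)
      + dir_deriv (\<lambda>_. dir_deriv Y \<pi> p) (rational_normal E (s p)) (\<pi> p)" if p: "p \<in> W" for Y p
  proof -
    have "dir_deriv Y (w 0) p = dir_deriv Y (\<lambda>q. rational_normal E (s q) (\<pi> q)) p"
      by (intro dir_deriv_cong[OF W(1) p] R)
    then show ?thesis using W.dir_deriv_rational_normal[where Y=Y, OF E_smooth' s_smooth p] by simp
  qed
  have D': "dir_deriv Y (w 0) p = dir_deriv Y k p *\<^sub>R v 0 p + k p *\<^sub>R dir_deriv Y (v 0) p" if p: "p \<in> W" for Y p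
  proof -
    have pU: "p \<in> U" using p W by blast
    have "dir_deriv Y (w 0) p = dir_deriv Y (\<lambda>q. k q *\<^sub>R v 0 q) p"
      by (intro dir_deriv_cong[OF open_U pU] w0)
    then show ?thesis using dir_deriv_scaleR[OF differentiable[OF k pU] differentiable[OF smooth_v pU]] by simp
  qed
  have lin_rn: "linear (frechet_derivative (rational_normal E r) (at y))" if y: "y \<in> N" for r y
  proof -
    have "rational_normal E r differentiable (at y)"
      unfolding rational_normal_def[abs_def]
      using smooth_on_imp_differentiable[OF E_smooth y] by (intro differentiable_sum) auto
    then show ?thesis by (rule linear_frechet_derivative)
  qed
  have X_s: "k p *\<^sub>R v 1 p + dir_deriv X k p *\<^sub>R v 0 p = dir_deriv X s p *\<^sub>R rational_tangent E (s p) (\<pi> p)" if p: "p \<in> W" for p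
  proof -
    have pU: "p \<in> U" using p W by blast
    have "\<pi> p \<in> N" using W\<gamma>[OF p] by blast
    then have "dir_deriv (\<lambda>_. dir_deriv X \<pi> p) (rational_normal E (s p)) (\<pi> p) = 0"
      unfolding dir_deriv_X_pi[OF pU] using linear_0[OF lin_rn] by (simp add: dir_deriv_def)
    then show ?thesis using D[OF p, of X] D'[OF p, of X] dir_deriv_X_v[OF pU, of 0] by (simp add: add.commute)
  qed
  have X_s_nz: "dir_deriv X s p \<noteq> 0" if p: "p \<in> W" for p
  proof
    have pU: "p \<in> U" using p W by blast
    assume "dir_deriv X s p = 0"
    then have "k p *\<^sub>R v 1 p + dir_deriv X k p *\<^sub>R v 0 p = 0" using X_s[OF p] by simp
    then have "0 = (\<Sum>i<4. (if i = 0 then dir_deriv X k p else if i = 1 then k p else 0) *\<^sub>R v i p)"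
      by (simp add: sum_lessThan_4 add.commute)
    from frame_coord_unique[OF frame_v pU this, of 1] have "frame_coord v p 1 0 = k p" by simp
    moreover have "frame_coord v p 1 0 = 0" using linear_0[OF linear_frame_coord[OF frame_v pU, of 1]] by simp
    ultimately show False using k_nz[OF pU] by simp
  qed
  have span_v: "span {v 0 p, v 1 p} \<subseteq> span {rational_normal E (s p) (\<pi> p), rational_tangent E (s p) (\<pi> p)}" if p: "p \<in> W" for p
  proof (intro span_minimal subspace_span)
    let ?R = "rational_normal E (s p) (\<pi> p)" and ?R' = "rational_tangent E (s p) (\<pi> p)"
    have pU: "p \<in> U" using p W by blast
    have "v 0 p = (1 / k p) *\<^sub>R ?R" unfolding R[OF p, symmetric] w0[OF pU] using k_nz[OF pU] by simp
    also have "\<dots> \<in> span {?R, ?R'}" by (intro span_mul span_base) simp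
    finally have v0: "v 0 p \<in> span {?R, ?R'}" .
    have "v 1 p = (1 / k p) *\<^sub>R (dir_deriv X s p *\<^sub>R ?R' - dir_deriv X k p *\<^sub>R v 0 p)"
      unfolding X_s[OF p, symmetric] using k_nz[OF pU] by simp
    also have "\<dots> \<in> span {?R, ?R'}"
      using v0 by (intro span_mul span_diff) (auto intro: span_base)
    finally have "v 1 p \<in> span {?R, ?R'}" .
    with v0 show "{v 0 p, v 1 p} \<subseteq> span {?R, ?R'}" by simp
  qed
  have "paraconformal_connection E N \<Gamma>"
    unfolding paraconformal_connection_def
  proof (intro conjI allI impI ballI)
    show "connection_on N \<Gamma>" by (rule conn)
    fix Y :: "real^4 \<Rightarrow> real^4" and r y assume y: "y \<in> N"
    have lin: "linear (\<Gamma> y (Y y))" using conn y by (auto simp: connection_on_def bilinear_def)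
    define P where "P i = dir_deriv Y (E i) y + \<Gamma> y (Y y) (E i y)" for i
    have cov: "cov_deriv \<Gamma> Y (rational_normal E r) y = (\<Sum>i<4. r ^ i *\<^sub>R P i)" for r
    proof -
      have dE: "E i differentiable (at y)" for i by (rule smooth_on_imp_differentiable[OF E_smooth y])
      have "dir_deriv Y (rational_normal E r) y = (\<Sum>i<4. r ^ i *\<^sub>R dir_deriv Y (E i) y)"
        unfolding rational_normal_def[abs_def] using dE by (subst dir_deriv_sum) (auto simp: dir_deriv_scaleR)
      moreover have "\<Gamma> y (Y y) (rational_normal E r y) = (\<Sum>i<4. r ^ i *\<^sub>R \<Gamma> y (Y y) (E i y))"
        unfolding rational_normal_def by (simp add: linear_sum[OF lin] linear_cmul[OF lin])
      ultimately show ?thesis by (simp add: cov_deriv_def P_def sum.distrib scaleR_add_right)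
    qed
    \<comment> \<open>The parameters met by the solution over \<open>y\<close>. They are infinitely
      many because the parameter moves, so a condition polynomial in \<open>r\<close> is decided on
      \<open>T\<close>.\<close>
    define T where "T = (\<lambda>t. s (\<gamma> y t)) ` I"
    have "infinite T"
      unfolding T_def
    proof (rule continuous_image_infinite[OF I(1) convex_connected[OF I(2)] I(3)])
      show "((\<lambda>t. s (\<gamma> y t)) has_real_derivative dir_deriv X s (\<gamma> y t)) (at t)" if "t \<in> I" for t
        unfolding has_real_derivative_iff_has_vector_derivative
        using smooth_on_imp_differentiable[OF s_smooth] by (intro flow_box_has_vector_derivative[OF fb _ y that])
      show "dir_deriv X s (\<gamma> y t0) \<noteq> 0" using \<gamma>[OF y I(3)] by (intro X_s_nz) simp
    qed
    moreover have "(\<Sum>i<4. r ^ i *\<^sub>R P i) \<in> span {rational_normal E r y, rational_tangent E r y}" if rT: "r \<in> T" for r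
    proof -
      obtain t where t: "t \<in> I" "r = s (\<gamma> y t)" using rT by (auto simp: T_def)
      define p where "p = \<gamma> y t"
      have p: "p \<in> W" and py: "\<pi> p = y" and r: "r = s p" using \<gamma>[OF y t(1)] t(2) by (auto simp: p_def)
      have pU: "p \<in> U" using p W by blast
      \<comment> \<open>A lift of \<open>Y y\<close> to the point of the solution with parameter
        \<open>r\<close>; there \<open>?R\<close> is a multiple of \<open>v 0\<close> and
        \<open>para0\<close> applies.\<close>
      define A where "A = (\<Sum>i<4. frame_coord v p i (Y y) *\<^sub>R V i p)"
      have A: "frechet_derivative \<pi> (at p) A = Y y"
        unfolding A_def pi_V_sum[OF pU] by (rule frame_coord_expand[OF frame_v pU])
      let ?R = "rational_normal E r y" and ?R' = "rational_tangent E r y"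
      have "dir_deriv (\<lambda>_. dir_deriv (\<lambda>_. A) \<pi> p) (rational_normal E (s p)) (\<pi> p) = dir_deriv Y (rational_normal E r) y"
        by (simp add: dir_deriv_def A py r)
      then have "cov_deriv \<Gamma> Y (rational_normal E r) y = dir_deriv (\<lambda>_. A) (w 0) p
          - dir_deriv (\<lambda>_. A) s p *\<^sub>R ?R' + \<Gamma> y (Y y) ?R"
        using D[OF p, of "\<lambda>_. A"] by (simp add: cov_deriv_def py r)
      also have "?R = k p *\<^sub>R v 0 p" using R[OF p] w0[OF pU] by (simp add: py r)
      also have "dir_deriv (\<lambda>_. A) (w 0) p - dir_deriv (\<lambda>_. A) s p *\<^sub>R ?R' + \<Gamma> y (Y y) (k p *\<^sub>R v 0 p) =
          dir_deriv (\<lambda>_. A) k p *\<^sub>R v 0 p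
          + k p *\<^sub>R (dir_deriv (\<lambda>_. A) (v 0) p + \<Gamma> (\<pi> p) (frechet_derivative \<pi> (at p) A) (v 0 p))
          - dir_deriv (\<lambda>_. A) s p *\<^sub>R ?R'"
        unfolding D'[OF p] A py linear_cmul[OF lin] by (simp add: algebra_simps)
      also have "\<dots> \<in> span {?R, ?R'}"
      proof -
        have sub: "span {v 0 p, v 1 p} \<subseteq> span {?R, ?R'}" using span_v[OF p] by (simp add: py r)
        have 1: "v 0 p \<in> span {?R, ?R'}" using sub span_base[of "v 0 p" "{v 0 p, v 1 p}"] by blast
        have 2: "dir_deriv (\<lambda>_. A) (v 0) p + \<Gamma> (\<pi> p) (frechet_derivative \<pi> (at p) A) (v 0 p) \<in> span {?R, ?R'}"
          using sub para0[OF p A_def] by blast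
        have 3: "?R' \<in> span {?R, ?R'}" by (intro span_base) simp
        show ?thesis
          by (rule span_diff[OF span_add[OF span_mul[OF 1] span_mul[OF 2]] span_mul[OF 3]])
      qed
      finally show ?thesis unfolding cov .
    qed
    ultimately have "(\<Sum>i<4. r ^ i *\<^sub>R P i) \<in> span {rational_normal E r y, rational_tangent E r y}"
      by (rule span_rational_extend[OF E_frame y])
    then show "cov_deriv \<Gamma> Y (rational_normal E r) y
        \<in> span {rational_normal E r y, vector_derivative (\<lambda>s. rational_normal E s y) (at r)}"
      unfolding cov vector_derivative_rational_normal .
  qed
  then show thesis using that[OF \<open>canonical_frame F W \<pi> E\<close> _ geo] image by simp
qed

end

section \<open>From local data to the equivalence on the whole domain\<close>

context fourth_order_ode
begin

lemma bryant_wuenschmannD: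
  assumes "bryant_wuenschmann F U" and "p \<in> U"
  shows "\<exists>W f h. open W \<and> p \<in> W \<and> W \<subseteq> U \<and> smooth_on W f \<and> smooth_on W h \<and> (\<forall>q\<in>W. f q \<noteq> 0 \<and> h q \<noteq> 0) \<and>
    (\<forall>q\<in>W. ad (\<lambda>q. f q *\<^sub>R X q) 4 (\<lambda>q. h q *\<^sub>R coord_field 3 q) q \<in> span {X q})"
  using assms(1)[unfolded bryant_wuenschmann_def, rule_format, OF assms(2)] unfolding X_def .

text \<open>The functions \<open>f\<close> and \<open>h\<close> exist only near each point, but the
  identities do not mention them and so hold on all of \<open>U\<close>.\<close>

lemma bryant_wuenschmann_imp_bw_ode:
  assumes "bryant_wuenschmann F U"
  shows "bw_ode F g K0 K1 K2 U \<pi>"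
proof
  fix p assume p: "p \<in> U"
  obtain W f h where W: "open W" "p \<in> W" "W \<subseteq> U" and f: "smooth_on W f" and h: "smooth_on W h"
    and nz: "\<And>q. q \<in> W \<Longrightarrow> f q \<noteq> 0 \<and> h q \<noteq> 0"
    and ad4: "\<And>q. q \<in> W \<Longrightarrow> ad (\<lambda>q. f q *\<^sub>R X q) 4 (\<lambda>q. h q *\<^sub>R coord_field 3 q) q \<in> span {X q}"
    using bryant_wuenschmannD[OF assms p] by blast
  interpret W: fourth_order_ode F g K0 K1 K2 W \<pi> by (rule restrict[OF W(1,3)])
  show "K1 p = - dir_deriv X K2 p"
    by (rule W.bryant_wuenschmann_identities(1)[OF f h nz ad4 W(2)])
  show "100 * K0 p = 9 * K2 p * K2 p - 30 * dir_deriv X K1 p"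
    by (rule W.bryant_wuenschmann_identities(2)[OF f h nz ad4 W(2)])
qed

lemma admits_imp:
  assumes adm: "admits_totally_geodesic_paraconformal_connection F U \<pi>" and p: "p \<in> U"
  shows "4 * DK2 1 0 p + 3 * DK2 0 1 p = 0"
proof -
  obtain W E \<Gamma> where W: "p \<in> W" "W \<subseteq> U" and cf: "canonical_frame F W \<pi> E"
    and pc: "paraconformal_connection E (\<pi> ` W) \<Gamma>"
    and geo: "\<And>c a. totally_geodesic \<Gamma> {u. slice c a u \<in> W} (\<lambda>u. \<pi> (slice c a u))"
    using adm p unfolding admits_totally_geodesic_paraconformal_connection_def by metis
  have "open W" using cf by (simp add: canonical_frame_def solution_space_def)
  then interpret W: fourth_order_ode F g K0 K1 K2 W \<pi> using W by (intro restrict)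
  show ?thesis
  proof (rule W.totally_geodesic_necessary[OF _ _ _ W(1)])
    show "connection_on (\<pi> ` W) \<Gamma>" using pc by (simp add: paraconformal_connection_def)
    show "dir_deriv (V i) (v 0) q + \<Gamma> (\<pi> q) (v i q) (v 0 q) \<in> span {v 0 q, v 1 q}" if "q \<in> W" for i q
      using W.paraconformal_imp[OF cf pc that, of "V i"] by (simp add: v_def)
    show "dir_deriv (V i) (v 2) q + \<Gamma> (\<pi> q) (v i q) (v 2 q) \<in> span {v 0 q, v 1 q, v 2 q}" if "q \<in> W" "i < 3" for i q
      by (rule W.totally_geodesic_imp[OF geo that])
  qed
qed

lemma admitsI:
  assumes bw: "bryant_wuenschmann F U" and main: "\<And>q. q \<in> U \<Longrightarrow> 4 * DK2 1 0 q + 3 * DK2 0 1 q = 0"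
  shows "admits_totally_geodesic_paraconformal_connection F U \<pi>"
  unfolding admits_totally_geodesic_paraconformal_connection_def
proof (intro conjI bw ballI)
  fix p assume p: "p \<in> U"
  interpret bw_ode F g K0 K1 K2 U \<pi> by (rule bryant_wuenschmann_imp_bw_ode[OF bw])
  obtain W f h where W: "open W" "p \<in> W" "W \<subseteq> U" and f: "smooth_on W f" and h: "smooth_on W h"
    and nz: "\<And>q. q \<in> W \<Longrightarrow> f q \<noteq> 0 \<and> h q \<noteq> 0"
    and ad4: "\<And>q. q \<in> W \<Longrightarrow> ad (\<lambda>q. f q *\<^sub>R X q) 4 (\<lambda>q. h q *\<^sub>R coord_field 3 q) q \<in> span {X q}"
    using bryant_wuenschmannD[OF bw p] by blast
  have "fourth_order_ode F g K0 K1 K2 W \<pi>" by (rule restrict[OF W(1,3)])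
  then interpret W: geodesic_ode F g K0 K1 K2 W \<pi>
    using K1_eq K0_eq main W(3)
    by (intro geodesic_ode.intro bw_ode.intro bw_ode_axioms.intro geodesic_ode_axioms.intro) blast+
  obtain W' N I t0 \<gamma> where fb: "W.flow_box W' N I t0 \<gamma>" and "p \<in> W'"
    using W.flow_box_exists[OF W(2)] by metis
  obtain E \<Gamma> where "canonical_frame F W' \<pi> E" "paraconformal_connection E (\<pi> ` W') \<Gamma>"
    "\<And>c a. totally_geodesic \<Gamma> {u. slice c a u \<in> W'} (\<lambda>u. \<pi> (slice c a u))"
    using W.connection_exists[OF f h nz ad4 fb] by metis
  moreover have "W' \<subseteq> U" using fb W(3) by (auto simp: W.flow_box_def)
  ultimately show "\<exists>W V \<Gamma>. p \<in> W \<and> W \<subseteq> U \<and> canonical_frame F W \<pi> V \<and> paraconformal_connection V (\<pi> ` W) \<Gamma> \<and>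
      (\<forall>c a. totally_geodesic \<Gamma> {u. slice c a u \<in> W} (\<lambda>u. \<pi> (slice c a u)))"
    using \<open>p \<in> W'\<close> by blast
qed

end

theorem theorem8p1:
  fixes F g K0 K1 K2 :: "jet \<Rightarrow> real" and U :: "jet set" and \<pi> :: "jet \<Rightarrow> real^4"
    and X :: "jet \<Rightarrow> jet" and V :: "nat \<Rightarrow> jet \<Rightarrow> jet"
  defines "X \<equiv> total_deriv F"
    and "V \<equiv> (\<lambda>j. ad X j (\<lambda>p. g p *\<^sub>R coord_field 3 p))"
  assumes "open U" and "smooth_on U F"
    and "solution_space F U \<pi>"
    and "smooth_on U g" and "\<forall>p\<in>U. g p \<noteq> 0"
    and "\<forall>p\<in>U. dir_deriv X g p = g p / 4 * dir_deriv (coord_field 3) F p"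
    and "\<forall>p\<in>U. V 4 p = - K0 p *\<^sub>R V 0 p + K1 p *\<^sub>R V 1 p - K2 p *\<^sub>R V 2 p"
  shows "(admits_totally_geodesic_paraconformal_connection F U \<pi> \<longleftrightarrow>
            bryant_wuenschmann F U \<and>
            (\<forall>p\<in>U. 4 * dir_deriv (V 1) K2 p + 3 * dir_deriv (V 0) (dir_deriv X K2) p = 0))
       \<and> (bryant_wuenschmann F U \<longrightarrow>
            (\<forall>p\<in>U. 4 * dir_deriv (V 1) K2 p + 3 * dir_deriv (V 0) (dir_deriv X K2) p
                 = 4 * dir_deriv (V 1) K2 p - 3 * dir_deriv (V 0) K1 p))"
proof -
  interpret L: fourth_order_ode F g K0 K1 K2 U \<pi>
    using assms(3-) unfolding X_def V_def solution_space_def by (intro fourth_order_ode.intro) blast+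
  have X: "L.X = X" by (simp add: L.X_def X_def)
  have V: "L.V = V" by (simp add: L.V_def[abs_def] V_def X)
  have DK2: "L.DK2 1 0 = dir_deriv (V 1) K2" "L.DK2 0 1 = dir_deriv (V 0) (dir_deriv X K2)"
    by (simp_all add: L.DK2_def X V)
  have "admits_totally_geodesic_paraconformal_connection F U \<pi> \<longleftrightarrow>
      bryant_wuenschmann F U \<and> (\<forall>p\<in>U. 4 * L.DK2 1 0 p + 3 * L.DK2 0 1 p = 0)"
    using L.admits_imp L.admitsI by (auto simp: admits_totally_geodesic_paraconformal_connection_def)
  \<comment> \<open>The second claim is \<open>K1 = - K2'\<close> differentiated along
    \<open>V 0\<close>.\<close>
  moreover have "dir_deriv (V 0) K1 p = - dir_deriv (V 0) (dir_deriv X K2) p" if "bryant_wuenschmann F U" "p \<in> U" for p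
  proof -
    interpret bw_ode F g K0 K1 K2 U \<pi> by (rule L.bryant_wuenschmann_imp_bw_ode[OF that(1)])
    show ?thesis using dir_deriv_K1[OF that(2), of 0] unfolding DK2 V .
  qed
  ultimately show ?thesis unfolding DK2 by simp
qed

end
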